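(* Let $f:U\to\mathbb R^2$ be an incircular net (IC-net), let $\omega$ be its net of incenters, and let $\eta$, $\tilde\eta$ be the two dual subnets of $\omega$ given by $$\eta_{kl}=\omega_{k-l,k+l},\ (k,l)\in\mathbb Z^2,\qquad \tilde\eta_{kl}=\omega_{k-l,k+l},\ (k,l)\in(\mathbb Z+\tfrac12)^2$$ (wherever defined). Then: (i) the edges of $\eta$ and $\tilde\eta$ are tangent to confocal conics, the points of tangency being the points of the IC-net $f$; (ii) each of the subnets $\eta,\tilde\eta$ consists of the intersection points of the diagonals of elementary quadrilaterals of the other subnet; (iii) both subnets are circular-conical, that is, opposite angles sum up to $\pi$ in each elementary quadrilateral and at each vertex-star; (iv) each pair of dual edges (one of $\eta$ and one of $\tilde\eta$) intersects orthogonally; (v) both subnets are (discrete) Koenigs nets.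
   Context: Let $U\subset\mathbb Z^2$ be a patch of the square grid (a product of two intervals of integers). A net $f:U\to\mathbb R^2$, $(i,j)\mapsto f_{ij}$, is an incircular net (IC-net) if (1) the points $f_{ij}$ with $i=\mathrm{const}$, respectively with $j=\mathrm{const}$, lie on straight lines, preserving the order; and (2) every elementary quadrilateral $(f_{ij},f_{i+1,j},f_{i+1,j+1},f_{i,j+1})$ has an incircle. It is known that all lines of an IC-net touch some conic $\alpha$, while all vertices on one diagonal $i+j=\mathrm{const}$, respectively $i-j=\mathrm{const}$, lie on a conic confocal to $\alpha$; these are the confocal conics in (i): at each point of $f$ where an edge of $\eta$ or $\tilde\eta$ passes, the edge is tangent there to the corresponding conic through that point. $\omega_{ij}$ denotes the incenter of the quadrilateral $(f_{ij},f_{i+1,j},f_{i+1,j+1},f_{i,j+1})$. The subnets $\eta$ and $\tilde\eta$ are nets with square grid combinatorics in the indices $(k,l)$ (edges join points whose indices differ by $(1,0)$ or $(0,1)$), on $\mathbb Z^2$ and the dual lattice $(\mathbb Z+\tfrac12)^2$. The edge of $\eta$ from $(k,l)$ to $(k+1,l)$ is dual to the edge of $\tilde\eta$ from $(k+\tfrac12,l-\tfrac12)$ to $(k+\tfrac12,l+\tfrac12)$; the edge of $\eta$ from $(k,l)$ to $(k,l+1)$ is dual to the edge of $\tilde\eta$ from $(k-\tfrac12,l+\tfrac12)$ to $(k+\tfrac12,l+\tfrac12)$. The vertex-star at an interior vertex consists of its four incident edges; the angles at it are the four angles between cyclically consecutive edges. A two-dimensional net $\boldsymbol x$ on a square lattice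 is a discrete Koenigs net if there exists a positive function $\nu$ on its vertices such that, with subscripts $(1),(2),(12)$ denoting shifts by $e_1$, $e_2$, $e_1+e_2$, and $\Delta_i\boldsymbol x=\boldsymbol x_{(i)}-\boldsymbol x$, $$\Delta_1\Delta_2\boldsymbol x=\frac{\nu_{(2)}\nu_{(12)}-\nu\nu_{(1)}}{\nu(\nu_{(1)}+\nu_{(2)})}\Delta_1\boldsymbol x+\frac{\nu_{(1)}\nu_{(12)}-\nu\nu_{(2)}}{\nu(\nu_{(1)}+\nu_{(2)})}\Delta_2\boldsymbol x .$$ Geometrically: the faces are planar and the intersection point $M$ of the diagonals of each elementary quadrilateral satisfies $\overrightarrow{\boldsymbol x_{(1)}M}:\overrightarrow{M\boldsymbol x_{(2)}}=\nu_{(1)}:\nu_{(2)}$ and $\overrightarrow{\boldsymbol xM}:\overrightarrow{M\boldsymbol x_{(12)}}=\nu:\nu_{(12)}$. *)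

theory Defs
  imports "HOL-Analysis.Analysis"
begin

section \<open>Incircular nets\<close>

text \<open>Possibly empty, bounded or unbounded.\<close>

definition int_interval :: "int set \<Rightarrow> bool" where
  "int_interval I \<longleftrightarrow> (\<forall>a\<in>I. \<forall>b\<in>I. {a..b} \<subseteq> I)"

definition on_line_in_order :: "int set \<Rightarrow> (int \<Rightarrow> real^2) \<Rightarrow> bool" where
  "on_line_in_order S p \<longleftrightarrow>
     (\<exists>a v t. v \<noteq> 0 \<and> strict_mono_on S t \<and> (\<forall>s\<in>S. p s = a + t s *\<^sub>R v))"

text \<open>The conditions say that the diagonals cross and that no three of the vertices,
  given in cyclic order, are collinear.\<close>

definition convex_quad :: "real^2 \<Rightarrow> real^2 \<Rightarrow> real^2 \<Rightarrow> real^2 \<Rightarrow> bool" where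
  "convex_quad A B C D \<longleftrightarrow>
     open_segment A C \<inter> open_segment B D \<noteq> {} \<and> \<not> collinear {A, B, C, D}"

definition circle_touches_side :: "real^2 \<Rightarrow> real \<Rightarrow> real^2 \<Rightarrow> real^2 \<Rightarrow> bool" where
  "circle_touches_side z r P Q \<longleftrightarrow>
     (\<exists>T\<in>closed_segment P Q. dist z T = r \<and> orthogonal (T - z) (Q - P))"

text \<open>A nondegenerate quadrilateral with a circle touching its four sides (as segments)
  from inside is automatically convex, so convexity is not an extra restriction.\<close>

definition incircle :: "real^2 \<Rightarrow> real^2 \<Rightarrow> real^2 \<Rightarrow> real^2 \<Rightarrow> real^2 \<Rightarrow> real \<Rightarrow> bool" where
  "incircle A B C D z r \<longleftrightarrow>
     convex_quad A B C D \<and> 0 < r \<and>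
     circle_touches_side z r A B \<and> circle_touches_side z r B C \<and>
     circle_touches_side z r C D \<and> circle_touches_side z r D A"

definition is_incenter :: "real^2 \<Rightarrow> real^2 \<Rightarrow> real^2 \<Rightarrow> real^2 \<Rightarrow> real^2 \<Rightarrow> bool" where
  "is_incenter A B C D z \<longleftrightarrow> (\<exists>r. incircle A B C D z r)"

definition cells :: "int set \<Rightarrow> int set \<Rightarrow> (int \<times> int) set" where
  "cells I J = {(i, j). i \<in> I \<and> i + 1 \<in> I \<and> j \<in> J \<and> j + 1 \<in> J}"

definition IC_net :: "int set \<Rightarrow> int set \<Rightarrow> (int \<Rightarrow> int \<Rightarrow> real^2) \<Rightarrow> bool" where
  "IC_net I J f \<longleftrightarrow>
     (\<forall>i\<in>I. on_line_in_order J (\<lambda>j. f i j)) \<and>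
     (\<forall>j\<in>J. on_line_in_order I (\<lambda>i. f i j)) \<and>
     (\<forall>(i, j)\<in>cells I J.
        \<exists>z r. incircle (f i j) (f (i + 1) j) (f (i + 1) (j + 1)) (f i (j + 1)) z r)"

definition net_of_incenters ::
    "int set \<Rightarrow> int set \<Rightarrow> (int \<Rightarrow> int \<Rightarrow> real^2) \<Rightarrow> (int \<Rightarrow> int \<Rightarrow> real^2) \<Rightarrow> bool" where
  "net_of_incenters I J f \<omega> \<longleftrightarrow>
     (\<forall>(i, j)\<in>cells I J.
        is_incenter (f i j) (f (i + 1) j) (f (i + 1) (j + 1)) (f i (j + 1)) (\<omega> i j))"


section \<open>The two dual subnets\<close>

text \<open>The second subnet lives on half-integer indices; \<open>etat \<omega> k l\<close> is its value at
  \<open>(k + 1/2, l + 1/2)\<close>, that is \<open>\<omega>\<close> at the index pair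
  \<open>((k + 1/2) - (l + 1/2), (k + 1/2) + (l + 1/2)) = (k - l, k + l + 1)\<close>.
  The sets \<open>eta_dom\<close> and \<open>etat_dom\<close> collect the \<open>(k, l)\<close> for which
  \<open>eta \<omega> k l\<close>, respectively \<open>etat \<omega> k l\<close>, is the incenter of an existing cell.\<close>

definition eta :: "(int \<Rightarrow> int \<Rightarrow> real^2) \<Rightarrow> int \<Rightarrow> int \<Rightarrow> real^2" where
  "eta \<omega> k l = \<omega> (k - l) (k + l)"

definition eta_dom :: "int set \<Rightarrow> int set \<Rightarrow> (int \<times> int) set" where
  "eta_dom I J = {(k, l). (k - l, k + l) \<in> cells I J}"

definition etat :: "(int \<Rightarrow> int \<Rightarrow> real^2) \<Rightarrow> int \<Rightarrow> int \<Rightarrow> real^2" where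
  "etat \<omega> k l = \<omega> (k - l) (k + l + 1)"

definition etat_dom :: "int set \<Rightarrow> int set \<Rightarrow> (int \<times> int) set" where
  "etat_dom I J = {(k, l). (k - l, k + l + 1) \<in> cells I J}"


section \<open>Nets on parts of the square lattice\<close>

definition quad_in :: "(int \<times> int) set \<Rightarrow> int \<Rightarrow> int \<Rightarrow> bool" where
  "quad_in V k l \<longleftrightarrow> {(k, l), (k + 1, l), (k + 1, l + 1), (k, l + 1)} \<subseteq> V"

definition star_in :: "(int \<times> int) set \<Rightarrow> int \<Rightarrow> int \<Rightarrow> bool" where
  "star_in V k l \<longleftrightarrow> {(k, l), (k + 1, l), (k, l + 1), (k - 1, l), (k, l - 1)} \<subseteq> V"

text \<open>The unoriented angle at \<open>q\<close> between the rays to \<open>p\<close> and \<open>r\<close>,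
  with values in \<open>[0, pi]\<close> for \<open>p \<noteq> q \<noteq> r\<close>.\<close>

definition angle :: "real^2 \<Rightarrow> real^2 \<Rightarrow> real^2 \<Rightarrow> real" where
  "angle p q r = arccos (((p - q) \<bullet> (r - q)) / (norm (p - q) * norm (r - q)))"

definition circular_conical ::
    "(int \<times> int) set \<Rightarrow> (int \<Rightarrow> int \<Rightarrow> real^2) \<Rightarrow> bool" where
  "circular_conical V x \<longleftrightarrow>
     (\<forall>k l. quad_in V k l \<longrightarrow>
        angle (x k (l + 1)) (x k l) (x (k + 1) l) +
        angle (x (k + 1) l) (x (k + 1) (l + 1)) (x k (l + 1)) = pi \<and>
        angle (x k l) (x (k + 1) l) (x (k + 1) (l + 1)) +
        angle (x (k + 1) (l + 1)) (x k (l + 1)) (x k l) = pi) \<and>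
     (\<forall>k l. star_in V k l \<longrightarrow>
        angle (x (k + 1) l) (x k l) (x k (l + 1)) +
        angle (x (k - 1) l) (x k l) (x k (l - 1)) = pi \<and>
        angle (x k (l + 1)) (x k l) (x (k - 1) l) +
        angle (x k (l - 1)) (x k l) (x (k + 1) l) = pi)"

definition koenigs_net ::
    "(int \<times> int) set \<Rightarrow> (int \<Rightarrow> int \<Rightarrow> real^2) \<Rightarrow> bool" where
  "koenigs_net V x \<longleftrightarrow>
     (\<exists>\<nu> :: int \<Rightarrow> int \<Rightarrow> real.
        (\<forall>(k, l)\<in>V. 0 < \<nu> k l) \<and>
        (\<forall>k l. quad_in V k l \<longrightarrow>
           x (k + 1) (l + 1) - x (k + 1) l - x k (l + 1) + x k l =
             ((\<nu> k (l + 1) * \<nu> (k + 1) (l + 1) - \<nu> k l * \<nu> (k + 1) l) /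
              (\<nu> k l * (\<nu> (k + 1) l + \<nu> k (l + 1)))) *\<^sub>R (x (k + 1) l - x k l) +
             ((\<nu> (k + 1) l * \<nu> (k + 1) (l + 1) - \<nu> k l * \<nu> k (l + 1)) /
              (\<nu> k l * (\<nu> (k + 1) l + \<nu> k (l + 1)))) *\<^sub>R (x k (l + 1) - x k l)))"

text \<open>Two edges cross in a common relative interior point, at a right angle.\<close>

definition cross_orthogonally :: "real^2 \<Rightarrow> real^2 \<Rightarrow> real^2 \<Rightarrow> real^2 \<Rightarrow> bool" where
  "cross_orthogonally a b c d \<longleftrightarrow>
     open_segment a b \<inter> open_segment c d \<noteq> {} \<and> orthogonal (b - a) (d - c)"


section \<open>Confocal conics\<close>

text \<open>Points of the plane are embedded in the projective plane by \<open>hom_pt\<close>; the vector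
  \<open>u = (a, b, c)\<close> stands for the line \<open>a x + b y + c = 0\<close>.\<close>

definition hom_pt :: "real^2 \<Rightarrow> real^3" where
  "hom_pt p = vector [p $ 1, p $ 2, 1]"

definition line_through :: "real^2 \<Rightarrow> real^2 \<Rightarrow> real^3" where
  "line_through p q = cross3 (hom_pt p) (hom_pt q)"

text \<open>A conic \<open>(A, B)\<close> is given by its point equation \<open>x\<^sup>T A x = 0\<close> together with its
  tangent line equation \<open>u\<^sup>T B u = 0\<close>. For a nondegenerate conic, \<open>B\<close> is the inverse of
  \<open>A\<close> up to a factor and carries no further information. In the degenerate limit cases
  (the classical complete conics) the product \<open>A B\<close> vanishes:

  \<^item> \<open>A\<close> is a double line, \<open>B\<close> a pair of points on it (a doubly covered segment; its lines are
    those through one of the two points);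
  \<^item> \<open>A\<close> is a pair of lines, \<open>B\<close> their doubly counted common point;
  \<^item> \<open>A\<close> is a double line, \<open>B\<close> a double point on it.

  They cannot be left out: the lines of an incircular net can be two families of parallel
  lines (rhombic nets) or pass through two points (their conic is the pair of foci), and
  confocal to a circle there are, besides the concentric circles, only the lines
  through its center.\<close>

type_synonym conic = "(real^3^3) \<times> (real^3^3)"

definition is_conic :: "conic \<Rightarrow> bool" where
  "is_conic Q \<longleftrightarrow> (case Q of (A, B) \<Rightarrow>
     A \<noteq> 0 \<and> B \<noteq> 0 \<and> transpose A = A \<and> transpose B = B \<and> (\<exists>\<mu>. A ** B = mat \<mu>))"

definition on_conic :: "real^2 \<Rightarrow> conic \<Rightarrow> bool" where
  "on_conic p Q \<longleftrightarrow> hom_pt p \<bullet> (fst Q *v hom_pt p) = 0"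

definition touches_conic :: "real^3 \<Rightarrow> conic \<Rightarrow> bool" where
  "touches_conic u Q \<longleftrightarrow> u \<bullet> (snd Q *v u) = 0"

text \<open>The line \<open>u\<close> touches the conic at the point \<open>p\<close>: it passes through \<open>p\<close>, it is the polar
  of \<open>p\<close>, and \<open>p\<close> is its pole. For a nondegenerate conic the last two conditions
  are equivalent. In the degenerate cases \<open>A p\<close> or \<open>B u\<close> may vanish, whence
  the factors \<open>\<kappa>\<close> may be zero. The conditions imply \<open>on_conic\<close> and \<open>touches_conic\<close>.\<close>

definition tangent_at :: "real^3 \<Rightarrow> real^2 \<Rightarrow> conic \<Rightarrow> bool" where
  "tangent_at u p Q \<longleftrightarrow>
     u \<noteq> 0 \<and> u \<bullet> hom_pt p = 0 \<and>
     (\<exists>\<kappa>. fst Q *v hom_pt p = \<kappa> *\<^sub>R u) \<and> (\<exists>\<kappa>. snd Q *v u = \<kappa> *\<^sub>R hom_pt p)"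

text \<open>The tangent line equation of the pair of circular points at infinity is
  \<open>a\<^sup>2 + b\<^sup>2 = 0\<close>. Conics are confocal if they have the same isotropic tangent lines (whose
  intersections are the foci), that is, if their tangent line equations lie in a common
  pencil with this one.  For \<open>x\<^sup>2 / a + y\<^sup>2 / b = 1\<close> one has \<open>B = diag (a, b, -1)\<close>, and the
  pencil is the familiar \<open>x\<^sup>2 / (a + \<tau>) + y\<^sup>2 / (b + \<tau>) = 1\<close>.\<close>

definition circular_pts :: "real^3^3" where
  "circular_pts = (\<chi> i j. if i = j \<and> i \<noteq> 3 then 1 else 0)"

definition confocal :: "conic \<Rightarrow> conic \<Rightarrow> bool" where
  "confocal Q Q' \<longleftrightarrow>
     (\<exists>s \<tau>. s \<noteq> 0 \<and> snd Q' = s *\<^sub>R snd Q + \<tau> *\<^sub>R circular_pts)"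

definition edge_touches_at :: "real^2 \<Rightarrow> real^2 \<Rightarrow> real^2 \<Rightarrow> conic \<Rightarrow> bool" where
  "edge_touches_at a b p Q \<longleftrightarrow> p \<in> open_segment a b \<and> tangent_at (line_through a b) p Q"

text \<open>\<open>\<alpha>\<close> is touched by all lines of the net, \<open>C c\<close> contains the vertices on the diagonal
  \<open>i + j = c\<close>, and \<open>D d\<close> those on the diagonal \<open>i - j = d\<close>. The premises
  \<open>j + 1 \<in> J\<close> and \<open>i + 1 \<in> I\<close> only serve to have two points spanning the line.\<close>

definition diagonal_conics ::
    "int set \<Rightarrow> int set \<Rightarrow> (int \<Rightarrow> int \<Rightarrow> real^2) \<Rightarrow>
     conic \<Rightarrow> (int \<Rightarrow> conic) \<Rightarrow> (int \<Rightarrow> conic) \<Rightarrow> bool" where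
  "diagonal_conics I J f \<alpha> C D \<longleftrightarrow>
     is_conic \<alpha> \<and>
     (\<forall>c. is_conic (C c) \<and> confocal \<alpha> (C c)) \<and>
     (\<forall>d. is_conic (D d) \<and> confocal \<alpha> (D d)) \<and>
     (\<forall>i\<in>I. \<forall>j\<in>J. j + 1 \<in> J \<longrightarrow> touches_conic (line_through (f i j) (f i (j + 1))) \<alpha>) \<and>
     (\<forall>i\<in>I. \<forall>j\<in>J. i + 1 \<in> I \<longrightarrow> touches_conic (line_through (f i j) (f (i + 1) j)) \<alpha>) \<and>
     (\<forall>i\<in>I. \<forall>j\<in>J. on_conic (f i j) (C (i + j)) \<and> on_conic (f i j) (D (i - j)))"

end

theory Submission
  imports Defs
begin

text \<open>
  Orient the lines of the two families by unit normals pointing in the direction of increasing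
  index. All these normals are \<open>(cos a\<^sub>i, \<plusminus> sin a\<^sub>i)\<close> and \<open>(cos b\<^sub>j, \<plusminus> sin b\<^sub>j)\<close> with one sign and with
  \<open>0 < b\<^sub>j - a\<^sub>i < \<pi>\<close> for all \<open>i, j\<close>. Then each edge of the two subnets is an angle bisector at
  a point of the net, with direction \<open>(a\<^sub>i + b\<^sub>j)/2\<close> up to a right angle, which gives (ii)--(iv).
  The ratios of the radii of neighbouring incircles are quotients of the numbers
  \<open>T\<^sub>i\<^sub>j = tan ((b\<^sub>j - a\<^sub>i)/2)\<close>, and closing up around a vertex gives
  \<open>T\<^sub>i\<^sub>,\<^sub>j\<^sub>+\<^sub>1 T\<^sub>i\<^sub>,\<^sub>j\<^sub>-\<^sub>1 = T\<^sub>i\<^sub>+\<^sub>1\<^sub>,\<^sub>j T\<^sub>i\<^sub>-\<^sub>1\<^sub>,\<^sub>j\<close>. The Koenigs function is the multiplicative potential of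
  the ratios in which the diagonals are divided; it exists by a trigonometric
  consequence of these vertex relations.

  For (i), let \<open>u\<^sub>i, v\<^sub>j\<close> be the line coordinate vectors. Five of them are isotropic for some
  symmetric \<open>B \<noteq> 0\<close>. The incircles and the vertex relations make all the others isotropic as well,
  and the incircles make \<open>u\<^sub>i B v\<^sub>j / (1 - n\<^sub>i \<bullet> p\<^sub>j)\<close> and \<open>u\<^sub>i B v\<^sub>j / (1 + n\<^sub>i \<bullet> p\<^sub>j)\<close>, with the normals
  \<open>n\<^sub>i, p\<^sub>j\<close>, constant on the diagonals \<open>i - j = const\<close> and \<open>i + j = const\<close>. These constants are
  the parameters of the confocal conics that the bisectors \<open>u\<^sub>i - v\<^sub>j\<close> and \<open>u\<^sub>i + v\<^sub>j\<close> touch.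
\<close>

section \<open>Trigonometry of the radius ratios\<close>

text \<open>Half angles are the natural coordinates because edges of the subnets are bisectors:
  directions become means of line angles, radii become products of half-angle sines and cosines. The
  obstacle in (v) is that the closing condition of the ratios involves four by four lines and is not
  a consequence of any single vertex relation. The four inner vertex relations together reduce to an
  equation tan \<alpha> tan \<beta> = tan \<alpha>' tan \<beta>' between half-gaps of the line
  angles. The obstacle in (i) is degeneracy. Isotropy of a bisector is a statement on
  \<open>B\<close> alone, but tangency at a given point also asks for a point equation
  \<open>A\<close>. The adjugate of the tangent line matrix supplies it unless that matrix has rank
  one, that is, describes a doubled point p. Then all bisectors of the diagonal pass through p.
  Consecutive ones also meet in an incenter, so they coincide unless p is this incenter, and that
  case is refuted by a comparison of signs. Five lines are a sufficient start because a symmetric 3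
  by 3 matrix has six entries.\<close>

text \<open>Where the tangents exist, the premise is tan p / tan q = tan s / tan r, and the
  conclusion compares difference over sum on both sides, cleared of denominators.\<close>

lemma sin_cos_cross_product:
  fixes p q r s :: real
  assumes "sin p * cos q * (sin r * cos s) = sin q * cos p * (sin s * cos r)"
  shows "sin (p - q) * sin (r + s) = sin (p + q) * sin (s - r)"
  using assms by (simp add: sin_add sin_diff algebra_simps)

text \<open>The premise \<open>star\<close> is the vertex relation at the four inner vertices of a 4 by 4 grid of lines.\<close>

lemma incenter_ratio_cycle:
  fixes a b :: "int \<Rightarrow> real"
  defines "S \<equiv> \<lambda>i j. sin ((b j - a i) / 2)" and "C \<equiv> \<lambda>i j. cos ((b j - a i) / 2)"
  assumes range: "\<And>i j. i \<in> {0..3} \<Longrightarrow> j \<in> {0..3} \<Longrightarrow> 0 < b j - a i \<and> b j - a i < pi"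
    and star: "\<And>i j. i \<in> {0..1} \<Longrightarrow> j \<in> {0..1} \<Longrightarrow>
      S (i+1) (j+2) * C (i+2) (j+1) * (S (i+1) j * C i (j+1)) =
      S (i+2) (j+1) * C (i+1) (j+2) * (S i (j+1) * C (i+1) j)"
  shows "C 0 1 * C 3 2 * (S 1 3 * S 2 0) = C 1 0 * C 2 3 * (S 3 1 * S 0 2)"
proof -
  have S: "0 < S i j" if "i \<in> {0..3}" "j \<in> {0..3}" for i j
    using range[OF that] unfolding S_def by (intro sin_gt_zero) auto
  have C: "0 < C i j" if "i \<in> {0..3}" "j \<in> {0..3}" for i j
    using range[OF that] unfolding C_def by (intro cos_gt_zero) auto
  define \<beta> \<beta>' \<alpha> \<alpha>' where
    "\<beta> = (b 2 - b 1) / 2" and "\<beta>' = (b 3 - b 0) / 2" and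
    "\<alpha> = (a 3 - a 0) / 2" and "\<alpha>' = (a 2 - a 1) / 2"
  define \<mu> e g where "\<mu> = (b 1 + b 2 - a 1 - a 2) / 2"
    and "e = (b 1 + b 2 + a 1 + a 2 - b 0 - b 3 - a 0 - a 3) / 4"
    and "g = (b 0 + b 1 + b 2 + b 3 - a 0 - a 1 - a 2 - a 3) / 4"
  note ds = \<beta>_def \<beta>'_def \<alpha>_def \<alpha>'_def \<mu>_def e_def g_def
  have s11: "S 1 2 * C 2 1 * (S 1 0 * C 0 1) = S 2 1 * C 1 2 * (S 0 1 * C 1 0)"
    using star[of 0 0] by (simp add: mult_ac)
  have s12: "S 1 1 * C 2 2 * (S 1 3 * C 0 2) = S 2 2 * C 1 1 * (S 0 2 * C 1 3)"
    using star[of 0 1] by (simp add: mult_ac)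
  have s21: "S 1 1 * C 2 2 * (S 3 1 * C 2 0) = S 2 2 * C 1 1 * (S 2 0 * C 3 1)"
    using star[of 1 0] by (simp add: mult_ac)
  have s22: "S 1 2 * C 2 1 * (S 3 2 * C 2 3) = S 2 1 * C 1 2 * (S 2 3 * C 3 2)"
    using star[of 1 1] by (simp add: mult_ac)
  \<comment> \<open>The relations at (1,1) and (2,2) have the same quotient of sines on one side; adding them as
    equal fractions removes \<open>e\<close> from the sines. Likewise for (1,2) and (2,1).\<close>
  have e1: "sin (\<beta> + \<alpha>') * sin (g + (\<alpha> + \<alpha>' - \<beta>' - \<beta>) / 2)
      = sin \<mu> * sin (e + (\<beta>' + \<alpha> - \<alpha>' - \<beta>) / 2)"
  proof -
    have *:
      "(b 2 - a 1) / 2 - (b 1 - a 2) / 2 = \<beta> + \<alpha>'"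
      "(b 0 - a 1) / 2 + (b 1 - a 0) / 2 = g + (\<alpha> + \<alpha>' - \<beta>' - \<beta>) / 2"
      "(b 2 - a 1) / 2 + (b 1 - a 2) / 2 = \<mu>"
      "(b 1 - a 0) / 2 - (b 0 - a 1) / 2 = e + (\<beta>' + \<alpha> - \<alpha>' - \<beta>) / 2"
      unfolding ds by (simp_all add: field_simps)
    show ?thesis
      using sin_cos_cross_product[of "(b 2 - a 1) / 2" "(b 1 - a 2) / 2" "(b 0 - a 1) / 2" "(b 1 - a 0) / 2"] s11
      unfolding * S_def C_def by (simp only: mult_ac)
  qed
  have e2: "sin (\<beta> + \<alpha>') * sin (g - (\<alpha> + \<alpha>' - \<beta>' - \<beta>) / 2)
      = sin \<mu> * sin ((\<beta>' + \<alpha> - \<alpha>' - \<beta>) / 2 - e)"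
  proof -
    have *:
      "(b 2 - a 1) / 2 - (b 1 - a 2) / 2 = \<beta> + \<alpha>'"
      "(b 2 - a 3) / 2 + (b 3 - a 2) / 2 = g - (\<alpha> + \<alpha>' - \<beta>' - \<beta>) / 2"
      "(b 2 - a 1) / 2 + (b 1 - a 2) / 2 = \<mu>"
      "(b 3 - a 2) / 2 - (b 2 - a 3) / 2 = (\<beta>' + \<alpha> - \<alpha>' - \<beta>) / 2 - e"
      unfolding ds by (simp_all add: field_simps)
    show ?thesis
      using sin_cos_cross_product[of "(b 2 - a 1) / 2" "(b 1 - a 2) / 2" "(b 2 - a 3) / 2" "(b 3 - a 2) / 2"] s22
      unfolding * S_def C_def by (simp only: mult_ac)
  qed
  have e3: "sin (\<alpha>' - \<beta>) * sin (g + (\<alpha> + \<alpha>' + \<beta>' + \<beta>) / 2)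
      = sin \<mu> * sin (e + (\<beta> - \<beta>' + \<alpha> - \<alpha>') / 2)"
  proof -
    have *:
      "(b 1 - a 1) / 2 - (b 2 - a 2) / 2 = \<alpha>' - \<beta>"
      "(b 3 - a 1) / 2 + (b 2 - a 0) / 2 = g + (\<alpha> + \<alpha>' + \<beta>' + \<beta>) / 2"
      "(b 1 - a 1) / 2 + (b 2 - a 2) / 2 = \<mu>"
      "(b 2 - a 0) / 2 - (b 3 - a 1) / 2 = e + (\<beta> - \<beta>' + \<alpha> - \<alpha>') / 2"
      unfolding ds by (simp_all add: field_simps)
    show ?thesis
      using sin_cos_cross_product[of "(b 1 - a 1) / 2" "(b 2 - a 2) / 2" "(b 3 - a 1) / 2" "(b 2 - a 0) / 2"] s12
      unfolding * S_def C_def by (simp only: mult_ac)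
  qed
  have e4: "sin (\<alpha>' - \<beta>) * sin (g - (\<alpha> + \<alpha>' + \<beta>' + \<beta>) / 2)
      = sin \<mu> * sin ((\<beta> - \<beta>' + \<alpha> - \<alpha>') / 2 - e)"
  proof -
    have *:
      "(b 1 - a 1) / 2 - (b 2 - a 2) / 2 = \<alpha>' - \<beta>"
      "(b 1 - a 3) / 2 + (b 0 - a 2) / 2 = g - (\<alpha> + \<alpha>' + \<beta>' + \<beta>) / 2"
      "(b 1 - a 1) / 2 + (b 2 - a 2) / 2 = \<mu>"
      "(b 0 - a 2) / 2 - (b 1 - a 3) / 2 = (\<beta> - \<beta>' + \<alpha> - \<alpha>') / 2 - e"
      unfolding ds by (simp_all add: field_simps)
    show ?thesis
      using sin_cos_cross_product[of "(b 1 - a 1) / 2" "(b 2 - a 2) / 2" "(b 1 - a 3) / 2" "(b 0 - a 2) / 2"] s21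
      unfolding * S_def C_def by (simp only: mult_ac)
  qed
  have e12: "sin (\<beta> + \<alpha>') * (sin g * cos ((\<alpha> + \<alpha>' - \<beta>' - \<beta>) / 2))
      = sin \<mu> * (cos e * sin ((\<beta>' + \<alpha> - \<alpha>' - \<beta>) / 2))"
    using e1 e2 by (simp add: sin_add sin_diff algebra_simps)
  have e34: "sin (\<alpha>' - \<beta>) * (sin g * cos ((\<alpha> + \<alpha>' + \<beta>' + \<beta>) / 2))
      = sin \<mu> * (cos e * sin ((\<beta> - \<beta>' + \<alpha> - \<alpha>') / 2))"
    using e3 e4 by (simp add: sin_add sin_diff algebra_simps)
  have "0 < g" "g < pi" "0 < \<mu>" "\<mu> < pi"
    using range[of 0 0] range[of 1 1] range[of 2 2] range[of 3 3]
    unfolding ds by simp_all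
  moreover have "- (pi / 2) < e" "e < pi / 2"
    using range[of 0 1] range[of 3 2] range[of 1 0] range[of 2 3]
    unfolding ds by simp_all
  ultimately have pos: "0 < sin g" "0 < sin \<mu>" "0 < cos e"
    by (simp_all add: sin_gt_zero cos_gt_zero_pi)
  \<comment> \<open>Multiplying \<open>e12\<close> crosswise with \<open>e34\<close> eliminates the
    mean positions; from here on only the half-gaps matter.\<close>
  have "(sin g * sin \<mu> * cos e) * (sin (\<beta> + \<alpha>') * (sin ((\<beta> - \<beta>' + \<alpha> - \<alpha>') / 2) * cos ((\<alpha> + \<alpha>' - \<beta>' - \<beta>) / 2)))
      = (sin g * sin \<mu> * cos e) * (sin (\<alpha>' - \<beta>) * (sin ((\<beta>' + \<alpha> - \<alpha>' - \<beta>) / 2) * cos ((\<alpha> + \<alpha>' + \<beta>' + \<beta>) / 2)))"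
    using arg_cong2[OF e12 e34[symmetric], of "(*)"] by (simp only: mult_ac)
  then have m: "sin (\<beta> + \<alpha>') * (sin ((\<beta> - \<beta>' + \<alpha> - \<alpha>') / 2) * cos ((\<alpha> + \<alpha>' - \<beta>' - \<beta>) / 2))
      = sin (\<alpha>' - \<beta>) * (sin ((\<beta>' + \<alpha> - \<alpha>' - \<beta>) / 2) * cos ((\<alpha> + \<alpha>' + \<beta>' + \<beta>) / 2))"
    using pos by simp
  have p1: "sin ((\<beta> - \<beta>' + \<alpha> - \<alpha>') / 2) * cos ((\<alpha> + \<alpha>' - \<beta>' - \<beta>) / 2)
      = (sin (\<alpha> - \<beta>') + sin (\<beta> - \<alpha>')) / 2"
  proof -
    have *: "(\<beta> - \<beta>' + \<alpha> - \<alpha>') / 2 + (\<alpha> + \<alpha>' - \<beta>' - \<beta>) / 2 = \<alpha> - \<beta>'" "(\<beta> - \<beta>' + \<alpha> - \<alpha>') / 2 - (\<alpha> + \<alpha>' - \<beta>' - \<beta>) / 2 = \<beta> - \<alpha>'"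
      by (simp_all add: field_simps)
    show ?thesis unfolding sin_times_cos * ..
  qed
  have p2: "sin ((\<beta>' + \<alpha> - \<alpha>' - \<beta>) / 2) * cos ((\<alpha> + \<alpha>' + \<beta>' + \<beta>) / 2)
      = (sin (\<alpha> + \<beta>') - sin (\<beta> + \<alpha>')) / 2"
  proof -
    have *: "(\<beta>' + \<alpha> - \<alpha>' - \<beta>) / 2 + (\<alpha> + \<alpha>' + \<beta>' + \<beta>) / 2 = \<alpha> + \<beta>'" "(\<beta>' + \<alpha> - \<alpha>' - \<beta>) / 2 - (\<alpha> + \<alpha>' + \<beta>' + \<beta>) / 2 = - (\<beta> + \<alpha>')"
      by (simp_all add: field_simps)
    show ?thesis unfolding sin_times_cos * sin_minus by (simp only: diff_conv_add_uminus)
  qed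
  have sn: "sin (\<alpha>' - \<beta>) = - sin (\<beta> - \<alpha>')"
    by (simp add: sin_diff)
  have alg: "x * P + z * R = 0" if "x * ((P + z) / 2) = - z * ((R - x) / 2)" for x z P R :: real
    using that by (simp add: field_simps)
  have "sin (\<beta> + \<alpha>') * sin (\<alpha> - \<beta>') + sin (\<beta> - \<alpha>') * sin (\<alpha> + \<beta>') = 0"
    by (rule alg[OF m[unfolded p1 p2 sn]])
  \<comment> \<open>This is tan \<alpha> tan \<beta> = tan \<alpha>' tan \<beta>' without
    denominators.\<close>
  then have "sin \<beta> * sin \<alpha> * (cos \<beta>' * cos \<alpha>') = sin \<beta>' * sin \<alpha>' * (cos \<beta> * cos \<alpha>)"
    by (simp add: sin_add sin_diff algebra_simps)
  then have cycle: "cos (\<beta> + \<alpha>) * cos (\<beta>' - \<alpha>') = cos (\<beta>' + \<alpha>') * cos (\<beta> - \<alpha>)"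
    by (simp add: cos_add cos_diff algebra_simps)
  \<comment> \<open>By the addition theorem each cosine in \<open>cycle\<close> is a product of two
    C plus a product of two S; the factors of the conclusion enter here.\<close>
  have c1: "C 0 2 * C 3 1 + S 0 2 * S 3 1 = cos (\<beta> + \<alpha>)"
    unfolding C_def S_def cos_diff[symmetric] by (rule arg_cong[of _ _ cos]) (simp add: ds field_simps)
  have c2: "C 2 0 * C 1 3 + S 2 0 * S 1 3 = cos (\<beta>' + \<alpha>')"
    unfolding C_def S_def cos_diff[symmetric] by (subst cos_minus[symmetric], rule arg_cong[of _ _ cos]) (simp add: ds field_simps)
  have c3: "C 2 3 * C 1 0 + S 2 3 * S 1 0 = cos (\<beta>' - \<alpha>')"
    unfolding C_def S_def cos_diff[symmetric] by (rule arg_cong[of _ _ cos]) (simp add: ds field_simps)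
  have c4: "C 3 2 * C 0 1 + S 3 2 * S 0 1 = cos (\<beta> - \<alpha>)"
    unfolding C_def S_def cos_diff[symmetric] by (rule arg_cong[of _ _ cos]) (simp add: ds field_simps)
  have t: "(S 0 2 * S 3 1) * (C 2 0 * C 1 3) = (S 2 0 * S 1 3) * (C 0 2 * C 3 1)"
  proof -
    have "(S 1 1 * C 1 1 * S 2 2 * C 2 2) * ((S 0 2 * S 3 1) * (C 2 0 * C 1 3))
       = (S 1 1 * C 1 1 * S 2 2 * C 2 2) * ((S 2 0 * S 1 3) * (C 0 2 * C 3 1))"
      using arg_cong2[OF s12[symmetric] s21, of "(*)"] by (simp only: mult_ac)
    then show ?thesis using S[of 1 1] S[of 2 2] C[of 1 1] C[of 2 2] by simp
  qed
  have t': "(S 2 3 * S 1 0) * (C 3 2 * C 0 1) = (S 3 2 * S 0 1) * (C 2 3 * C 1 0)"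
  proof -
    have "(S 1 2 * C 2 1 * S 2 1 * C 1 2) * ((S 2 3 * S 1 0) * (C 3 2 * C 0 1))
       = (S 1 2 * C 2 1 * S 2 1 * C 1 2) * ((S 3 2 * S 0 1) * (C 2 3 * C 1 0))"
      using arg_cong2[OF s11 s22[symmetric], of "(*)"] by (simp only: mult_ac)
    then show ?thesis using S[of 1 2] S[of 2 1] C[of 1 2] C[of 2 1] by simp
  qed
  \<comment> \<open>From Q : Q' = R : R' follows Q : R = (Q + Q') : (R + R'), and likewise for the
    second pair, so the equation between the sums descends to their summands.\<close>
  have key: "Q2 * Q' = R2 * R'"
    if "0 < Q" "0 < R" "0 < Q2" "0 < R2" "0 < Q'" "0 < R'" "0 < Q2'" "0 < R2'"
      "Q' * R = R' * Q" "Q2' * R2 = R2' * Q2"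
      "(Q + Q') * (Q2 + Q2') = (R + R') * (R2 + R2')"
    for Q R Q2 R2 Q' R' Q2' R2' :: real
  proof -
    have a: "Q * (R + R') = R * (Q + Q')" "Q2 * (R2 + R2') = R2 * (Q2 + Q2')"
      using that by (simp_all add: algebra_simps)
    have "(Q * Q2) * ((R + R') * (R2 + R2')) = (R * R2) * ((R + R') * (R2 + R2'))"
      using arg_cong2[OF a, of "(*)"] that(11) by (simp only: mult_ac)
    then have "Q * Q2 = R * R2" using that by simp
    then have "R * (Q2 * Q') = R * (R2 * R')"
      using that(9) by algebra
    then show ?thesis using that by simp
  qed
  have "C 2 3 * C 1 0 * (S 0 2 * S 3 1) = C 3 2 * C 0 1 * (S 2 0 * S 1 3)"
    by (rule key[OF _ _ _ _ _ _ _ _ t t' cycle[folded c1 c2 c3 c4]]) (simp_all add: S C)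
  then show ?thesis by (simp only: mult_ac)
qed

section \<open>Conics and lines in homogeneous coordinates\<close>

text \<open>This is the inner product of the normals of two lines. Passing to a confocal conic by
  adding \<open>\<tau> *\<^sub>R circular_pts\<close> changes the bilinear form by \<tau> times this
  product.\<close>

definition normal_product :: "real^3 \<Rightarrow> real^3 \<Rightarrow> real" where
  "normal_product u v = u \<bullet> (circular_pts *v v)"

text \<open>A linear relation with positive coefficients between the coordinates of the four oriented sides of
  a cell. The condition \<open>l + l' = m + m'\<close> expresses that there is an incircle: the sides
  \<open>u, v\<close> have signed distance \<open>r\<close> from its center, and \<open>u', v'\<close> have \<open>- r\<close>.\<close>

definition tangent_cell :: "real^3 \<Rightarrow> real^3 \<Rightarrow> real^3 \<Rightarrow> real^3 \<Rightarrow> bool" where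
  "tangent_cell u u' v v' \<longleftrightarrow>
     (\<exists>l l' m m'. 0 < l \<and> 0 < l' \<and> 0 < m \<and> 0 < m' \<and>
        l *\<^sub>R u + m' *\<^sub>R v' = l' *\<^sub>R u' + m *\<^sub>R v \<and> l + l' = m + m')"

text \<open>The coefficients l and l' merely change places. Reversing one family in this way lets an
  argument that adds a line on one side run towards the other side as well.\<close>

lemma tangent_cell_reverse: "tangent_cell u u' v v' \<Longrightarrow> tangent_cell (- u') (- u) v v'"
  unfolding tangent_cell_def by (auto simp: algebra_simps eq_diff_eq) (metis add.commute)

lemma bilinear_matrix: "bilinear (\<lambda>u v. u \<bullet> (B *v v))" for B :: "real^'n^'m"
  by (simp add: bilinear_def linear_iff inner_add_left inner_add_right matrix_vector_mult_add_rdistrib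
      matrix_vector_right_distrib matrix_vector_mult_scaleR)

lemma symmetric_matrix_inner: "u \<bullet> (B *v v) = v \<bullet> (B *v u)"
  if "transpose B = B" for B :: "real^'n^'n"
  using dot_lmul_matrix[of v B u] that by (metis inner_commute transpose_matrix_vector)

lemma form_add_square:
  assumes "bilinear \<phi>" "\<And>u v. \<phi> u v = \<phi> v u"
  shows "\<phi> (a *\<^sub>R u + b *\<^sub>R v) (a *\<^sub>R u + b *\<^sub>R v) = a\<^sup>2 * \<phi> u u + b\<^sup>2 * \<phi> v v + 2 * a * b * (\<phi> u v :: real)"
    "\<phi> (a *\<^sub>R u - b *\<^sub>R v) (a *\<^sub>R u - b *\<^sub>R v) = a\<^sup>2 * \<phi> u u + b\<^sup>2 * \<phi> v v - 2 * a * b * \<phi> u v"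
  using assms(2)[of v u]
  by (simp_all add: bilinear_ladd[OF assms(1)] bilinear_radd[OF assms(1)] bilinear_lsub[OF assms(1)]
      bilinear_rsub[OF assms(1)] bilinear_lmul[OF assms(1)] bilinear_rmul[OF assms(1)]
      power2_eq_square algebra_simps)

lemma normal_product_bilinear: "bilinear normal_product"
  and normal_product_commute: "normal_product u v = normal_product v u"
proof -
  show "bilinear normal_product"
    unfolding normal_product_def using bilinear_matrix[of circular_pts] .
  show "normal_product u v = normal_product v u"
    unfolding normal_product_def
    by (rule symmetric_matrix_inner) (simp add: transpose_def circular_pts_def vec_eq_iff)
qed

text \<open>The linear relation between the sides is squared twice, once as it stands and once with
  v and v' moved across, both under \<phi> and under \<open>normal_product\<close>; dividing the
  results removes the coefficients. The error caused by a non-isotropic u' has opposite signs in the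
  two equations.\<close>

lemma tangent_cell_form:
  assumes cell: "tangent_cell u u' v v'"
    and unit: "normal_product u u = 1" "normal_product u' u' = 1"
      "normal_product v v = 1" "normal_product v' v' = 1"
    and \<phi>: "bilinear \<phi>" "\<And>x y. \<phi> x y = \<phi> y x"
    and zero: "\<phi> u u = 0" "\<phi> v v = 0" "\<phi> v' v' = 0"
  obtains k k' :: real where "0 < k" "0 < k'"
    "\<phi> u v * (1 - normal_product u' v') = (\<phi> u' v' - k * \<phi> u' u') * (1 - normal_product u v)"
    "\<phi> u v' * (1 + normal_product u' v) = (\<phi> u' v + k' * \<phi> u' u') * (1 + normal_product u v')"
proof -
  obtain l l' m m' where pos: "0 < l" "0 < l'" "0 < m" "0 < m'"
    and eq: "l *\<^sub>R u + m' *\<^sub>R v' = l' *\<^sub>R u' + m *\<^sub>R v" and sum: "l + l' = m + m'"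
    using cell unfolding tangent_cell_def by auto
  have eq': "l *\<^sub>R u - m *\<^sub>R v = l' *\<^sub>R u' - m' *\<^sub>R v'"
    using eq by (simp add: algebra_simps)
  let ?n = normal_product
  note sq = form_add_square[OF \<phi>] and nsq = form_add_square[OF normal_product_bilinear normal_product_commute]
  have 1: "2 * l * m' * \<phi> u v' = l'\<^sup>2 * \<phi> u' u' + 2 * l' * m * \<phi> u' v"
    using sq(1)[of l u m' v'] sq(1)[of l' u' m v] unfolding eq zero by simp
  have 2: "- 2 * l * m * \<phi> u v = l'\<^sup>2 * \<phi> u' u' - 2 * l' * m' * \<phi> u' v'"
    using sq(2)[of l u m v] sq(2)[of l' u' m' v'] unfolding eq' zero by simp
  have "l\<^sup>2 + m'\<^sup>2 + 2 * l * m' * ?n u v' = l'\<^sup>2 + m\<^sup>2 + 2 * l' * m * ?n u' v"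
    using nsq(1)[of l u m' v'] nsq(1)[of l' u' m v] unfolding eq unit by simp
  \<comment> \<open>Here the incircle enters: the condition on the coefficient sums lets the pure
    squares cancel, leaving only mixed products.\<close>
  moreover have "l - m' = m - l'"
    using sum by linarith
  then have "(l - m')\<^sup>2 = (m - l')\<^sup>2" by simp
  ultimately have 3: "l * m' * (1 + ?n u v') = l' * m * (1 + ?n u' v)"
    by (simp add: power2_eq_square algebra_simps)
  have "l\<^sup>2 + m\<^sup>2 - 2 * l * m * ?n u v = l'\<^sup>2 + m'\<^sup>2 - 2 * l' * m' * ?n u' v'"
    using nsq(2)[of l u m v] nsq(2)[of l' u' m' v'] unfolding eq' unit by simp
  moreover have "l - m = m' - l'"
    using sum by linarith
  then have "(l - m)\<^sup>2 = (m' - l')\<^sup>2" by simp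
  ultimately have 4: "l * m * (1 - ?n u v) = l' * m' * (1 - ?n u' v')"
    by (simp add: power2_eq_square algebra_simps)
  have "(l * m) * (\<phi> u v * (1 - ?n u' v')) = (l * m) * ((\<phi> u' v' - l' / (2 * m') * \<phi> u' u') * (1 - ?n u v))"
  proof -
    have "(l * m) * ((\<phi> u' v' - l' / (2 * m') * \<phi> u' u') * (1 - ?n u v))
       = (\<phi> u' v' - l' / (2 * m') * \<phi> u' u') * (l' * m' * (1 - ?n u' v'))"
      unfolding 4[symmetric] by (simp only: mult_ac)
    also have "\<dots> = (l' * m' * \<phi> u' v' - l'\<^sup>2 / 2 * \<phi> u' u') * (1 - ?n u' v')"
      using pos by (simp add: field_simps power2_eq_square)
    also have "l' * m' * \<phi> u' v' - l'\<^sup>2 / 2 * \<phi> u' u' = l * m * \<phi> u v"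
      using 2 by (simp add: field_simps)
    finally show ?thesis by (simp only: mult_ac)
  qed
  moreover have "(l * m') * (\<phi> u v' * (1 + ?n u' v)) = (l * m') * ((\<phi> u' v + l' / (2 * m) * \<phi> u' u') * (1 + ?n u v'))"
  proof -
    have "(l * m') * ((\<phi> u' v + l' / (2 * m) * \<phi> u' u') * (1 + ?n u v'))
       = (\<phi> u' v + l' / (2 * m) * \<phi> u' u') * (l' * m * (1 + ?n u' v))"
      unfolding 3[symmetric] by (simp only: mult_ac)
    also have "\<dots> = (l' * m * \<phi> u' v + l'\<^sup>2 / 2 * \<phi> u' u') * (1 + ?n u' v)"
      using pos by (simp add: field_simps power2_eq_square)
    also have "l' * m * \<phi> u' v + l'\<^sup>2 / 2 * \<phi> u' u' = l * m' * \<phi> u v'"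
      using 1 by (simp add: field_simps)
    finally show ?thesis by (simp only: mult_ac)
  qed
  ultimately show ?thesis
    using that[of "l' / (2 * m')" "l' / (2 * m)"] pos by simp
qed

text \<open>Two ways around the middle cells compute \<open>\<phi> u2 v1\<close>. Because of \<open>star\<close> they agree only up to a
  multiple of \<open>\<phi> u2 u2\<close> whose factor is positive.\<close>

lemma tangent_line_extension:
  assumes cells: "tangent_cell u0 u1 v0 v1" "tangent_cell u0 u1 v1 v2"
      "tangent_cell u1 u2 v0 v1" "tangent_cell u1 u2 v1 v2"
    and unit: "\<forall>w\<in>{u0, u1, u2, v0, v1, v2}. normal_product w w = 1"
    and strict: "\<forall>u\<in>{u0, u1, u2}. \<forall>v\<in>{v0, v1, v2}. \<bar>normal_product u v\<bar> < 1"
    and star: "(1 - normal_product u1 v2) * (1 - normal_product u1 v0) *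
        ((1 + normal_product u2 v1) * (1 + normal_product u0 v1)) =
      (1 + normal_product u1 v2) * (1 + normal_product u1 v0) *
        ((1 - normal_product u2 v1) * (1 - normal_product u0 v1))"
    and \<phi>: "bilinear \<phi>" "\<And>x y. \<phi> x y = \<phi> y x"
    and zero: "\<forall>w\<in>{u0, u1, v0, v1, v2}. \<phi> w w = (0::real)"
  shows "\<phi> u2 u2 = 0"
proof -
  let ?n = normal_product
  have b: "\<bar>?n u v\<bar> < 1" if "u \<in> {u0, u1, u2}" "v \<in> {v0, v1, v2}" for u v
    using strict that by blast
  have p: "0 < 1 - ?n u v" "0 < 1 + ?n u v" if "u \<in> {u0, u1, u2}" "v \<in> {v0, v1, v2}" for u v
    using b[OF that] by linarith+
  \<comment> \<open>In the two cells between u0 and u1 all sides are isotropic, so the error terms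
    vanish; in the two cells next to u2 they remain.\<close>
  have k: "\<phi> u0 v1 * (1 + ?n u1 v0) = \<phi> u1 v0 * (1 + ?n u0 v1)"
    using tangent_cell_form[OF cells(1) _ _ _ _ \<phi>] unit zero by (metis insertCI mult_zero_right add_0_right)
  have k2: "\<phi> u0 v1 * (1 - ?n u1 v2) = \<phi> u1 v2 * (1 - ?n u0 v1)"
    using tangent_cell_form[OF cells(2) _ _ _ _ \<phi>] unit zero by (metis insertCI mult_zero_right diff_zero)
  obtain k3 where k3: "0 < k3"
    "\<phi> u1 v0 * (1 - ?n u2 v1) = (\<phi> u2 v1 - k3 * \<phi> u2 u2) * (1 - ?n u1 v0)"
    using tangent_cell_form[OF cells(3) _ _ _ _ \<phi>] unit zero by (metis insertCI)
  obtain k4 where k4: "0 < k4"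
    "\<phi> u1 v2 * (1 + ?n u2 v1) = (\<phi> u2 v1 + k4 * \<phi> u2 u2) * (1 + ?n u1 v2)"
    using tangent_cell_form[OF cells(4) _ _ _ _ \<phi>] unit zero by (metis insertCI)
  have alg: "x = 0"
    if "B01 * P10 = B10 * P01" "B01 * M12 = B12 * M01"
      "B10 * M21 = (B21 - k3 * x) * M10" "B12 * P21 = (B21 + k4 * x) * P12"
      "M12 * M10 * (P21 * P01) = P12 * P10 * (M21 * M01)"
      "0 < P10" "0 < P01" "0 < M12" "0 < M01" "0 < M21" "0 < M10" "0 < P21" "0 < P12" "0 < k3" "0 < k4"
    for B01 P10 B10 P01 M12 B12 M01 M21 B21 x M10 P21 P12 k3 k4 :: real
  proof -
    have "(P01 * M01 * M12 * P10) * (B10 * M21 * P12) = (P01 * M01 * M12 * P10) * (B12 * P21 * M10)"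
    proof -
      have "(P01 * M01 * M12 * P10) * (B10 * M21 * P12) = (B10 * P01) * M12 * (P12 * P10 * (M21 * M01))"
        by (simp only: mult_ac)
      also have "\<dots> = (B01 * M12) * P10 * (M12 * M10 * (P21 * P01))"
        unfolding that(1)[symmetric] that(5) by (simp only: mult_ac)
      also have "\<dots> = (P01 * M01 * M12 * P10) * (B12 * P21 * M10)"
        unfolding that(2) by (simp only: mult_ac)
      finally show ?thesis .
    qed
    then have "(B10 * M21) * P12 = (B12 * P21) * M10" using that by simp
    then have "(M10 * P12) * ((k3 + k4) * x) = 0"
      unfolding that(3,4) by (simp add: algebra_simps)
    then show ?thesis using that by simp
  qed
  show ?thesis
    by (rule alg[OF k k2 k3(2) k4(2) star]) (simp_all only: p k3(1) k4(1) insert_iff simp_thms)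
qed


section \<open>Conics with prescribed tangents, and point equations from tangent line
  equations\<close>

text \<open>Isotropy of a line is one homogeneous linear condition on the six entries of a symmetric
  matrix, and five conditions leave a nonzero solution.\<close>

lemma five_tangents_conic:
  fixes S :: "(real^3) set"
  assumes "finite S" "card S \<le> 5"
  obtains B :: "real^3^3" where "transpose B = B" "B \<noteq> 0" "\<And>u. u \<in> S \<Longrightarrow> u \<bullet> (B *v u) = 0"
proof -
  \<comment> \<open>The value \<open>u \<bullet> (B *v u)\<close> is the inner product of
    \<open>q u\<close> with the three diagonal and three off-diagonal entries of B; the latter occur
    twice, hence the factor 2.\<close>
  define q :: "real^3 \<Rightarrow> (real^3) \<times> (real^3)" where
    "q u = (vector [u$1 * u$1, u$2 * u$2, u$3 * u$3],
            vector [2 * u$2 * u$3, 2 * u$1 * u$3, 2 * u$1 * u$2])" for u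
  have "dim (q ` S) \<le> card (q ` S)"
    using assms by (intro dim_le_card') auto
  also have "\<dots> < DIM((real^3) \<times> (real^3))"
    using card_image_le[OF assms(1), of q] assms(2) by simp
  finally obtain z where z: "z \<noteq> 0" "\<And>y. y \<in> span (q ` S) \<Longrightarrow> orthogonal z y"
    using orthogonal_to_subspace_exists by blast
  obtain x y where xy: "z = (x, y)" by fastforce
  define B :: "real^3^3" where
    "B = vector [vector [x$1, y$3, y$2], vector [y$3, x$2, y$1], vector [y$2, y$1, x$3]]"
  show ?thesis
  proof
    show "transpose B = B"
      by (simp add: B_def transpose_def vec_eq_iff forall_3)
    show "B \<noteq> 0"
    proof
      assume "B = 0"
      then have "B $ i $ j = 0" for i j by simp
      from this[of 1 1] this[of 2 2] this[of 3 3] this[of 1 2] this[of 1 3] this[of 2 3]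
      have "x = 0" "y = 0" by (simp_all add: B_def vec_eq_iff forall_3)
      then show False using z(1) xy by (simp add: zero_prod_def)
    qed
    show "u \<bullet> (B *v u) = 0" if "u \<in> S" for u
    proof -
      have "z \<bullet> q u = 0"
        using z(2)[of "q u"] that by (simp add: orthogonal_def span_base)
      then show ?thesis
        by (simp add: xy q_def B_def inner_vec_def matrix_vector_mult_def sum_3 algebra_simps)
    qed
  qed
qed

text \<open>The rows are the cofactor rows, so this is the adjugate up to transposition, hence the
  adjugate itself for symmetric B.\<close>

definition adjugate3 :: "real^3^3 \<Rightarrow> real^3^3" where
  "adjugate3 B = vector [cross3 (B$2) (B$3), cross3 (B$3) (B$1), cross3 (B$1) (B$2)]"

definition outer :: "real^3 \<Rightarrow> real^3 \<Rightarrow> real^3^3" where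
  "outer p q = (\<chi> i j. p$i * q$j)"

lemma outer_mult_vec: "outer p q *v x = (q \<bullet> x) *\<^sub>R p"
  by (simp add: outer_def matrix_vector_mult_def inner_vec_def vec_eq_iff sum_3 algebra_simps)

lemma symmetric_matrix_swap: "B $ i $ j = B $ j $ i" if "transpose B = B" for B :: "real^'n^'n"
  using that by (metis transpose_def vec_lambda_beta)

lemma adjugate3_symmetric:
  assumes "transpose B = B"
  shows "transpose (adjugate3 B) = adjugate3 B" "adjugate3 B ** B = mat (det B)"
proof -
  have B: "B$2$1 = B$1$2" "B$3$1 = B$1$3" "B$3$2 = B$2$3"
    using symmetric_matrix_swap[OF assms] by auto
  show "transpose (adjugate3 B) = adjugate3 B"
    by (simp add: transpose_def vec_eq_iff forall_3 adjugate3_def cross_components B algebra_simps)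
  show "adjugate3 B ** B = mat (det B)"
    by (simp add: matrix_matrix_mult_def mat_def det_3 vec_eq_iff forall_3 sum_3 adjugate3_def
        cross_components B algebra_simps)
qed

text \<open>All 2 by 2 minors vanish. With symmetry, \<open>B$i$i * B$j$j\<close> is the square of
  \<open>B$i$j\<close>, so a nonzero entry forces a nonzero diagonal entry, and its row serves as
  p.\<close>

lemma adjugate3_eq_0_imp_outer:
  assumes "transpose B = B" "B \<noteq> 0" "adjugate3 B = 0"
  obtains \<epsilon> p where "B = \<epsilon> *\<^sub>R outer p p" "\<epsilon> \<noteq> 0" "p \<noteq> 0"
proof -
  have sw: "B $ i $ j = B $ j $ i" for i j
    by (rule symmetric_matrix_swap[OF assms(1)])
  have "cross3 (B$2) (B$3) = 0" "cross3 (B$3) (B$1) = 0" "cross3 (B$1) (B$2) = 0"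
    using assms(3) by (simp_all add: adjugate3_def vec_eq_iff[of "vector _"] forall_3)
  then have minor: "\<forall>i j k l. B$i$k * B$j$l = B$i$l * B$j$k"
    by (simp add: forall_3 vec_eq_iff cross_components algebra_simps)
  obtain i j where "B$i$j \<noteq> 0"
    using assms(2) by (auto simp: vec_eq_iff)
  moreover have "B$i$i * B$j$j = B$i$j * B$i$j"
    using minor sw[of i j] by metis
  ultimately have i: "B$i$i \<noteq> 0" by auto
  show ?thesis
  proof
    show "B = (1 / B$i$i) *\<^sub>R outer (B$i) (B$i)"
    proof -
      have "B$i$i * B$k$l = B$i$k * B$i$l" for k l
        using minor sw[of i k] by metis
      then show ?thesis using i by (simp add: outer_def vec_eq_iff field_simps)
    qed
    show "1 / B$i$i \<noteq> 0" using i by simp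
    show "B$i \<noteq> 0" using i by (metis zero_index)
  qed
qed

lemma cross3_parallel:
  fixes u :: "real^3"
  assumes "u \<noteq> 0" "x \<bullet> u = 0" "y \<bullet> u = 0"
  obtains c where "cross3 x y = c *\<^sub>R u"
proof -
  have "cross3 u (cross3 x y) = 0"
    using assms by (simp add: Lagrange inner_commute)
  then have "collinear {0, u, cross3 x y}" by (simp add: cross_eq_0)
  then show ?thesis using assms(1) that by (metis collinear_lemma scaleR_zero_left)
qed

text \<open>If \<open>B\<close> has rank one, its adjugate vanishes and \<open>A\<close> has to be the square of one line through
  the point \<open>p\<close>; all lines of \<open>F\<close> must then be that line.\<close>

lemma conic_with_tangents:
  assumes sym: "transpose B = B" "B \<noteq> 0"
    and F: "\<And>u x. (u, x) \<in> F \<Longrightarrow> u \<noteq> 0 \<and> u \<bullet> x = 0 \<and> (\<exists>\<kappa>. B *v u = \<kappa> *\<^sub>R x)"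
    and rank1: "\<And>\<epsilon> p u x u' x'. B = \<epsilon> *\<^sub>R outer p p \<Longrightarrow> p \<noteq> 0 \<Longrightarrow>
        (\<And>u x. (u, x) \<in> F \<Longrightarrow> u \<bullet> p = 0) \<Longrightarrow> (u, x) \<in> F \<Longrightarrow> (u', x') \<in> F \<Longrightarrow> \<exists>c. u' = c *\<^sub>R u"
  obtains A where "is_conic (A, B)" "\<And>u x. (u, x) \<in> F \<Longrightarrow> \<exists>\<kappa>. A *v x = \<kappa> *\<^sub>R u"
proof (cases "adjugate3 B = 0")
  case False
  let ?A = "adjugate3 B"
  show ?thesis
  proof
    show "is_conic (?A, B)"
      using False sym adjugate3_symmetric[OF sym(1)] by (auto simp: is_conic_def)
    fix u x assume ux: "(u, x) \<in> F"
    then obtain \<kappa> where \<kappa>: "B *v u = \<kappa> *\<^sub>R x" and u: "u \<noteq> 0" "u \<bullet> x = 0" using F by blast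
    show "\<exists>\<kappa>. ?A *v x = \<kappa> *\<^sub>R u"
    proof (cases "\<kappa> = 0")
      case False
      have "\<kappa> *\<^sub>R (?A *v x) = ?A *v (B *v u)"
        by (simp add: \<kappa> matrix_vector_mult_scaleR)
      also have "\<dots> = mat (det B) *v u"
        by (simp add: matrix_vector_mul_assoc adjugate3_symmetric[OF sym(1)])
      also have "\<dots> = det B *\<^sub>R u"
        by (simp add: vec_eq_iff mat_def matrix_vector_mult_def sum_3 forall_3)
      finally have "(1 / \<kappa>) *\<^sub>R (\<kappa> *\<^sub>R (?A *v x)) = (1 / \<kappa>) *\<^sub>R (det B *\<^sub>R u)" by simp
      then show ?thesis using False by auto
    next
      case True
      \<comment> \<open>If u lies in the kernel of B, all rows are orthogonal to u, so their cross
        products are multiples of u and thus annihilate x.\<close>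
      have row: "B$i \<bullet> u = 0" for i
        using \<kappa> True by (metis matrix_vector_mul_component scaleR_zero_left zero_index)
      have "?A$i \<bullet> x = 0" for i
      proof -
        have "cross3 (B$j) (B$k) \<bullet> x = 0" for j k
          using cross3_parallel[OF u(1) row row] u(2) by (metis inner_scaleR_left mult_zero_right)
        then show ?thesis using exhaust_3[of i] by (auto simp: adjugate3_def)
      qed
      then have "?A *v x = 0 *\<^sub>R u"
        by (simp add: vec_eq_iff matrix_vector_mul_component)
      then show ?thesis by blast
    qed
  qed
next
  case True
  then obtain \<epsilon> p where p: "B = \<epsilon> *\<^sub>R outer p p" "\<epsilon> \<noteq> 0" "p \<noteq> 0"
    using adjugate3_eq_0_imp_outer[OF sym] by blast
  have thru: "u \<bullet> p = 0" if ux: "(u, x) \<in> F" for u x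
  proof -
    obtain \<kappa> where "B *v u = \<kappa> *\<^sub>R x" "u \<bullet> x = 0" using F[OF ux] by blast
    then have "u \<bullet> (B *v u) = 0" by simp
    then show ?thesis
      using p by (simp add: outer_mult_vec scaleR_matrix_vector_assoc[symmetric] inner_commute)
  qed
  have conic: "is_conic (outer m m, B)" if "m \<noteq> 0" "m \<bullet> p = 0" for m
  proof -
    have "outer m m \<noteq> 0"
    proof
      assume "outer m m = 0"
      then have "(m \<bullet> m) *\<^sub>R m = 0" by (metis outer_mult_vec matrix_vector_mult_0)
      then show False using that by simp
    qed
    moreover have "outer m m ** B = (\<epsilon> * (m \<bullet> p)) *\<^sub>R outer m p"
      unfolding p
      by (simp add: outer_def matrix_matrix_mult_def vec_eq_iff inner_vec_def sum_3 algebra_simps)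
    then have "outer m m ** B = mat 0"
      using that(2) by (simp add: mat_def vec_eq_iff)
    moreover have "transpose (outer m m) = outer m m"
      by (simp add: outer_def transpose_def vec_eq_iff)
    ultimately show ?thesis using sym unfolding is_conic_def prod.case by blast
  qed
  show ?thesis
  proof (cases "F = {}")
    case True
    \<comment> \<open>Nothing is prescribed in this case: any line through the double point
      completes the conic.\<close>
    obtain m where "m \<noteq> 0" "orthogonal p m"
      using orthogonal_to_vector_exists[of p] by auto
    then show ?thesis using conic[of m] that True by (auto simp: orthogonal_def inner_commute)
  next
    case False
    then obtain m y where m: "(m, y) \<in> F" by auto
    show ?thesis
    proof
      show "is_conic (outer m m, B)" using conic thru[OF m] F[OF m] by blast
      fix u x assume ux: "(u, x) \<in> F"
      obtain c where c: "u = c *\<^sub>R m" using rank1[OF p(1,3) _ m ux] thru by blast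
      then have "m \<bullet> x = 0" using F[OF ux] by auto
      then show "\<exists>\<kappa>. outer m m *v x = \<kappa> *\<^sub>R u"
        by (auto simp: outer_mult_vec intro!: exI[of _ 0])
    qed
  qed
qed


text \<open>Projectively, two distinct lines have one common point, and dually two distinct points
  one joining line. Both readings occur below; x may be zero.\<close>

lemma common_orthogonal_parallel:
  fixes u v x y :: "real^3"
  assumes "cross3 u v \<noteq> 0" "x \<bullet> u = 0" "x \<bullet> v = 0" "y \<bullet> u = 0" "y \<bullet> v = 0" "y \<noteq> 0"
  obtains \<kappa> where "x = \<kappa> *\<^sub>R y"
proof -
  have *: "\<exists>c. z = c *\<^sub>R cross3 u v" if "z \<bullet> u = 0" "z \<bullet> v = 0" for z
  proof -
    have "cross3 z (cross3 u v) = 0" using that by (simp add: Lagrange)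
    then have "cross3 (cross3 u v) z = 0" by (metis cross_skew neg_equal_0_iff_equal)
    then have "collinear {0, cross3 u v, z}" by (simp add: cross_eq_0)
    then show ?thesis using assms(1) by (metis collinear_lemma scaleR_zero_left)
  qed
  obtain c c' where c: "x = c *\<^sub>R cross3 u v" "y = c' *\<^sub>R cross3 u v"
    using *[OF assms(2,3)] *[OF assms(4,5)] by blast
  then have "c' \<noteq> 0" using assms(6) by auto
  then have "x = (c / c') *\<^sub>R y" using c by simp
  then show ?thesis using that by blast
qed

lemma line_through_eq:
  assumes "P \<noteq> Q" "w \<bullet> hom_pt P = 0" "w \<bullet> hom_pt Q = 0" "w \<noteq> 0"
  obtains c where "c \<noteq> 0" "line_through P Q = c *\<^sub>R w"
proof -
  have "line_through P Q \<noteq> 0"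
    using assms(1) by (auto simp: line_through_def hom_pt_def cross3_def vec_eq_iff forall_2 forall_3)
  moreover obtain c where "line_through P Q = c *\<^sub>R w"
    using cross3_parallel[OF assms(4), of "hom_pt P" "hom_pt Q"] assms(2,3)
    unfolding line_through_def by (metis inner_commute)
  ultimately show ?thesis using that by force
qed

lemma tangent_at_scaleR:
  assumes "tangent_at w p Q" "c \<noteq> 0"
  shows "tangent_at (c *\<^sub>R w) p Q"
proof -
  obtain \<kappa> \<kappa>' where *: "fst Q *v hom_pt p = \<kappa> *\<^sub>R w" "snd Q *v w = \<kappa>' *\<^sub>R hom_pt p"
    and w: "w \<noteq> 0" "w \<bullet> hom_pt p = 0"
    using assms(1) unfolding tangent_at_def by blast
  have "fst Q *v hom_pt p = (\<kappa> / c) *\<^sub>R (c *\<^sub>R w)" using * assms(2) by simp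
  moreover have "snd Q *v (c *\<^sub>R w) = (c * \<kappa>') *\<^sub>R hom_pt p"
    using * by (simp add: matrix_vector_mult_scaleR)
  ultimately show ?thesis using w assms(2) unfolding tangent_at_def
    by (metis inner_scaleR_left mult_zero_right scaleR_eq_0_iff)
qed

section \<open>Oriented lines and incircles in the plane\<close>

lemma inner_real2: "x \<bullet> y = x$1 * y$1 + x$2 * y$2" for x y :: "real^2"
  by (simp add: inner_vec_def sum_2)

text \<open>The sign \<sigma> selects the sense of rotation, so that nets of either orientation obey
  the same inequalities between angles.\<close>

definition dir :: "real \<Rightarrow> real \<Rightarrow> real^2" where
  "dir \<sigma> t = vector [cos t, \<sigma> * sin t]"

definition det2 :: "real^2 \<Rightarrow> real^2 \<Rightarrow> real" where
  "det2 x y = x$1 * y$2 - x$2 * y$1"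

lemma inner_dir: "\<sigma> * \<sigma> = 1 \<Longrightarrow> dir \<sigma> s \<bullet> dir \<sigma> t = cos (s - t)"
  by (simp add: inner_real2 dir_def cos_diff algebra_simps)

lemma det2_dir: "det2 (dir \<sigma> s) (dir \<sigma> t) = \<sigma> * sin (t - s)"
  by (simp add: det2_def dir_def sin_diff algebra_simps)

lemma dir_exists:
  assumes \<sigma>: "\<sigma> * \<sigma> = 1" and x: "x \<bullet> x = 1"
  obtains t where "0 \<le> t" "t < 2 * pi" "x = dir \<sigma> (c + t)"
proof -
  \<comment> \<open>These are the coordinates of x, mirrored according to \<sigma> and rotated back
    by c, so the angle found for them counts from c.\<close>
  let ?u = "x$1 * cos c + \<sigma> * x$2 * sin c" and ?w = "\<sigma> * x$2 * cos c - x$1 * sin c"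
  have "(x$1 * C + \<sigma> * x$2 * S)\<^sup>2 + (\<sigma> * x$2 * C - x$1 * S)\<^sup>2
      = (x$1 * x$1 + (\<sigma> * \<sigma>) * (x$2 * x$2)) * (C\<^sup>2 + S\<^sup>2)" for C S :: real
    by (simp add: power2_eq_square algebra_simps)
  then have "?u\<^sup>2 + ?w\<^sup>2 = 1"
    using x \<sigma> by (simp add: inner_real2)
  then obtain t where t: "0 \<le> t" "t < 2 * pi" "?u = cos t" "?w = sin t"
    using sincos_total_2pi by blast
  have "x$1 * (C\<^sup>2 + S\<^sup>2) = (x$1 * C + \<sigma> * x$2 * S) * C - (\<sigma> * x$2 * C - x$1 * S) * S"
    "\<sigma> * x$2 * (C\<^sup>2 + S\<^sup>2) = (x$1 * C + \<sigma> * x$2 * S) * S + (\<sigma> * x$2 * C - x$1 * S) * C"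
    for C S :: real
    by (simp_all add: power2_eq_square algebra_simps)
  from this[of "cos c" "sin c"]
  have "x$1 = cos (c + t)" and s: "\<sigma> * x$2 = sin (c + t)"
    unfolding t(3,4) by (simp_all add: cos_add sin_add algebra_simps)
  moreover have "x$2 = \<sigma> * sin (c + t)"
    using \<sigma> unfolding s[symmetric] by (simp flip: mult.assoc)
  ultimately have "x = dir \<sigma> (c + t)"
    by (simp add: dir_def vec_eq_iff forall_2)
  then show ?thesis using that t by blast
qed

text \<open>Because the step is an equivalence, a property spreads from \<open>j0\<close> in both
  directions of the interval.\<close>

lemma int_interval_iff_induct:
  assumes J: "int_interval J" and "j0 \<in> J" "j \<in> J"
    and step: "\<And>j. j \<in> J \<Longrightarrow> j + 1 \<in> J \<Longrightarrow> P j \<longleftrightarrow> P (j + 1)"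
  shows "P j0 \<longleftrightarrow> P j"
proof -
  have *: "k \<in> J \<Longrightarrow> P l \<longleftrightarrow> P k" if "l \<in> J" "l \<le> k" for l k
    using that(2)
  proof (induction k rule: int_ge_induct)
    case (step k)
    then have "{l..k + 1} \<subseteq> J"
      using J that(1) unfolding int_interval_def by blast
    then have "k \<in> J" using step.hyps by auto
    then show ?case using step assms(4) by blast
  qed simp
  show ?thesis
    using *[OF assms(2) _ assms(3)] *[OF assms(3) _ assms(2)] by (metis linear)
qed

lemma int_interval_neighbour:
  assumes "int_interval I" "i0 \<in> I" "i0 + 1 \<in> I" "k \<in> I"
  shows "k + 1 \<in> I \<or> k - 1 \<in> I"
proof (cases "k \<le> i0")
  case True
  then have "k + 1 \<in> {k..i0 + 1}" by simp
  then show ?thesis using assms unfolding int_interval_def by blast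
next
  case False
  then have "k - 1 \<in> {i0..k}" by simp
  then show ?thesis using assms unfolding int_interval_def by blast
qed

section \<open>Convex cells, signed distances and oriented normals\<close>

lemma convex_quad_symmetries:
  assumes "convex_quad A B C D"
  shows "convex_quad A D C B" "convex_quad B A D C"
proof -
  have "{A, D, C, B} = {A, B, C, D}" "{B, A, D, C} = {A, B, C, D}" by auto
  then show "convex_quad A D C B" "convex_quad B A D C"
    using assms unfolding convex_quad_def by (auto simp: open_segment_commute)
qed

text \<open>Combinations of these two reflections bring each of the four sides into the position D
  A, the only one that \<open>incircle_distance\<close> treats.\<close>

lemma incircle_symmetries:
  assumes "incircle A B C D z r"
  shows "incircle A D C B z r" "incircle B A D C z r"
proof -
  have comm: "circle_touches_side z r P Q \<Longrightarrow> circle_touches_side z r Q P" for P Q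
    unfolding circle_touches_side_def orthogonal_def inner_diff_right
    by (auto simp: closed_segment_commute)
  show "incircle A D C B z r" "incircle B A D C z r"
    using assms convex_quad_symmetries[of A B C D] comm unfolding incircle_def by blast+
qed

lemma collinear_line_real2:
  fixes n :: "real^2"
  assumes "n \<noteq> 0" "\<And>x. x \<in> S \<Longrightarrow> n \<bullet> x = d"
  shows "collinear S"
proof -
  have "\<exists>c. x - y = c *\<^sub>R vector [- n$2, n$1]" if "x \<in> S" "y \<in> S" for x y
  proof -
    have "n \<bullet> (x - y) = 0" using assms(2)[of x] assms(2)[of y] that by (simp add: inner_diff_right)
    then have *: "n$1 * (x - y)$1 + n$2 * (x - y)$2 = 0" by (simp add: inner_real2)
    show ?thesis
    proof (cases "n$2 = 0")
      case True
      then have "n$1 \<noteq> 0" using assms(1) by (auto simp: vec_eq_iff forall_2)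
      then have "x - y = ((x - y)$2 / n$1) *\<^sub>R vector [- n$2, n$1]"
        using * True by (simp add: vec_eq_iff forall_2)
      then show ?thesis by blast
    next
      case False
      then have "x - y = (- (x - y)$1 / n$2) *\<^sub>R vector [- n$2, n$1]"
        using * by (simp add: vec_eq_iff forall_2 field_simps)
      then show ?thesis by blast
    qed
  qed
  then show ?thesis unfolding collinear_def by blast
qed

text \<open>Relative to the line A D, the crossing point E of the diagonals lies on the same side as
  C, being on the ray from A, and on the same side as B, being on the ray from D.\<close>

lemma convex_quad_same_side:
  assumes "convex_quad A B C D" "n \<noteq> 0" "n \<bullet> A = d" "n \<bullet> D = d"
  shows "0 < (n \<bullet> B - d) * (n \<bullet> C - d)"
proof -
  obtain E where "E \<in> open_segment A C" "E \<in> open_segment B D" and nc: "\<not> collinear {A, B, C, D}"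
    using assms(1) unfolding convex_quad_def by blast
  then obtain s t where s: "0 < s" "s < 1" "E = (1 - s) *\<^sub>R A + s *\<^sub>R C"
    and t: "0 < t" "t < 1" "E = (1 - t) *\<^sub>R B + t *\<^sub>R D"
    by (auto simp: in_segment)
  have "n \<bullet> E - d = s * (n \<bullet> C - d)"
    unfolding s(3) using assms(3) by (simp add: inner_add_right algebra_simps)
  moreover have "n \<bullet> E - d = (1 - t) * (n \<bullet> B - d)"
    unfolding t(3) using assms(4) by (simp add: inner_add_right algebra_simps)
  ultimately have eq: "s * (n \<bullet> C - d) = (1 - t) * (n \<bullet> B - d)" by simp
  have "n \<bullet> B \<noteq> d"
  proof
    assume B: "n \<bullet> B = d"
    then have "n \<bullet> C = d" using eq s by simp
    then have "collinear {A, B, C, D}"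
      using assms(3,4) B by (intro collinear_line_real2[OF assms(2), of _ d]) auto
    then show False using nc by blast
  qed
  then have "0 < (1 - t) * ((n \<bullet> B - d) * (n \<bullet> B - d))"
    using t zero_less_power2[of "n \<bullet> B - d"] by (simp add: power2_eq_square)
  also have "\<dots> = s * ((n \<bullet> B - d) * (n \<bullet> C - d))"
    unfolding mult.assoc[symmetric] eq[symmetric] by (simp only: mult_ac)
  finally show ?thesis using s by (simp add: zero_less_mult_iff)
qed

lemma parallel_to_unit_normal:
  fixes w n x :: "real^2"
  assumes "w \<bullet> x = 0" "n \<bullet> x = 0" "x \<noteq> 0" "n \<bullet> n = 1"
  shows "w = (w \<bullet> n) *\<^sub>R n"
proof -
  have *: "w$1 * x$1 + w$2 * x$2 = 0" "n$1 * x$1 + n$2 * x$2 = 0" "n$1 * n$1 + n$2 * n$2 = 1"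
    using assms by (simp_all add: inner_real2)
  have "(w$1 * n$2 - w$2 * n$1) * x$1 = n$2 * (w$1 * x$1 + w$2 * x$2) - w$2 * (n$1 * x$1 + n$2 * x$2)"
    "(w$1 * n$2 - w$2 * n$1) * x$2 = w$1 * (n$1 * x$1 + n$2 * x$2) - n$1 * (w$1 * x$1 + w$2 * x$2)"
    by (simp_all add: algebra_simps)
  then have "w$1 * n$2 = w$2 * n$1"
    using assms(3) unfolding *(1,2) by (auto simp: vec_eq_iff forall_2)
  then have "w$1 * (n$1 * n$1 + n$2 * n$2) = (w$1 * n$1 + w$2 * n$2) * n$1"
    "w$2 * (n$1 * n$1 + n$2 * n$2) = (w$1 * n$1 + w$2 * n$2) * n$2"
    by (simp_all add: algebra_simps)
  then have "w$1 = (w$1 * n$1 + w$2 * n$2) * n$1" "w$2 = (w$1 * n$1 + w$2 * n$2) * n$2"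
    unfolding *(3) by simp_all
  then show ?thesis by (simp add: vec_eq_iff forall_2 inner_real2)
qed

text \<open>Touching the side D A only gives distance r up to sign. The touching point on B C lies
  strictly beyond the line and at distance r from z, which excludes the value
  \<open>d - r\<close>.\<close>

lemma incircle_distance:
  assumes inc: "incircle A B C D z r" and "A \<noteq> D" and n: "n \<bullet> n = 1"
    and line: "n \<bullet> A = d" "n \<bullet> D = d" and side: "d < n \<bullet> B" "d < n \<bullet> C"
  shows "n \<bullet> z = d + r"
proof -
  obtain T where T: "T \<in> closed_segment D A" "dist z T = r" "orthogonal (T - z) (A - D)"
    using inc unfolding incircle_def circle_touches_side_def by blast
  obtain T' where T': "T' \<in> closed_segment B C" "dist z T' = r"
    using inc unfolding incircle_def circle_touches_side_def by blast
  have r: "0 < r" using inc unfolding incircle_def by blast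
  have "n \<bullet> (A - D) = 0" using line by (simp add: inner_diff_right)
  then have Tn: "T - z = ((T - z) \<bullet> n) *\<^sub>R n"
    using parallel_to_unit_normal[of "T - z" "A - D" n] T(3) n assms(2) by (simp add: orthogonal_def)
  have "norm n = 1" using n by (simp add: norm_eq_sqrt_inner)
  then have abs: "\<bar>(T - z) \<bullet> n\<bar> = r"
    using T(2) Tn by (metis dist_commute dist_norm mult.right_neutral norm_scaleR)
  obtain u where u: "T = (1 - u) *\<^sub>R D + u *\<^sub>R A"
    using T(1) by (auto simp: in_segment)
  have "n \<bullet> T = (1 - u) * d + u * d"
    unfolding u inner_add_right inner_scaleR_right line ..
  then have "n \<bullet> T = d" by (simp add: algebra_simps)
  then have z: "n \<bullet> z = d - (T - z) \<bullet> n"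
    unfolding inner_commute[of "T - z" n] inner_diff_right by simp
  have "d < n \<bullet> T'"
  proof -
    obtain u where u: "0 \<le> u" "u \<le> 1" "T' = (1 - u) *\<^sub>R B + u *\<^sub>R C"
      using T'(1) by (auto simp: in_segment)
    have "n \<bullet> T' - d = (1 - u) * (n \<bullet> B - d) + u * (n \<bullet> C - d)"
      unfolding u(3) by (simp add: inner_add_right algebra_simps)
    moreover have "0 < (1 - u) * (n \<bullet> B - d) + u * (n \<bullet> C - d)"
      using u side by (cases "u = 0") (auto intro: add_nonneg_pos)
    ultimately show ?thesis by simp
  qed
  moreover have "n \<bullet> (T' - z) \<le> norm n * norm (T' - z)"
    by (rule norm_cauchy_schwarz)
  then have "n \<bullet> T' - n \<bullet> z \<le> r"
    using T'(2) \<open>norm n = 1\<close> by (simp add: inner_diff_right dist_norm norm_minus_commute)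
  ultimately show ?thesis using abs z r by linarith
qed

text \<open>The sign of the normal is chosen at one point of a neighbouring line i1. Convexity of
  the cells carries it along that line, and the order of the points on each transversal carries it
  across to the other neighbour.\<close>

lemma oriented_normal:
  assumes J: "int_interval J" and jj: "j0 \<in> J" "j0 + 1 \<in> J"
    and i: "i \<in> I" and i1: "i1 \<in> I" "i1 = i + 1 \<or> i1 = i - 1"
    and lines: "on_line_in_order J (\<lambda>j. f i j)" "\<And>j. j \<in> J \<Longrightarrow> on_line_in_order I (\<lambda>i. f i j)"
    and convex: "\<And>i j. (i, j) \<in> cells I J \<Longrightarrow>
      convex_quad (f i j) (f (i + 1) j) (f (i + 1) (j + 1)) (f i (j + 1))"
  obtains n d where "n \<bullet> n = 1" "\<And>j. j \<in> J \<Longrightarrow> n \<bullet> f i j = d"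
    "\<And>j. j \<in> J \<Longrightarrow> i + 1 \<in> I \<Longrightarrow> d < n \<bullet> f (i + 1) j"
    "\<And>j. j \<in> J \<Longrightarrow> i - 1 \<in> I \<Longrightarrow> n \<bullet> f (i - 1) j < d"
proof -
  obtain a v t where v: "v \<noteq> 0" and f: "\<And>j. j \<in> J \<Longrightarrow> f i j = a + t j *\<^sub>R v"
    using lines(1) unfolding on_line_in_order_def by blast
  define n0 :: "real^2" where "n0 = (1 / norm v) *\<^sub>R vector [- v$2, v$1]"
  have vv: "norm v * norm v = v$1 * v$1 + v$2 * v$2"
    by (metis inner_real2 power2_eq_square power2_norm_eq_inner)
  have n0v: "n0 \<bullet> v = 0" by (simp add: n0_def inner_real2)
  have n0: "n0 \<bullet> n0 = 1"
  proof -
    have "n0 \<bullet> n0 = (v$1 * v$1 + v$2 * v$2) / (norm v * norm v)"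
      by (simp add: n0_def inner_real2 add_divide_distrib)
    then show ?thesis using v unfolding vv[symmetric] by simp
  qed
  then have n0z: "n0 \<noteq> 0" by auto
  define g where "g x = n0 \<bullet> x - n0 \<bullet> a" for x
  have g0: "g (f i j) = 0" if "j \<in> J" for j
    using f[OF that] n0v by (simp add: g_def inner_add_right)
  define c :: real where "c = of_int (i1 - i)"
  have c: "c = 1 \<or> c = -1" "c * c = 1" using i1(2) by (auto simp: c_def)
  have same: "0 < g (f i1 j) * g (f i1 (j + 1))" if "j \<in> J" "j + 1 \<in> J" for j
    using i1(2)
  proof
    assume i1': "i1 = i + 1"
    have "(i, j) \<in> cells I J" using i i1 i1' that by (simp add: cells_def)
    from convex_quad_same_side[OF convex[OF this] n0z, of "n0 \<bullet> a"]
    show ?thesis using g0[OF that(1)] g0[OF that(2)] i1' by (simp add: g_def)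
  next
    assume i1': "i1 = i - 1"
    have "(i - 1, j) \<in> cells I J" using i i1 i1' that by (simp add: cells_def)
    from convex_quad_same_side[OF convex_quad_symmetries(2)[OF convex[OF this]] n0z, of "n0 \<bullet> a"]
    show ?thesis using g0[OF that(1)] g0[OF that(2)] i1' by (simp add: g_def)
  qed
  \<comment> \<open>While c records whether i1 comes after or before i, s turns \<open>n0\<close> so
    that larger indices lie on its positive side.\<close>
  define s where "s = sgn (c * g (f i1 j0))"
  have "g (f i1 j0) \<noteq> 0" using same[OF jj] by auto
  then have s: "s = 1 \<or> s = -1" "s * s = 1" "0 < s * (c * g (f i1 j0))"
    using c(1) by (auto simp: s_def sgn_if)
  have pos: "0 < s * (c * g (f i1 j))" if "j \<in> J" for j
  proof -
    have "0 < s * (c * g (f i1 j0)) \<longleftrightarrow> 0 < s * (c * g (f i1 j))"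
    proof (rule int_interval_iff_induct[OF J jj(1) that])
      fix j assume "j \<in> J" "j + 1 \<in> J"
      from same[OF this] show "0 < s * (c * g (f i1 j)) \<longleftrightarrow> 0 < s * (c * g (f i1 (j + 1)))"
        using s(1) c(1) by (auto simp: zero_less_mult_iff)
    qed
    then show ?thesis using s(3) by simp
  qed
  \<comment> \<open>On a transversal g is affine in a strictly increasing parameter, so its sign at
    i1 fixes the slope and hence its sign everywhere.\<close>
  have side: "0 < s * g (f k j) * of_int (k - i)" if j: "j \<in> J" and k: "k \<in> I" "k \<noteq> i" for j k
  proof -
    obtain A V T where T: "strict_mono_on I T" and fT: "\<And>k. k \<in> I \<Longrightarrow> f k j = A + T k *\<^sub>R V"
      using lines(2)[OF j] unfolding on_line_in_order_def by blast
    have g: "g (f k j) = (T k - T i) * (n0 \<bullet> V)" if "k \<in> I" for k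
    proof -
      have "g (f k j) = g (f k j) - g (f i j)" using g0[OF j] by simp
      then show ?thesis using fT[OF that] fT[OF i] by (simp add: g_def inner_add_right algebra_simps)
    qed
    have T': "0 < (T k - T i) * of_int (k - i)" if "k \<in> I" "k \<noteq> i" for k
      using strict_mono_onD[OF T i that(1)] strict_mono_onD[OF T that(1) i] that(2)
      by (cases "k < i") (auto simp: zero_less_mult_iff)
    have "0 < ((T i1 - T i) * c) * (s * (n0 \<bullet> V))"
      using pos[OF j] g[OF i1(1)] by (simp add: mult_ac)
    moreover have "0 < (T i1 - T i) * c" using T'[of i1] i1 by (auto simp: c_def)
    ultimately have "0 < s * (n0 \<bullet> V)" by (simp add: zero_less_mult_iff)
    then have "0 < (T k - T i) * of_int (k - i) * (s * (n0 \<bullet> V))"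
      using T'[OF k] by simp
    then show ?thesis using g[OF k(1)] by (simp add: mult_ac)
  qed
  have sg: "(s *\<^sub>R n0) \<bullet> x - s * (n0 \<bullet> a) = s * g x" for x
    by (simp add: g_def right_diff_distrib)
  show ?thesis
  proof
    show "(s *\<^sub>R n0) \<bullet> (s *\<^sub>R n0) = 1" using n0 s(2) by simp
    show "(s *\<^sub>R n0) \<bullet> f i j = s * (n0 \<bullet> a)" if "j \<in> J" for j
      using sg[of "f i j"] g0[OF that] by simp
    show "s * (n0 \<bullet> a) < (s *\<^sub>R n0) \<bullet> f (i + 1) j" if "j \<in> J" "i + 1 \<in> I" for j
      using sg[of "f (i + 1) j"] side[OF that] by simp
    show "(s *\<^sub>R n0) \<bullet> f (i - 1) j < s * (n0 \<bullet> a)" if "j \<in> J" "i - 1 \<in> I" for j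
      using sg[of "f (i - 1) j"] side[OF that] by simp
  qed
qed

section \<open>Incircular nets in angle coordinates\<close>

lemma int_shift: "k + 1 + 1 = k + 2" "k - 1 + 1 = k" for k :: int
  by simp_all

text \<open>Exchanging the two families of lines amounts to \<open>\<sigma>, a, b \<mapsto> - \<sigma>, - b, - a\<close>.\<close>

lemma dir_uminus: "dir (- \<sigma>) (- t) = dir \<sigma> t"
  by (simp add: dir_def)

lemma dir_add_pi: "dir \<sigma> (t + pi) = - dir \<sigma> t"
  by (simp add: dir_def vec_eq_iff forall_2)

lemma inner_dir_quarter:
  "\<sigma> * \<sigma> = 1 \<Longrightarrow> dir \<sigma> t \<bullet> dir \<sigma> (t + pi / 2) = 0"
  "\<sigma> * \<sigma> = 1 \<Longrightarrow> dir \<sigma> t \<bullet> dir \<sigma> (t - pi / 2) = 0"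
  by (simp_all add: inner_dir)

lemma eq_zero_if_orthogonal_dirs:
  assumes "\<sigma> * \<sigma> = 1" "dir \<sigma> s \<bullet> w = 0" "dir \<sigma> t \<bullet> w = 0" "sin (t - s) \<noteq> 0"
  shows "w = 0"
proof -
  have *: "cos s * w$1 + \<sigma> * sin s * w$2 = 0" "cos t * w$1 + \<sigma> * sin t * w$2 = 0"
    using assms(2,3) by (simp_all add: dir_def inner_real2)
  have "w$1 * sin (t - s) = (cos s * w$1 + \<sigma> * sin s * w$2) * sin t - (cos t * w$1 + \<sigma> * sin t * w$2) * sin s"
    "\<sigma> * w$2 * sin (t - s) = (cos t * w$1 + \<sigma> * sin t * w$2) * cos s - (cos s * w$1 + \<sigma> * sin s * w$2) * cos t"
    by (simp_all add: sin_diff algebra_simps)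
  then have "w$1 * sin (t - s) = 0" "\<sigma> * w$2 * sin (t - s) = 0"
    unfolding * by simp_all
  then have "w$1 = 0" "\<sigma> * w$2 = 0" using assms(4) by simp_all
  then show ?thesis using assms(1) by (auto simp: vec_eq_iff forall_2)
qed

text \<open>Equal signed distances from two lines put w on the bisector of the normals, opposite
  ones on its perpendicular. Two independent projections determine w, so the candidates only have to
  be tested against both normals.\<close>

lemma dir_bisector:
  assumes \<sigma>: "\<sigma> * \<sigma> = 1" and range: "0 < t - s" "t - s < pi"
  shows "dir \<sigma> s \<bullet> w = x \<Longrightarrow> dir \<sigma> t \<bullet> w = x \<Longrightarrow>
      w = (x / cos ((t - s) / 2)) *\<^sub>R dir \<sigma> ((s + t) / 2)"
    "dir \<sigma> s \<bullet> w = - x \<Longrightarrow> dir \<sigma> t \<bullet> w = x \<Longrightarrow>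
      w = (x / sin ((t - s) / 2)) *\<^sub>R dir \<sigma> ((s + t) / 2 + pi / 2)"
proof -
  have ne: "sin (t - s) \<noteq> 0" "cos ((t - s) / 2) \<noteq> 0" "sin ((t - s) / 2) \<noteq> 0"
    using range sin_gt_zero[of "t - s"] sin_gt_zero[of "(t - s) / 2"] cos_gt_zero[of "(t - s) / 2"] by auto
  have h: "s - (s + t) / 2 = - ((t - s) / 2)" "t - (s + t) / 2 = (t - s) / 2"
    by (simp_all add: field_simps)
  have h2: "s - ((s + t) / 2 + pi / 2) = - ((t - s) / 2 + pi / 2)"
    "t - ((s + t) / 2 + pi / 2) = (t - s) / 2 - pi / 2"
    by (simp_all add: field_simps)
  have c: "dir \<sigma> s \<bullet> dir \<sigma> ((s + t) / 2) = cos ((t - s) / 2)"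
    "dir \<sigma> t \<bullet> dir \<sigma> ((s + t) / 2) = cos ((t - s) / 2)"
    unfolding inner_dir[OF \<sigma>] h cos_minus by simp_all
  have c2: "dir \<sigma> s \<bullet> dir \<sigma> ((s + t) / 2 + pi / 2) = - sin ((t - s) / 2)"
    "dir \<sigma> t \<bullet> dir \<sigma> ((s + t) / 2 + pi / 2) = sin ((t - s) / 2)"
    unfolding inner_dir[OF \<sigma>] h2 cos_minus cos_add cos_diff by simp_all
  show "w = (x / cos ((t - s) / 2)) *\<^sub>R dir \<sigma> ((s + t) / 2)"
    if "dir \<sigma> s \<bullet> w = x" "dir \<sigma> t \<bullet> w = x"
    using eq_zero_if_orthogonal_dirs[OF \<sigma> _ _ ne(1), of "w - (x / cos ((t - s) / 2)) *\<^sub>R dir \<sigma> ((s + t) / 2)"]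
      that c ne(2) by (simp add: inner_diff_right)
  show "w = (x / sin ((t - s) / 2)) *\<^sub>R dir \<sigma> ((s + t) / 2 + pi / 2)"
    if "dir \<sigma> s \<bullet> w = - x" "dir \<sigma> t \<bullet> w = x"
    using eq_zero_if_orthogonal_dirs[OF \<sigma> _ _ ne(1), of "w - (x / sin ((t - s) / 2)) *\<^sub>R dir \<sigma> ((s + t) / 2 + pi / 2)"]
      that c2 ne(3) by (simp add: inner_diff_right)
qed

lemma dir_sum: "dir \<sigma> x + dir \<sigma> y = (2 * cos ((x - y) / 2)) *\<^sub>R dir \<sigma> ((x + y) / 2)"
proof -
  have "cos x + cos y = 2 * cos ((x + y) / 2) * cos ((x - y) / 2)"
    "sin x + sin y = 2 * sin ((x + y) / 2) * cos ((x - y) / 2)"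
    by (simp_all add: cos_plus_cos sin_plus_sin)
  then show ?thesis
    by (simp add: dir_def vec_eq_iff forall_2 flip: distrib_left)
qed

text \<open>Here p and q are radii of two circles in the strip between the lines with normal angles
  x and y, separated by the line with normal angle t, and w joins their centers. The first two
  equations put w on the bisector of the strip, the third fixes its length, and sum-to-product
  formulas yield the radii.\<close>

lemma center_step:
  assumes \<sigma>: "\<sigma> * \<sigma> = 1" and x: "0 < t - x" "t - x < pi" and y: "0 < t - y" "t - y < pi"
    and w: "dir \<sigma> x \<bullet> w = q - p" "dir \<sigma> y \<bullet> w = p - q" "dir \<sigma> t \<bullet> w = p + q"
  obtains s where "w = s *\<^sub>R dir \<sigma> ((x + y) / 2 + pi / 2)"
    "p = s * (sin ((t - x) / 2) * cos ((t - y) / 2))"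
    "q = s * (sin ((t - y) / 2) * cos ((t - x) / 2))"
proof -
  define m where "m = (x + y) / 2"
  have "0 < t - m" "t - m < pi" using x y unfolding m_def by (simp_all add: field_simps)
  then have st: "0 < sin (t - m)" by (rule sin_gt_zero)
  have cd: "0 < cos ((x - y) / 2)" using x y by (intro cos_gt_zero_pi) auto
  have "dir \<sigma> x \<bullet> w + dir \<sigma> y \<bullet> w = 0" using w by simp
  then have mw: "dir \<sigma> m \<bullet> w = 0"
    using cd unfolding inner_add_left[symmetric] dir_sum m_def by simp
  define s where "s = (p + q) / sin (t - m)"
  have inn: "dir \<sigma> u \<bullet> dir \<sigma> (m + pi / 2) = sin (u - m)" for u
  proof -
    have "u - (m + pi / 2) = (u - m) - pi / 2" by simp
    then show ?thesis unfolding inner_dir[OF \<sigma>] by (simp only: cos_diff[of "u - m"]) simp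
  qed
  have "w - s *\<^sub>R dir \<sigma> (m + pi / 2) = 0"
    by (rule eq_zero_if_orthogonal_dirs[OF \<sigma>, of m _ t])
      (use mw w(3) st in \<open>simp_all add: inner_diff_right inn s_def\<close>)
  then have ws: "w = s *\<^sub>R dir \<sigma> (m + pi / 2)" by simp
  have "q - p = s * sin (x - m)" "p + q = s * sin (t - m)"
    using w(1,3) unfolding ws by (simp_all add: inn)
  then have pq: "p = s * ((sin (t - m) + sin (m - x)) / 2)" "q = s * ((sin (t - m) - sin (m - x)) / 2)"
    using sin_minus[of "m - x"] by (simp_all add: algebra_simps)
  have arg: "(t - m + (m - x)) / 2 = (t - x) / 2" "(t - m - (m - x)) / 2 = (t - y) / 2"
    by (simp_all add: m_def field_simps)
  show ?thesis
  proof
    show "w = s *\<^sub>R dir \<sigma> ((x + y) / 2 + pi / 2)" using ws by (simp add: m_def)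
    show "p = s * (sin ((t - x) / 2) * cos ((t - y) / 2))"
      unfolding pq(1) sin_plus_sin arg by simp
    show "q = s * (sin ((t - y) / 2) * cos ((t - x) / 2))"
      unfolding pq(2) sin_diff_sin arg by simp
  qed
qed

lemma angle_dir:
  assumes "\<sigma> * \<sigma> = 1" "p - q = k *\<^sub>R dir \<sigma> s" "0 < k" "r - q = k' *\<^sub>R dir \<sigma> t" "0 < k'"
  shows "angle p q r = arccos (cos (s - t))"
proof -
  have "norm (dir \<sigma> u) = 1" for u
    using inner_dir[OF assms(1), of u u] by (simp add: norm_eq_sqrt_inner)
  then show ?thesis
    using assms by (simp add: angle_def inner_dir)
qed

text \<open>The arguments are directed angles of arbitrary size. The cosine changes sign when a half
  turn is added and is even, which absorbs both possible values of the sum.\<close>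

lemma arccos_cos_supplement:
  assumes "x + y = pi \<or> x + y = - pi"
  shows "arccos (cos x) + arccos (cos y) = pi"
proof -
  have "y = pi - x \<or> y = - (pi + x)" using assms by auto
  then have "cos y = - cos x" by (auto simp: cos_diff cos_add simp del: minus_add_distrib)
  then show ?thesis by (simp add: arccos_minus)
qed

lemma in_open_segment_dir:
  assumes "p - a = k *\<^sub>R v" "b - p = k' *\<^sub>R v" "0 < k" "0 < k'" "v \<noteq> 0"
  shows "p \<in> open_segment a b"
proof -
  have b: "b = a + (k + k') *\<^sub>R v" and p: "p = a + k *\<^sub>R v"
    using assms(1,2) by (simp_all add: algebra_simps)
  have "(1 - u) *\<^sub>R a + u *\<^sub>R (a + w) = a + u *\<^sub>R w" for u :: real and w
    by (simp add: algebra_simps)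
  then have "p = (1 - k / (k + k')) *\<^sub>R a + (k / (k + k')) *\<^sub>R b"
    using assms(3,4) unfolding b p by simp
  then show ?thesis
    using assms(3-5) by (auto simp: in_segment b intro!: exI[of _ "k / (k + k')"])
qed

text \<open>The net in oriented line coordinates, with offsets d, e and radii r. Convexity and the
  order of the points survive as signs in the side conditions; each incircle becomes four signed
  distances, positive from the lines i, j and negative from i + 1, j + 1.\<close>

locale incircular_net =
  fixes I J :: "int set" and f \<omega> :: "int \<Rightarrow> int \<Rightarrow> real^2"
    and \<sigma> :: real and a b d e :: "int \<Rightarrow> real" and r :: "int \<Rightarrow> int \<Rightarrow> real"
  assumes I: "int_interval I" and J: "int_interval J" and \<sigma>: "\<sigma> * \<sigma> = 1"
    and range: "\<And>i j. i \<in> I \<Longrightarrow> j \<in> J \<Longrightarrow> 0 < b j - a i \<and> b j - a i < pi"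
    and on_lines: "\<And>i j. i \<in> I \<Longrightarrow> j \<in> J \<Longrightarrow> dir \<sigma> (a i) \<bullet> f i j = d i \<and> dir \<sigma> (b j) \<bullet> f i j = e j"
    and side_I: "\<And>i j. i \<in> I \<Longrightarrow> i + 1 \<in> I \<Longrightarrow> j \<in> J \<Longrightarrow>
      d i < dir \<sigma> (a i) \<bullet> f (i + 1) j \<and> dir \<sigma> (a (i + 1)) \<bullet> f i j < d (i + 1)"
    and side_J: "\<And>i j. i \<in> I \<Longrightarrow> j \<in> J \<Longrightarrow> j + 1 \<in> J \<Longrightarrow>
      e j < dir \<sigma> (b j) \<bullet> f i (j + 1) \<and> dir \<sigma> (b (j + 1)) \<bullet> f i j < e (j + 1)"
    and r_pos: "\<And>i j. (i, j) \<in> cells I J \<Longrightarrow> 0 < r i j"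
    and tangent_I: "\<And>i j. (i, j) \<in> cells I J \<Longrightarrow>
      dir \<sigma> (a i) \<bullet> \<omega> i j = d i + r i j \<and> dir \<sigma> (a (i + 1)) \<bullet> \<omega> i j = d (i + 1) - r i j"
    and tangent_J: "\<And>i j. (i, j) \<in> cells I J \<Longrightarrow>
      dir \<sigma> (b j) \<bullet> \<omega> i j = e j + r i j \<and> dir \<sigma> (b (j + 1)) \<bullet> \<omega> i j = e (j + 1) - r i j"
begin

text \<open>The difference of the new angles is again \<open>b j - a i\<close>, so the locale is
  closed under exchange of the families, and results on columns carry over to rows.\<close>

lemma transposed: "incircular_net J I (\<lambda>j i. f i j) (\<lambda>j i. \<omega> i j) (- \<sigma>) (\<lambda>j. - b j) (\<lambda>i. - a i) e d (\<lambda>j i. r i j)"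
proof -
  have cells: "(j, i) \<in> cells J I \<Longrightarrow> (i, j) \<in> cells I J" for i j
    by (auto simp: cells_def)
  show ?thesis
    by unfold_locales
      (use I J \<sigma> range on_lines side_I side_J r_pos[OF cells] tangent_I[OF cells] tangent_J[OF cells]
        in \<open>simp_all add: dir_uminus\<close>)
qed

definition S where "S i j = sin ((b j - a i) / 2)"
definition C where "C i j = cos ((b j - a i) / 2)"
definition mid where "mid i j = (a i + b j) / 2"

lemma S_pos: "i \<in> I \<Longrightarrow> j \<in> J \<Longrightarrow> 0 < S i j"
  using range[of i j] unfolding S_def by (intro sin_gt_zero) auto

lemma C_pos: "i \<in> I \<Longrightarrow> j \<in> J \<Longrightarrow> 0 < C i j"
  using range[of i j] unfolding C_def by (intro cos_gt_zero) auto

lemma dir_nonzero: "dir \<sigma> t \<noteq> 0"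
  using inner_dir[OF \<sigma>, of t t] by auto

section \<open>Edges of the subnets as angle bisectors, and their angles\<close>

text \<open>At the corners (i, j) and (i + 1, j + 1) the center has equal signed distances from the
  two sides, at the other two opposite ones; hence the quarter turn in the last two
  directions.\<close>

lemma center_offsets:
  assumes ij: "(i, j) \<in> cells I J"
  shows "\<omega> i j - f i j = (r i j / C i j) *\<^sub>R dir \<sigma> (mid i j)"
    "f (i + 1) (j + 1) - \<omega> i j = (r i j / C (i + 1) (j + 1)) *\<^sub>R dir \<sigma> (mid (i + 1) (j + 1))"
    "\<omega> i j - f (i + 1) j = (r i j / S (i + 1) j) *\<^sub>R dir \<sigma> (mid (i + 1) j + pi / 2)"
    "f i (j + 1) - \<omega> i j = (r i j / S i (j + 1)) *\<^sub>R dir \<sigma> (mid i (j + 1) + pi / 2)"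
proof -
  have m: "i \<in> I" "i + 1 \<in> I" "j \<in> J" "j + 1 \<in> J" using ij by (auto simp: cells_def)
  note rg = range[OF m(1,3)] range[OF m(1,4)] range[OF m(2,3)] range[OF m(2,4)]
  note fx = on_lines[OF m(1,3)] on_lines[OF m(1,4)] on_lines[OF m(2,3)] on_lines[OF m(2,4)]
  show "\<omega> i j - f i j = (r i j / C i j) *\<^sub>R dir \<sigma> (mid i j)"
    unfolding C_def mid_def using rg fx tangent_I[OF ij] tangent_J[OF ij]
    by (intro dir_bisector(1)[OF \<sigma>]) (auto simp: inner_diff_right)
  show "f (i + 1) (j + 1) - \<omega> i j = (r i j / C (i + 1) (j + 1)) *\<^sub>R dir \<sigma> (mid (i + 1) (j + 1))"
    unfolding C_def mid_def using rg fx tangent_I[OF ij] tangent_J[OF ij]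
    by (intro dir_bisector(1)[OF \<sigma>]) (auto simp: inner_diff_right)
  show "\<omega> i j - f (i + 1) j = (r i j / S (i + 1) j) *\<^sub>R dir \<sigma> (mid (i + 1) j + pi / 2)"
    unfolding S_def mid_def using rg fx tangent_I[OF ij] tangent_J[OF ij]
    by (intro dir_bisector(2)[OF \<sigma>]) (auto simp: inner_diff_right)
  show "f i (j + 1) - \<omega> i j = (r i j / S i (j + 1)) *\<^sub>R dir \<sigma> (mid i (j + 1) + pi / 2)"
    unfolding S_def mid_def using rg fx tangent_I[OF ij] tangent_J[OF ij]
    by (intro dir_bisector(2)[OF \<sigma>]) (auto simp: inner_diff_right)
qed

text \<open>Both centers lie on the same bisector at the common vertex of the two cells, on opposite
  sides of it. The reversed edge is recorded with its angle shifted by pi, so that angles at an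
  incenter are differences of directions.\<close>

lemma diagonal_edge:
  assumes "(i, j) \<in> cells I J" "(i + 1, j + 1) \<in> cells I J"
  shows "f (i + 1) (j + 1) \<in> open_segment (\<omega> i j) (\<omega> (i + 1) (j + 1))"
    "\<exists>k>0. \<omega> (i + 1) (j + 1) - \<omega> i j = k *\<^sub>R dir \<sigma> (mid (i + 1) (j + 1))"
    "\<exists>k>0. \<omega> i j - \<omega> (i + 1) (j + 1) = k *\<^sub>R dir \<sigma> (mid (i + 1) (j + 1) + pi)"
proof -
  have "i + 1 \<in> I" "j + 1 \<in> J" using assms by (auto simp: cells_def)
  then have pos: "0 < r i j / C (i + 1) (j + 1)" "0 < r (i + 1) (j + 1) / C (i + 1) (j + 1)"
    using r_pos[OF assms(1)] r_pos[OF assms(2)] C_pos by simp_all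
  note off = center_offsets(2)[OF assms(1)] center_offsets(1)[OF assms(2)]
  show "f (i + 1) (j + 1) \<in> open_segment (\<omega> i j) (\<omega> (i + 1) (j + 1))"
    by (rule in_open_segment_dir[OF off pos dir_nonzero])
  have eq: "\<omega> (i + 1) (j + 1) - \<omega> i j = (r i j / C (i + 1) (j + 1) + r (i + 1) (j + 1) / C (i + 1) (j + 1)) *\<^sub>R dir \<sigma> (mid (i + 1) (j + 1))"
    unfolding scaleR_left_distrib off[symmetric] by simp
  then show "\<exists>k>0. \<omega> (i + 1) (j + 1) - \<omega> i j = k *\<^sub>R dir \<sigma> (mid (i + 1) (j + 1))"
    using pos by (blast intro: add_pos_pos)
  then show "\<exists>k>0. \<omega> i j - \<omega> (i + 1) (j + 1) = k *\<^sub>R dir \<sigma> (mid (i + 1) (j + 1) + pi)"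
    unfolding dir_add_pi by (metis minus_diff_eq scaleR_minus_right)
qed

lemma antidiagonal_edge:
  assumes "(i + 1, j) \<in> cells I J" "(i, j + 1) \<in> cells I J"
  shows "f (i + 1) (j + 1) \<in> open_segment (\<omega> (i + 1) j) (\<omega> i (j + 1))"
    "\<exists>k>0. \<omega> i (j + 1) - \<omega> (i + 1) j = k *\<^sub>R dir \<sigma> (mid (i + 1) (j + 1) + pi / 2)"
    "\<exists>k>0. \<omega> (i + 1) j - \<omega> i (j + 1) = k *\<^sub>R dir \<sigma> (mid (i + 1) (j + 1) + pi / 2 + pi)"
proof -
  have "i + 1 \<in> I" "j + 1 \<in> J" using assms by (auto simp: cells_def)
  then have pos: "0 < r (i + 1) j / S (i + 1) (j + 1)" "0 < r i (j + 1) / S (i + 1) (j + 1)"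
    using r_pos[OF assms(1)] r_pos[OF assms(2)] S_pos by simp_all
  note off = center_offsets(4)[OF assms(1)] center_offsets(3)[OF assms(2)]
  show "f (i + 1) (j + 1) \<in> open_segment (\<omega> (i + 1) j) (\<omega> i (j + 1))"
    by (rule in_open_segment_dir[OF off pos dir_nonzero])
  have eq: "\<omega> i (j + 1) - \<omega> (i + 1) j = (r (i + 1) j / S (i + 1) (j + 1) + r i (j + 1) / S (i + 1) (j + 1)) *\<^sub>R dir \<sigma> (mid (i + 1) (j + 1) + pi / 2)"
    unfolding scaleR_left_distrib off[symmetric] by simp
  then show "\<exists>k>0. \<omega> i (j + 1) - \<omega> (i + 1) j = k *\<^sub>R dir \<sigma> (mid (i + 1) (j + 1) + pi / 2)"
    using pos by (blast intro: add_pos_pos)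
  then show "\<exists>k>0. \<omega> (i + 1) j - \<omega> i (j + 1) = k *\<^sub>R dir \<sigma> (mid (i + 1) (j + 1) + pi / 2 + pi)"
    unfolding dir_add_pi by (metis minus_diff_eq scaleR_minus_right)
qed

lemma edges_cross_orthogonally:
  assumes "(i, j) \<in> cells I J" "(i + 1, j + 1) \<in> cells I J" "(i + 1, j) \<in> cells I J" "(i, j + 1) \<in> cells I J"
  shows "cross_orthogonally (\<omega> i j) (\<omega> (i + 1) (j + 1)) (\<omega> (i + 1) j) (\<omega> i (j + 1))"
    "cross_orthogonally (\<omega> (i + 1) j) (\<omega> i (j + 1)) (\<omega> i j) (\<omega> (i + 1) (j + 1))"
proof -
  have "orthogonal (\<omega> (i + 1) (j + 1) - \<omega> i j) (\<omega> i (j + 1) - \<omega> (i + 1) j)"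
    using diagonal_edge(2)[OF assms(1,2)] antidiagonal_edge(2)[OF assms(3,4)]
    by (auto simp: orthogonal_def inner_dir[OF \<sigma>])
  then show "cross_orthogonally (\<omega> i j) (\<omega> (i + 1) (j + 1)) (\<omega> (i + 1) j) (\<omega> i (j + 1))"
    "cross_orthogonally (\<omega> (i + 1) j) (\<omega> i (j + 1)) (\<omega> i j) (\<omega> (i + 1) (j + 1))"
    using diagonal_edge(1)[OF assms(1,2)] antidiagonal_edge(1)[OF assms(3,4)]
    unfolding cross_orthogonally_def by (auto simp: orthogonal_commute)
qed

text \<open>The four edges pass through the corners of the middle cell (i, j + 1). Each angle of the
  quadrilateral is a difference of two \<open>mid\<close> values plus an odd multiple of pi / 2, and
  for opposite corners the line angles cancel. For \<open>star_angles\<close> the same happens with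
  the corners of the cell (i, j).\<close>

lemma quad_angles:
  assumes c: "(i, j) \<in> cells I J" "(i + 1, j + 1) \<in> cells I J" "(i - 1, j + 1) \<in> cells I J" "(i, j + 2) \<in> cells I J"
  shows "angle (\<omega> (i - 1) (j + 1)) (\<omega> i j) (\<omega> (i + 1) (j + 1)) +
      angle (\<omega> (i + 1) (j + 1)) (\<omega> i (j + 2)) (\<omega> (i - 1) (j + 1)) = pi"
    "angle (\<omega> i j) (\<omega> (i + 1) (j + 1)) (\<omega> i (j + 2)) +
      angle (\<omega> i (j + 2)) (\<omega> (i - 1) (j + 1)) (\<omega> i j) = pi"
proof -
  obtain k1 k1' where 1: "0 < k1" "\<omega> (i + 1) (j + 1) - \<omega> i j = k1 *\<^sub>R dir \<sigma> (mid (i + 1) (j + 1))"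
    "0 < k1'" "\<omega> i j - \<omega> (i + 1) (j + 1) = k1' *\<^sub>R dir \<sigma> (mid (i + 1) (j + 1) + pi)"
    using diagonal_edge(2,3)[OF c(1,2)] by blast
  obtain k2 k2' where 2: "0 < k2" "\<omega> i (j + 2) - \<omega> (i - 1) (j + 1) = k2 *\<^sub>R dir \<sigma> (mid i (j + 2))"
    "0 < k2'" "\<omega> (i - 1) (j + 1) - \<omega> i (j + 2) = k2' *\<^sub>R dir \<sigma> (mid i (j + 2) + pi)"
    using diagonal_edge(2,3)[of "i - 1" "j + 1", unfolded int_shift] c(3,4) by blast
  obtain k3 k3' where 3: "0 < k3" "\<omega> (i - 1) (j + 1) - \<omega> i j = k3 *\<^sub>R dir \<sigma> (mid i (j + 1) + pi / 2)"
    "0 < k3'" "\<omega> i j - \<omega> (i - 1) (j + 1) = k3' *\<^sub>R dir \<sigma> (mid i (j + 1) + pi / 2 + pi)"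
    using antidiagonal_edge(2,3)[of "i - 1" j, unfolded int_shift] c(1,3) by blast
  obtain k4 k4' where 4: "0 < k4" "\<omega> i (j + 2) - \<omega> (i + 1) (j + 1) = k4 *\<^sub>R dir \<sigma> (mid (i + 1) (j + 2) + pi / 2)"
    "0 < k4'" "\<omega> (i + 1) (j + 1) - \<omega> i (j + 2) = k4' *\<^sub>R dir \<sigma> (mid (i + 1) (j + 2) + pi / 2 + pi)"
    using antidiagonal_edge(2,3)[of i "j + 1", unfolded int_shift] c(2,4) by blast
  show "angle (\<omega> (i - 1) (j + 1)) (\<omega> i j) (\<omega> (i + 1) (j + 1)) +
      angle (\<omega> (i + 1) (j + 1)) (\<omega> i (j + 2)) (\<omega> (i - 1) (j + 1)) = pi"
    unfolding angle_dir[OF \<sigma> 3(2,1) 1(2,1)] angle_dir[OF \<sigma> 4(4,3) 2(4,3)]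
    by (rule arccos_cos_supplement) (simp add: mid_def field_simps)
  show "angle (\<omega> i j) (\<omega> (i + 1) (j + 1)) (\<omega> i (j + 2)) +
      angle (\<omega> i (j + 2)) (\<omega> (i - 1) (j + 1)) (\<omega> i j) = pi"
    unfolding angle_dir[OF \<sigma> 1(4,3) 4(2,1)] angle_dir[OF \<sigma> 2(2,1) 3(4,3)]
    by (rule arccos_cos_supplement) (simp add: mid_def field_simps)
qed

lemma star_angles:
  assumes c: "(i, j) \<in> cells I J" "(i + 1, j + 1) \<in> cells I J" "(i - 1, j + 1) \<in> cells I J"
    "(i - 1, j - 1) \<in> cells I J" "(i + 1, j - 1) \<in> cells I J"
  shows "angle (\<omega> (i + 1) (j + 1)) (\<omega> i j) (\<omega> (i - 1) (j + 1)) +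
      angle (\<omega> (i - 1) (j - 1)) (\<omega> i j) (\<omega> (i + 1) (j - 1)) = pi"
    "angle (\<omega> (i - 1) (j + 1)) (\<omega> i j) (\<omega> (i - 1) (j - 1)) +
      angle (\<omega> (i + 1) (j - 1)) (\<omega> i j) (\<omega> (i + 1) (j + 1)) = pi"
proof -
  obtain k1 where 1: "0 < k1" "\<omega> (i + 1) (j + 1) - \<omega> i j = k1 *\<^sub>R dir \<sigma> (mid (i + 1) (j + 1))"
    using diagonal_edge(2)[OF c(1,2)] by blast
  obtain k2 where 2: "0 < k2" "\<omega> (i - 1) (j + 1) - \<omega> i j = k2 *\<^sub>R dir \<sigma> (mid i (j + 1) + pi / 2)"
    using antidiagonal_edge(2)[of "i - 1" j, unfolded int_shift] c(1,3) by blast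
  obtain k3 where 3: "0 < k3" "\<omega> (i - 1) (j - 1) - \<omega> i j = k3 *\<^sub>R dir \<sigma> (mid i j + pi)"
    using diagonal_edge(3)[of "i - 1" "j - 1", unfolded int_shift] c(1,4) by blast
  obtain k4 where 4: "0 < k4" "\<omega> (i + 1) (j - 1) - \<omega> i j = k4 *\<^sub>R dir \<sigma> (mid (i + 1) j + pi / 2 + pi)"
    using antidiagonal_edge(3)[of i "j - 1", unfolded int_shift] c(1,5) by blast
  show "angle (\<omega> (i + 1) (j + 1)) (\<omega> i j) (\<omega> (i - 1) (j + 1)) +
      angle (\<omega> (i - 1) (j - 1)) (\<omega> i j) (\<omega> (i + 1) (j - 1)) = pi"
    unfolding angle_dir[OF \<sigma> 1(2,1) 2(2,1)] angle_dir[OF \<sigma> 3(2,1) 4(2,1)]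
    by (rule arccos_cos_supplement) (simp add: mid_def field_simps)
  show "angle (\<omega> (i - 1) (j + 1)) (\<omega> i j) (\<omega> (i - 1) (j - 1)) +
      angle (\<omega> (i + 1) (j - 1)) (\<omega> i j) (\<omega> (i + 1) (j + 1)) = pi"
    unfolding angle_dir[OF \<sigma> 2(2,1) 3(2,1)] angle_dir[OF \<sigma> 4(2,1) 1(2,1)]
    by (rule arccos_cos_supplement) (simp add: mid_def field_simps)
qed

section \<open>Radii of neighbouring incircles and crossing diagonals\<close>

text \<open>Since \<open>dir\<close> is a unit vector, s is the distance of the two centers. Two
  expressions for one radius, from its two neighbours in a column, therefore give the ratio of
  consecutive distances.\<close>

lemma column_step:
  assumes "(i, j) \<in> cells I J" "(i, j + 1) \<in> cells I J"
  obtains s where "0 < s" "\<omega> i (j + 1) - \<omega> i j = s *\<^sub>R dir \<sigma> ((a i + a (i + 1)) / 2 + pi / 2)"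
    "r i j = s * (S i (j + 1) * C (i + 1) (j + 1))"
    "r i (j + 1) = s * (S (i + 1) (j + 1) * C i (j + 1))"
proof -
  have m: "i \<in> I" "i + 1 \<in> I" "j + 1 \<in> J" using assms by (auto simp: cells_def)
  note rg = range[OF m(1,3), THEN conjunct1] range[OF m(1,3), THEN conjunct2]
    range[OF m(2,3), THEN conjunct1] range[OF m(2,3), THEN conjunct2]
  have w: "dir \<sigma> (a i) \<bullet> (\<omega> i (j + 1) - \<omega> i j) = r i (j + 1) - r i j"
    "dir \<sigma> (a (i + 1)) \<bullet> (\<omega> i (j + 1) - \<omega> i j) = r i j - r i (j + 1)"
    "dir \<sigma> (b (j + 1)) \<bullet> (\<omega> i (j + 1) - \<omega> i j) = r i j + r i (j + 1)"
    using tangent_I[OF assms(1)] tangent_I[OF assms(2)] tangent_J[OF assms(1)] tangent_J[OF assms(2)]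
    by (simp_all add: inner_diff_right)
  obtain s where s: "\<omega> i (j + 1) - \<omega> i j = s *\<^sub>R dir \<sigma> ((a i + a (i + 1)) / 2 + pi / 2)"
    "r i j = s * (S i (j + 1) * C (i + 1) (j + 1))"
    "r i (j + 1) = s * (S (i + 1) (j + 1) * C i (j + 1))"
    unfolding S_def C_def using center_step[OF \<sigma> rg w] by blast
  moreover have "0 < S i (j + 1) * C (i + 1) (j + 1)"
    using S_pos C_pos m by simp
  then have "0 < s" using s(2) r_pos[OF assms(1)] by (metis zero_less_mult_pos2)
  ultimately show ?thesis using that by blast
qed

lemma row_step:
  assumes "(i, j) \<in> cells I J" "(i + 1, j) \<in> cells I J"
  obtains s where "0 < s" "\<omega> (i + 1) j - \<omega> i j = s *\<^sub>R dir \<sigma> ((b j + b (j + 1)) / 2 - pi / 2)"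
    "r i j = s * (S (i + 1) j * C (i + 1) (j + 1))"
    "r (i + 1) j = s * (S (i + 1) (j + 1) * C (i + 1) j)"
proof -
  interpret T: incircular_net J I "\<lambda>j i. f i j" "\<lambda>j i. \<omega> i j" "- \<sigma>" "\<lambda>j. - b j" "\<lambda>i. - a i" e d "\<lambda>j i. r i j"
    by (rule transposed)
  have SC: "T.S j i = S i j" "T.C j i = C i j" for i j
    by (simp_all add: S_def C_def T.S_def T.C_def)
  have "(j, i) \<in> cells J I" "(j, i + 1) \<in> cells J I" using assms by (auto simp: cells_def)
  then obtain s where s: "0 < s" "\<omega> (i + 1) j - \<omega> i j = s *\<^sub>R dir (- \<sigma>) ((- b j + - b (j + 1)) / 2 + pi / 2)"
    "r i j = s * (S (i + 1) j * C (i + 1) (j + 1))"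
    "r (i + 1) j = s * (S (i + 1) (j + 1) * C (i + 1) j)"
    using T.column_step[of j i] unfolding SC by blast
  have arg: "(- b j + - b (j + 1)) / 2 + pi / 2 = - ((b j + b (j + 1)) / 2 - pi / 2)"
    by (simp add: field_simps)
  show ?thesis using that[OF s(1) s(2)[unfolded arg dir_uminus] s(3,4)] .
qed

text \<open>Each of the four radii around the vertex is expressed once along its column and once
  along its row; combining the four equations cancels the four distances.\<close>

lemma vertex_relation:
  assumes c: "(i, j) \<in> cells I J" "(i + 1, j) \<in> cells I J" "(i, j + 1) \<in> cells I J" "(i + 1, j + 1) \<in> cells I J"
  shows "S (i + 1) (j + 2) * C (i + 2) (j + 1) * (S (i + 1) j * C i (j + 1)) =
    S (i + 2) (j + 1) * C (i + 1) (j + 2) * (S i (j + 1) * C (i + 1) j)"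
proof -
  have m: "i \<in> I" "i + 1 \<in> I" "i + 2 \<in> I" "j \<in> J" "j + 1 \<in> J" "j + 2 \<in> J"
    using c by (auto simp: cells_def add.assoc)
  obtain s1 where s1: "0 < s1" "r i j = s1 * (S i (j + 1) * C (i + 1) (j + 1))"
    "r i (j + 1) = s1 * (S (i + 1) (j + 1) * C i (j + 1))"
    using column_step[OF c(1,3)] by blast
  obtain s2 where s2: "0 < s2" "r (i + 1) j = s2 * (S (i + 1) (j + 1) * C (i + 2) (j + 1))"
    "r (i + 1) (j + 1) = s2 * (S (i + 2) (j + 1) * C (i + 1) (j + 1))"
    using column_step[OF c(2,4), unfolded int_shift] by blast
  obtain t1 where t1: "0 < t1" "r i j = t1 * (S (i + 1) j * C (i + 1) (j + 1))"
    "r (i + 1) j = t1 * (S (i + 1) (j + 1) * C (i + 1) j)"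
    using row_step[OF c(1,2)] by blast
  obtain t2 where t2: "0 < t2" "r i (j + 1) = t2 * (S (i + 1) (j + 1) * C (i + 1) (j + 2))"
    "r (i + 1) (j + 1) = t2 * (S (i + 1) (j + 2) * C (i + 1) (j + 1))"
    using row_step[OF c(3,4), unfolded int_shift] by blast
  have alg: "S12 * C21 * (S10 * C01) = S21 * C12 * (S01 * C10)"
    if "s1 * (S01 * C11) = t1 * (S10 * C11)" "s1 * (S11 * C01) = t2 * (S11 * C12)"
      "s2 * (S11 * C21) = t1 * (S11 * C10)" "s2 * (S21 * C11) = t2 * (S12 * C11)"
      "0 < s1" "0 < s2" "0 < t1" "0 < t2" "0 < S11" "0 < C11"
    for S01 C11 S10 S11 C01 C12 C21 C10 S21 S12 s1 s2 t1 t2 :: real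
  proof -
    have e: "s1 * S01 = t1 * S10" "s1 * C01 = t2 * C12" "s2 * C21 = t1 * C10" "s2 * S21 = t2 * S12"
      using that by simp_all
    have "(s1 * s2 * t1 * t2) * (S12 * C21 * (S10 * C01)) = (t2 * S12) * (s2 * C21) * ((t1 * S10) * (s1 * C01))"
      by (simp only: mult_ac)
    also have "\<dots> = (s2 * S21) * (t1 * C10) * ((s1 * S01) * (t2 * C12))"
      unfolding e ..
    also have "\<dots> = (s1 * s2 * t1 * t2) * (S21 * C12 * (S01 * C10))"
      by (simp only: mult_ac)
    finally show ?thesis using that by simp
  qed
  show ?thesis
    by (rule alg[of s1 _ "C (i + 1) (j + 1)" t1 _ "S (i + 1) (j + 1)" _ t2 _ s2])
      (use s1 s2 t1 t2 S_pos C_pos m in auto)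
qed

text \<open>Both diagonals pass through the middle incenter along the bisectors of its two strips.
  These are not parallel, since the mean angle of the b lines exceeds that of the a lines by less
  than pi.\<close>

lemma diagonals_meet:
  assumes c: "(i, j) \<in> cells I J" "(i, j + 1) \<in> cells I J" "(i, j + 2) \<in> cells I J"
    "(i - 1, j + 1) \<in> cells I J" "(i + 1, j + 1) \<in> cells I J"
  shows "closed_segment (\<omega> i j) (\<omega> i (j + 2)) \<inter>
    closed_segment (\<omega> (i + 1) (j + 1)) (\<omega> (i - 1) (j + 1)) = {\<omega> i (j + 1)}"
proof -
  let ?p = "dir \<sigma> ((a i + a (i + 1)) / 2 + pi / 2)" and ?q = "dir \<sigma> ((b (j + 1) + b (j + 2)) / 2 - pi / 2)"
  obtain s1 where s1: "0 < s1" "\<omega> i (j + 1) - \<omega> i j = s1 *\<^sub>R ?p"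
    using column_step[OF c(1,2)] by blast
  obtain s2 where s2: "0 < s2" "\<omega> i (j + 2) - \<omega> i (j + 1) = s2 *\<^sub>R ?p"
    using column_step[of i "j + 1", unfolded int_shift] c(2,3) by blast
  obtain t1 where t1: "0 < t1" "\<omega> i (j + 1) - \<omega> (i - 1) (j + 1) = t1 *\<^sub>R ?q"
    using row_step[of "i - 1" "j + 1", unfolded int_shift] c(2,4) by blast
  obtain t2 where t2: "0 < t2" "\<omega> (i + 1) (j + 1) - \<omega> i (j + 1) = t2 *\<^sub>R ?q"
    using row_step[of i "j + 1", unfolded int_shift] c(2,5) by blast
  have on1: "\<omega> i (j + 1) \<in> closed_segment (\<omega> i j) (\<omega> i (j + 2))"
    using in_open_segment_dir[OF s1(2) s2(2) s1(1) s2(1) dir_nonzero] segment_open_subset_closed by blast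
  have on2: "\<omega> i (j + 1) \<in> closed_segment (\<omega> (i + 1) (j + 1)) (\<omega> (i - 1) (j + 1))"
    using in_open_segment_dir[OF t1(2) t2(2) t1(1) t2(1) dir_nonzero] segment_open_subset_closed
    by (metis closed_segment_commute subsetD)
  have "x = \<omega> i (j + 1)" if x: "x \<in> closed_segment (\<omega> i j) (\<omega> i (j + 2))"
    "x \<in> closed_segment (\<omega> (i + 1) (j + 1)) (\<omega> (i - 1) (j + 1))" for x
  proof -
    obtain u where u: "x = (1 - u) *\<^sub>R \<omega> i j + u *\<^sub>R \<omega> i (j + 2)" using x(1) by (auto simp: in_segment)
    obtain v where v: "x = (1 - v) *\<^sub>R \<omega> (i + 1) (j + 1) + v *\<^sub>R \<omega> (i - 1) (j + 1)"
      using x(2) by (auto simp: in_segment)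
    have "x - \<omega> i (j + 1) = u *\<^sub>R (\<omega> i (j + 2) - \<omega> i (j + 1)) - (1 - u) *\<^sub>R (\<omega> i (j + 1) - \<omega> i j)"
      unfolding u by (simp add: algebra_simps)
    then have p: "x - \<omega> i (j + 1) = (u * s2 - (1 - u) * s1) *\<^sub>R ?p"
      unfolding s1(2) s2(2) by (simp add: algebra_simps)
    have "x - \<omega> i (j + 1) = (1 - v) *\<^sub>R (\<omega> (i + 1) (j + 1) - \<omega> i (j + 1)) - v *\<^sub>R (\<omega> i (j + 1) - \<omega> (i - 1) (j + 1))"
      unfolding v by (simp add: algebra_simps)
    then have q: "x - \<omega> i (j + 1) = ((1 - v) * t2 - v * t1) *\<^sub>R ?q"
      unfolding t1(2) t2(2) by (simp add: algebra_simps)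
    have m: "i \<in> I" "i + 1 \<in> I" "j + 1 \<in> J" "j + 2 \<in> J" using c by (auto simp: cells_def add.assoc)
    let ?A = "(a i + a (i + 1)) / 2" and ?B = "(b (j + 1) + b (j + 2)) / 2"
    have "0 < ?B - ?A" "?B - ?A < pi"
      using range[OF m(1,3)] range[OF m(2,4)] by (simp_all add: field_simps)
    then have "sin (?B - ?A) \<noteq> 0" using sin_gt_zero less_irrefl by metis
    moreover have "dir \<sigma> ?A \<bullet> (x - \<omega> i (j + 1)) = 0" unfolding p by (simp only: inner_scaleR_right inner_dir_quarter[OF \<sigma>] mult_zero_right)
    moreover have "dir \<sigma> ?B \<bullet> (x - \<omega> i (j + 1)) = 0" unfolding q by (simp only: inner_scaleR_right inner_dir_quarter[OF \<sigma>] mult_zero_right)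
    ultimately have "x - \<omega> i (j + 1) = 0" by (intro eq_zero_if_orthogonal_dirs[OF \<sigma>, of ?A _ ?B])
    then show ?thesis by simp
  qed
  then show ?thesis using on1 on2 by blast
qed

end

section \<open>Koenigs nets\<close>

lemma multiplicative_potential:
  fixes R :: "int \<Rightarrow> real"
  assumes "\<And>i. 0 < R i"
  obtains g where "\<And>i. 0 < g i" "\<And>i. g (i + 1) = R i * g i"
proof
  define g where "g i = (if 0 \<le> i then \<Prod>k\<in>{0..<i}. R k else inverse (\<Prod>k\<in>{i..<0}. R k))" for i
  show "0 < g i" for i
    using assms by (auto simp: g_def intro!: prod_pos)
  show "g (i + 1) = R i * g i" for i
  proof (cases "0 \<le> i")
    case True
    then have "{0..<i + 1} = insert i {0..<i}" by auto
    then show ?thesis using True by (simp add: g_def)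
  next
    case False
    then have "{i..<0} = insert i {i + 1..<0}" by auto
    moreover have "R i \<noteq> 0" using assms[of i] by simp
    ultimately show ?thesis using False by (auto simp: g_def)
  qed
qed

lemma multiplicative_potential_step2:
  fixes R :: "int \<Rightarrow> real"
  obtains g where "\<And>i. 0 < g i" "\<And>i. 0 < R i \<Longrightarrow> g (i + 2) = R i * g i"
proof -
  \<comment> \<open>Outside the net R may take any value; the default 1 makes a total positive
    potential possible.\<close>
  define R' where "R' i = (if 0 < R i then R i else 1)" for i
  then have R': "0 < R' i" for i by simp
  have "\<exists>g. (\<forall>k. 0 < g k) \<and> (\<forall>k. g (k + 1) = R' (2 * k + p) * g k)" for p
    by (rule multiplicative_potential[of "\<lambda>k. R' (2 * k + p)", OF R']) blast
  then obtain G where G: "\<And>p k. 0 < G p k" "\<And>p k. G p (k + 1) = R' (2 * k + p) * G p k"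
    by metis
  show ?thesis
  proof
    show "0 < G (i mod 2) (i div 2)" for i :: int by (rule G)
    show "G ((i + 2) mod 2) ((i + 2) div 2) = R i * G (i mod 2) (i div 2)" if "0 < R i" for i
      using G(2)[of "i mod 2" "i div 2"] that by (simp add: R'_def)
  qed
qed

text \<open>Steps of length two decouple the parity classes, and on each of them closing around the
  elementary squares suffices.\<close>

lemma multiplicative_potential_plane:
  fixes R1 R2 :: "int \<Rightarrow> int \<Rightarrow> real"
  assumes I: "int_interval I"
    and pos: "\<And>i j. i \<in> I \<Longrightarrow> j \<in> J \<Longrightarrow> j + 2 \<in> J \<Longrightarrow> 0 < R1 i j"
      "\<And>i j. i \<in> I \<Longrightarrow> i + 2 \<in> I \<Longrightarrow> j \<in> J \<Longrightarrow> 0 < R2 i j"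
    and closed: "\<And>i j. i \<in> I \<Longrightarrow> i + 2 \<in> I \<Longrightarrow> j \<in> J \<Longrightarrow> j + 2 \<in> J \<Longrightarrow>
      R1 i j * R2 i (j + 2) = R2 i j * R1 (i + 2) j"
  obtains \<nu> where "\<And>i j. 0 < \<nu> i j"
    "\<And>i j. i \<in> I \<Longrightarrow> j \<in> J \<Longrightarrow> j + 2 \<in> J \<Longrightarrow> \<nu> i (j + 2) = R1 i j * \<nu> i j"
    "\<And>i j. i \<in> I \<Longrightarrow> i + 2 \<in> I \<Longrightarrow> j \<in> J \<Longrightarrow> \<nu> (i + 2) j = R2 i j * \<nu> i j"
proof -
  \<comment> \<open>Every column needs a base column of its own parity inside I, which is
    \<open>i0\<close> or \<open>i0 + 1\<close>; an interval without two consecutive members has at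
    most one member.\<close>
  obtain i0 where i0: "\<And>i. i \<in> I \<Longrightarrow> i0 + (i - i0) mod 2 \<in> I"
  proof (cases "\<exists>i. i \<in> I \<and> i + 1 \<in> I")
    case True
    then obtain i0 where i0: "i0 \<in> I" "i0 + 1 \<in> I" by blast
    have "i0 + (i - i0) mod 2 \<in> I" for i
      using i0 by (cases "(i - i0) mod 2 = 0") (auto simp: not_mod_2_eq_0_eq_1)
    then show ?thesis using that by blast
  next
    case False
    show ?thesis
    proof (cases "I = {}")
      case False
      then obtain i0 where i0: "i0 \<in> I" by blast
      have "i = i0" if "i \<in> I" for i
      proof (rule ccontr)
        assume "i \<noteq> i0"
        then have "min i i0 \<in> I" "min i i0 + 1 \<in> {min i i0..max i i0}" "{min i i0..max i i0} \<subseteq> I"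
          using i0 that I unfolding int_interval_def by (auto simp: min_def max_def)
        then show False using \<open>\<nexists>i. i \<in> I \<and> i + 1 \<in> I\<close> by blast
      qed
      then show ?thesis using that[of i0] i0 by auto
    qed (use that in auto)
  qed
  have "\<exists>g. (\<forall>j. 0 < g j) \<and> (\<forall>j. 0 < R1 i j \<longrightarrow> g (j + 2) = R1 i j * g j)" for i
    using multiplicative_potential_step2[of "R1 i"] by metis
  then obtain G where G: "\<And>i j. 0 < G i j" "\<And>i j. 0 < R1 i j \<Longrightarrow> G i (j + 2) = R1 i j * G i j"
    by metis
  have "\<exists>g. (\<forall>i. 0 < g i) \<and> (\<forall>i. 0 < R2 i j \<longrightarrow> g (i + 2) = R2 i j * g i)" for j
    using multiplicative_potential_step2[of "\<lambda>i. R2 i j"] by metis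
  then obtain H where H: "\<And>j i. 0 < H j i" "\<And>j i. 0 < R2 i j \<Longrightarrow> H j (i + 2) = R2 i j * H j i"
    by metis
  define c where "c i = i0 + (i - i0) mod 2" for i
  \<comment> \<open>G integrates R1 along the base column and H integrates R2 along the row from
    there. The row equation is then immediate, while the column equation holds on the base column
    and is transported by \<open>closed\<close>.\<close>
  define \<nu> where "\<nu> i j = H j i / H j (c i) * G (c i) j" for i j
  have c2: "c (i + 2) = c i" for i
  proof -
    have "i + 2 - i0 = (i - i0) + 2" by simp
    then show ?thesis unfolding c_def by (simp only: mod_add_self2)
  qed
  have \<nu>2: "\<nu> (i + 2) j = R2 i j * \<nu> i j" if "i \<in> I" "i + 2 \<in> I" "j \<in> J" for i j
    using H(2)[OF pos(2)[OF that]] by (simp add: \<nu>_def c2)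
  have \<nu>pos: "0 < \<nu> i j" for i j using G H by (simp add: \<nu>_def)
  have \<nu>1: "\<nu> i (j + 2) = R1 i j * \<nu> i j" if i: "i \<in> I" and j: "j \<in> J" "j + 2 \<in> J" for i j
  proof -
    let ?P = "\<lambda>k. \<nu> (c i + 2 * k) (j + 2) = R1 (c i + 2 * k) j * \<nu> (c i + 2 * k) j"
    let ?K = "{k. c i + 2 * k \<in> I}"
    have "int_interval ?K"
      unfolding int_interval_def
    proof (intro ballI subsetI)
      fix p q k assume pq: "p \<in> ?K" "q \<in> ?K" and k: "k \<in> {p..q}"
      have "{c i + 2 * p..c i + 2 * q} \<subseteq> I"
        using I pq unfolding int_interval_def by blast
      moreover have "c i + 2 * k \<in> {c i + 2 * p..c i + 2 * q}" using k by simp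
      ultimately show "k \<in> ?K" by blast
    qed
    moreover have "0 \<in> ?K" using i0[OF i] by (simp add: c_def)
    moreover have ic: "c i + 2 * ((i - i0) div 2) = i"
      using mult_div_mod_eq[of 2 "i - i0"] by (simp add: c_def)
    then have "(i - i0) div 2 \<in> ?K" using i by simp
    moreover have "?P k \<longleftrightarrow> ?P (k + 1)" if "k \<in> ?K" "k + 1 \<in> ?K" for k
    proof -
      let ?m = "c i + 2 * k"
      have m: "?m \<in> I" "?m + 2 \<in> I" using that by (simp_all add: algebra_simps)
      have m2: "c i + 2 * (k + 1) = ?m + 2" by simp
      have "?P (k + 1) \<longleftrightarrow> R2 ?m (j + 2) * \<nu> ?m (j + 2) = R1 (?m + 2) j * (R2 ?m j * \<nu> ?m j)"
        unfolding m2 \<nu>2[OF m j(1)] \<nu>2[OF m j(2)] ..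
      also have "R1 (?m + 2) j * (R2 ?m j * \<nu> ?m j) = R2 ?m (j + 2) * (R1 ?m j * \<nu> ?m j)"
        using closed[OF m j] by (simp add: mult_ac)
      finally show ?thesis using pos(2)[OF m j(2)] by simp
    qed
    ultimately have "?P 0 \<longleftrightarrow> ?P ((i - i0) div 2)"
      by (rule int_interval_iff_induct)
    moreover have "?P 0"
    proof -
      have "c (c i) = c i" by (simp add: c_def)
      then have "\<nu> (c i) j' = G (c i) j'" for j' using H(1)[of j' "c i"] by (simp add: \<nu>_def)
      then show ?thesis using G(2)[OF pos(1)[OF _ j]] i0[OF i] by (simp add: c_def)
    qed
    ultimately show ?thesis unfolding ic by blast
  qed
  show ?thesis using that[of \<nu>] \<nu>pos \<nu>1 \<nu>2 by blast
qed

text \<open>The point m is the crossing of the diagonals, given by its two division ratios. It is a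
  weighted mean of x1 and x2, and x12 lies on the prolongation from x through m; eliminating m gives
  the equation.\<close>

lemma koenigs_equation:
  fixes x x1 x2 x12 m :: "real^2"
  assumes pos: "0 < n" "0 < n1" "0 < n2" "0 < n12"
    and m: "n *\<^sub>R (x12 - m) = n12 *\<^sub>R (m - x)" "n2 *\<^sub>R (x1 - m) = n1 *\<^sub>R (m - x2)"
  shows "x12 - x1 - x2 + x = ((n2 * n12 - n * n1) / (n * (n1 + n2))) *\<^sub>R (x1 - x) +
    ((n1 * n12 - n * n2) / (n * (n1 + n2))) *\<^sub>R (x2 - x)"
proof -
  have real: "y12 - y1 - y2 + y = ((n2 * n12 - n * n1) / (n * (n1 + n2))) * (y1 - y) +
      ((n1 * n12 - n * n2) / (n * (n1 + n2))) * (y2 - y)"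
    if 1: "n * (y12 - z) = n12 * (z - y)" and 2: "n2 * (y1 - z) = n1 * (z - y2)"
    for y12 y1 y2 y z :: real
  proof -
    have "n1 + n2 \<noteq> 0" using pos by simp
    then have z: "z = (n2 * y1 + n1 * y2) / (n1 + n2)"
      using 2 by (simp add: field_simps)
    have y12: "y12 = z + n12 * (z - y) / n"
      using 1 pos by (simp add: field_simps)
    show ?thesis
      unfolding y12 z using pos \<open>n1 + n2 \<noteq> 0\<close>
      by (simp add: divide_simps) (simp add: algebra_simps)
  qed
  have "n * (x12 $ k - m $ k) = n12 * (m $ k - x $ k)" "n2 * (x1 $ k - m $ k) = n1 * (m $ k - x2 $ k)" for k
    using arg_cong[OF m(1), of "\<lambda>v. v $ k"] arg_cong[OF m(2), of "\<lambda>v. v $ k"] by simp_all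
  from real[OF this] show ?thesis by (simp add: vec_eq_iff)
qed

context incircular_net
begin

lemma koenigs_ratios_closed:
  assumes "i \<in> I" "i + 1 \<in> I" "i + 2 \<in> I" "i + 3 \<in> I" "j \<in> J" "j + 1 \<in> J" "j + 2 \<in> J" "j + 3 \<in> J"
  shows "C i (j + 1) * C (i + 3) (j + 2) * (S (i + 1) (j + 3) * S (i + 2) j) =
    C (i + 1) j * C (i + 2) (j + 3) * (S (i + 3) (j + 1) * S i (j + 2))"
proof -
  have mI: "i + k \<in> I" if "k \<in> {0..3}" for k
    using assms(1,4) I that unfolding int_interval_def by (meson atLeastAtMost_iff subsetD add_left_mono le_add_same_cancel1)
  have mJ: "j + k \<in> J" if "k \<in> {0..3}" for k
    using assms(5,8) J that unfolding int_interval_def by (meson atLeastAtMost_iff subsetD add_left_mono le_add_same_cancel1)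
  have cell: "(i + k, j + l) \<in> cells I J" if "k \<in> {0..2}" "l \<in> {0..2}" for k l
    using mI[of k] mI[of "k + 1"] mJ[of l] mJ[of "l + 1"] that by (simp add: cells_def add.assoc)
  show ?thesis
  proof (rule incenter_ratio_cycle[of "\<lambda>l. b (j + l)" "\<lambda>k. a (i + k)", folded S_def C_def, simplified])
    show "a (i + k) < b (j + l) \<and> b (j + l) - a (i + k) < pi"
      if "0 \<le> k \<and> k \<le> 3" "0 \<le> l \<and> l \<le> 3" for k l
      using range[OF mI mJ, of k l] that by simp
    show "S (i + (k + 1)) (j + (l + 2)) * C (i + (k + 2)) (j + (l + 1)) *
        (S (i + (k + 1)) (j + l) * C (i + k) (j + (l + 1))) =
       S (i + (k + 2)) (j + (l + 1)) * C (i + (k + 1)) (j + (l + 2)) *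
        (S (i + k) (j + (l + 1)) * C (i + (k + 1)) (j + l))"
      if "0 \<le> k \<and> k \<le> 1" "0 \<le> l \<and> l \<le> 1" for k l
      using vertex_relation[of "i + k" "j + l"] cell[of k l] cell[of "k + 1" l] cell[of k "l + 1"] cell[of "k + 1" "l + 1"] that
      by (simp add: add.assoc)
  qed
qed

text \<open>R1 and R2 are quotients of consecutive distances of incenters along a column and a row.
  Diagonals of the quadrilaterals of either subnet are steps of length two in one index, so one
  function on all cells serves both subnets.\<close>

lemma koenigs_function:
  obtains \<nu> where "\<And>i j. 0 < \<nu> i j"
    "\<And>i j. {(i, j), (i, j + 1), (i, j + 2), (i - 1, j + 1), (i + 1, j + 1)} \<subseteq> cells I J \<Longrightarrow>
      \<nu> i j *\<^sub>R (\<omega> i (j + 2) - \<omega> i (j + 1)) = \<nu> i (j + 2) *\<^sub>R (\<omega> i (j + 1) - \<omega> i j) \<and>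
      \<nu> (i - 1) (j + 1) *\<^sub>R (\<omega> (i + 1) (j + 1) - \<omega> i (j + 1)) =
        \<nu> (i + 1) (j + 1) *\<^sub>R (\<omega> i (j + 1) - \<omega> (i - 1) (j + 1))"
proof -
  define R1 where "R1 i j = S (i + 1) (j + 1) * C i (j + 1) / (S i (j + 2) * C (i + 1) (j + 2))" for i j
  define R2 where "R2 i j = S (i + 1) (j + 1) * C (i + 1) j / (S (i + 2) j * C (i + 2) (j + 1))" for i j
  \<comment> \<open>Cells are indexed by the product of these two intervals of strips.\<close>
  let ?I = "{i. i \<in> I \<and> i + 1 \<in> I}" and ?J = "{j. j \<in> J \<and> j + 1 \<in> J}"
  have I': "int_interval ?I"
    using I unfolding int_interval_def by (auto simp: subset_eq)
  have p1: "0 < R1 i j" if "i \<in> ?I" "j \<in> ?J" "j + 2 \<in> ?J" for i j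
    using that S_pos C_pos by (simp add: R1_def)
  have p2: "0 < R2 i j" if "i \<in> ?I" "i + 2 \<in> ?I" "j \<in> ?J" for i j
    using that S_pos C_pos by (simp add: R2_def)
  have cl: "R1 i j * R2 i (j + 2) = R2 i j * R1 (i + 2) j"
    if "i \<in> ?I" "i + 2 \<in> ?I" "j \<in> ?J" "j + 2 \<in> ?J" for i j
  proof -
    have m: "i \<in> I" "i + 1 \<in> I" "i + 2 \<in> I" "i + 3 \<in> I" "j \<in> J" "j + 1 \<in> J" "j + 2 \<in> J" "j + 3 \<in> J"
      using that by (simp_all add: add.assoc)
    have alg: "S11 * C01 / (S02 * C12) * (S13 * C12 / (S22 * C23)) = S11 * C10 / (S20 * C21) * (S31 * C21 / (S22 * C32))"
      if "C01 * C32 * (S13 * S20) = C10 * C23 * (S31 * S02)"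
        "S02 \<noteq> 0" "C12 \<noteq> 0" "S22 \<noteq> 0" "C23 \<noteq> 0" "S20 \<noteq> 0" "C21 \<noteq> 0" "C32 \<noteq> 0"
      for S11 C01 S02 C12 S13 S22 C23 C10 S20 C21 S31 C32 :: real
    proof -
      have "S11 * C01 / (S02 * C12) * (S13 * C12 / (S22 * C23)) = S11 / S22 * (C01 * S13 / (S02 * C23))"
        "S11 * C10 / (S20 * C21) * (S31 * C21 / (S22 * C32)) = S11 / S22 * (C10 * S31 / (S20 * C32))"
        using that(2-) by (simp_all add: divide_simps)
      moreover have "C01 * S13 / (S02 * C23) = C10 * S31 / (S20 * C32)"
        using that by (simp add: frac_eq_eq mult_ac)
      ultimately show ?thesis by simp
    qed
    have ne: "S k l \<noteq> 0" "C k l \<noteq> 0" if "k \<in> I" "l \<in> J" for k l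
      using S_pos[OF that] C_pos[OF that] by auto
    have s: "i + 2 + 1 = i + 3" "j + 2 + 1 = j + 3" by simp_all
    show ?thesis unfolding R1_def R2_def s
      by (rule alg[OF koenigs_ratios_closed[OF m]]) (simp_all add: ne m)
  qed
  obtain \<nu> where \<nu>: "\<And>i j. 0 < \<nu> i j"
    "\<And>i j. i \<in> ?I \<Longrightarrow> j \<in> ?J \<Longrightarrow> j + 2 \<in> ?J \<Longrightarrow> \<nu> i (j + 2) = R1 i j * \<nu> i j"
    "\<And>i j. i \<in> ?I \<Longrightarrow> i + 2 \<in> ?I \<Longrightarrow> j \<in> ?J \<Longrightarrow> \<nu> (i + 2) j = R2 i j * \<nu> i j"
    by (rule multiplicative_potential_plane[of ?I ?J R1 R2, OF I' p1 p2 cl]) blast+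
  have col: "\<nu> i j *\<^sub>R (\<omega> i (j + 2) - \<omega> i (j + 1)) = \<nu> i (j + 2) *\<^sub>R (\<omega> i (j + 1) - \<omega> i j)"
    if c: "(i, j) \<in> cells I J" "(i, j + 1) \<in> cells I J" "(i, j + 2) \<in> cells I J" for i j
  proof -
    have m: "i \<in> ?I" "j \<in> ?J" "j + 2 \<in> ?J" using c by (auto simp: cells_def)
    obtain s1 where s1: "\<omega> i (j + 1) - \<omega> i j = s1 *\<^sub>R dir \<sigma> ((a i + a (i + 1)) / 2 + pi / 2)"
      "r i (j + 1) = s1 * (S (i + 1) (j + 1) * C i (j + 1))"
      using column_step[OF c(1,2)] by blast
    obtain s2 where s2: "\<omega> i (j + 2) - \<omega> i (j + 1) = s2 *\<^sub>R dir \<sigma> ((a i + a (i + 1)) / 2 + pi / 2)"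
      "r i (j + 1) = s2 * (S i (j + 2) * C (i + 1) (j + 2))"
      using column_step[of i "j + 1", unfolded int_shift] c(2,3) by blast
    have "S i (j + 2) \<noteq> 0" "C (i + 1) (j + 2) \<noteq> 0"
      using m S_pos[of i "j + 2"] C_pos[of "i + 1" "j + 2"] by simp_all
    then have "s2 = R1 i j * s1" using s1(2) s2(2) by (simp add: R1_def field_simps)
    then show ?thesis unfolding s1(1) s2(1) \<nu>(2)[OF m] by simp
  qed
  have row: "\<nu> i j *\<^sub>R (\<omega> (i + 2) j - \<omega> (i + 1) j) = \<nu> (i + 2) j *\<^sub>R (\<omega> (i + 1) j - \<omega> i j)"
    if c: "(i, j) \<in> cells I J" "(i + 1, j) \<in> cells I J" "(i + 2, j) \<in> cells I J" for i j
  proof -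
    have m: "i \<in> ?I" "i + 2 \<in> ?I" "j \<in> ?J" using c by (auto simp: cells_def)
    obtain s1 where s1: "\<omega> (i + 1) j - \<omega> i j = s1 *\<^sub>R dir \<sigma> ((b j + b (j + 1)) / 2 - pi / 2)"
      "r (i + 1) j = s1 * (S (i + 1) (j + 1) * C (i + 1) j)"
      using row_step[OF c(1,2)] by blast
    obtain s2 where s2: "\<omega> (i + 2) j - \<omega> (i + 1) j = s2 *\<^sub>R dir \<sigma> ((b j + b (j + 1)) / 2 - pi / 2)"
      "r (i + 1) j = s2 * (S (i + 2) j * C (i + 2) (j + 1))"
      using row_step[of "i + 1" j, unfolded int_shift] c(2,3) by blast
    have "S (i + 2) j \<noteq> 0" "C (i + 2) (j + 1) \<noteq> 0"
      using m S_pos[of "i + 2" j] C_pos[of "i + 2" "j + 1"] by simp_all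
    then have "s2 = R2 i j * s1" using s1(2) s2(2) by (simp add: R2_def field_simps)
    then show ?thesis unfolding s1(1) s2(1) \<nu>(3)[OF m] by simp
  qed
  have sh: "i - 1 + 2 = i + 1" for i :: int by simp
  show ?thesis
    using that[of \<nu>] \<nu>(1) col row[of "i - 1" "j + 1" for i j, unfolded int_shift sh] by simp
qed

end

section \<open>Confocal conics\<close>

definition line_vec :: "real^2 \<Rightarrow> real \<Rightarrow> real^3" where
  "line_vec n d = vector [n$1, n$2, - d]"

lemma line_vec_hom_pt: "line_vec n d \<bullet> hom_pt x = n \<bullet> x - d"
  by (simp add: line_vec_def hom_pt_def inner_vec_def sum_2 sum_3)

lemma normal_product_components: "normal_product u v = u$1 * v$1 + u$2 * v$2"
  by (simp add: normal_product_def circular_pts_def inner_vec_def matrix_vector_mult_def sum_3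
      if_distrib cong: if_cong)

lemma hom_pt_nonzero: "hom_pt x \<noteq> 0"
  by (simp add: hom_pt_def vec_eq_iff forall_3)

text \<open>The Binet-Cauchy identity in the plane.\<close>

lemma inner_det2_identity: "(n \<bullet> x) * (p \<bullet> y) - (n \<bullet> y) * (p \<bullet> x) = det2 n p * det2 x y"
  by (simp add: inner_real2 det2_def algebra_simps)

lemma vanishing_at_triangle:
  assumes w: "w \<bullet> hom_pt P = 0" "w \<bullet> hom_pt Q = 0" "w \<bullet> hom_pt R = 0"
    and det: "det2 (Q - P) (R - Q) \<noteq> 0"
  shows "w = 0"
proof -
  let ?x = "Q - P" and ?y = "R - Q"
  have x: "w$1 * ?x$1 + w$2 * ?x$2 = 0" and y: "w$1 * ?y$1 + w$2 * ?y$2 = 0"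
    using w by (simp_all add: hom_pt_def inner_vec_def sum_3 algebra_simps)
  have "w$1 * det2 ?x ?y = (w$1 * ?x$1 + w$2 * ?x$2) * ?y$2 - (w$1 * ?y$1 + w$2 * ?y$2) * ?x$2"
    "w$2 * det2 ?x ?y = (w$1 * ?y$1 + w$2 * ?y$2) * ?x$1 - (w$1 * ?x$1 + w$2 * ?x$2) * ?y$1"
    unfolding det2_def by (simp_all add: algebra_simps)
  then have "w$1 = 0" "w$2 = 0" using det unfolding x y by simp_all
  moreover have "w$3 = 0" using w(1) calculation by (simp add: hom_pt_def inner_vec_def sum_3)
  ultimately show ?thesis by (simp add: vec_eq_iff forall_3)
qed

lemma int_interval_shift:
  assumes "int_interval I" "int_interval J"
  shows "int_interval {k. i + k \<in> I \<and> j + k \<in> J}" "int_interval {k. i + k \<in> I \<and> j - k \<in> J}"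
proof -
  have mem: "i + k \<in> I" if "i + p \<in> I" "i + q \<in> I" "k \<in> {p..q}" for p q k
  proof -
    have "{i + p..i + q} \<subseteq> I" using assms(1) that unfolding int_interval_def by blast
    then show ?thesis using that by auto
  qed
  have mem': "j + k \<in> J" if "j + p \<in> J" "j + q \<in> J" "k \<in> {p..q}" for p q k
  proof -
    have "{j + p..j + q} \<subseteq> J" using assms(2) that unfolding int_interval_def by blast
    then show ?thesis using that by auto
  qed
  have mem'': "j - k \<in> J" if "j - p \<in> J" "j - q \<in> J" "k \<in> {p..q}" for p q k
    using mem'[of "- q" "- p" "- k"] that by simp
  show "int_interval {k. i + k \<in> I \<and> j + k \<in> J}" "int_interval {k. i + k \<in> I \<and> j - k \<in> J}"
    unfolding int_interval_def using mem mem' mem'' by blast+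
qed

text \<open>A diagonal meets the patch in an interval of its parameter, so steps across single cells
  connect any two of its vertices.\<close>

lemma diagonal_iff:
  assumes IJ: "int_interval I" "int_interval J"
    and step: "\<And>i j. (i, j) \<in> cells I J \<Longrightarrow> P i j \<longleftrightarrow> P (i + 1) (j + 1)"
    and "i \<in> I" "j \<in> J" "i' \<in> I" "j' \<in> J" "i - j = i' - j'"
  shows "P i j \<longleftrightarrow> P i' j'"
proof -
  have j': "j + (i' - i) = j'" using assms(8) by simp
  have "P (i + 0) (j + 0) \<longleftrightarrow> P (i + (i' - i)) (j + (i' - i))"
    by (rule int_interval_iff_induct[OF int_interval_shift(1)[OF IJ, of i j], of 0 "i' - i"])
      (use assms j' step in \<open>auto simp: cells_def add.assoc[symmetric]\<close>)
  then show ?thesis unfolding j' by simp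
qed

lemma antidiagonal_iff:
  assumes IJ: "int_interval I" "int_interval J"
    and step: "\<And>i j. (i, j) \<in> cells I J \<Longrightarrow> P i (j + 1) \<longleftrightarrow> P (i + 1) j"
    and "i \<in> I" "j \<in> J" "i' \<in> I" "j' \<in> J" "i + j = i' + j'"
  shows "P i j \<longleftrightarrow> P i' j'"
proof -
  have j': "j - (i' - i) = j'" using assms(8) by simp
  have "P (i + 0) (j - 0) \<longleftrightarrow> P (i + (i' - i)) (j - (i' - i))"
  proof (rule int_interval_iff_induct[OF int_interval_shift(2)[OF IJ, of i j], of 0 "i' - i"])
    fix k assume "k \<in> {k. i + k \<in> I \<and> j - k \<in> J}" "k + 1 \<in> {k. i + k \<in> I \<and> j - k \<in> J}"
    then have "(i + k, j - (k + 1)) \<in> cells I J" by (auto simp: cells_def algebra_simps)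
    from step[OF this] show "P (i + k) (j - k) \<longleftrightarrow> P (i + (k + 1)) (j - (k + 1))"
      by (simp add: algebra_simps)
  qed (use assms j' in auto)
  then show ?thesis unfolding j' by simp
qed

section \<open>Line coordinates and the linear relation of a cell\<close>

context incircular_net
begin

definition U where "U i = line_vec (dir \<sigma> (a i)) (d i)"
definition V where "V j = line_vec (dir \<sigma> (b j)) (e j)"

lemma U_hom_pt: "U i \<bullet> hom_pt x = dir \<sigma> (a i) \<bullet> x - d i"
  by (simp add: U_def line_vec_hom_pt)

lemma V_hom_pt: "V j \<bullet> hom_pt x = dir \<sigma> (b j) \<bullet> x - e j"
  by (simp add: V_def line_vec_hom_pt)

lemma normal_products:
  "normal_product (U i) (U i) = 1" "normal_product (V j) (V j) = 1"
  "1 - normal_product (U i) (V j) = 2 * (S i j)\<^sup>2" "1 + normal_product (U i) (V j) = 2 * (C i j)\<^sup>2"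
proof -
  have np: "normal_product (line_vec n x) (line_vec p y) = n \<bullet> p" for n p x y
    by (simp add: normal_product_components line_vec_def inner_real2)
  show "normal_product (U i) (U i) = 1" "normal_product (V j) (V j) = 1"
    by (simp_all add: U_def V_def np inner_dir[OF \<sigma>])
  have double: "2 * ((b j - a i) / 2) = b j - a i" by simp
  have "normal_product (U i) (V j) = cos (2 * ((b j - a i) / 2))"
    unfolding double
    using cos_minus[of "b j - a i"] by (simp add: U_def V_def np inner_dir[OF \<sigma>])
  then show "1 - normal_product (U i) (V j) = 2 * (S i j)\<^sup>2" "1 + normal_product (U i) (V j) = 2 * (C i j)\<^sup>2"
    unfolding S_def C_def by (simp_all only: cos_double_sin) (simp_all add: cos_squared_eq)
qed

lemma normal_product_bounds:
  assumes "i \<in> I" "j \<in> J"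
  shows "0 < 1 - normal_product (U i) (V j)" "0 < 1 + normal_product (U i) (V j)"
  unfolding normal_products using S_pos[OF assms] C_pos[OF assms] by simp_all

lemma U_V_independent:
  assumes "i \<in> I" "j \<in> J"
  shows "cross3 (U i) (V j) \<noteq> 0"
proof
  assume "cross3 (U i) (V j) = 0"
  then have "cross3 (U i) (V j) $ 3 = 0" by simp
  then have "det2 (dir \<sigma> (a i)) (dir \<sigma> (b j)) = 0"
    by (simp add: cross_components U_def V_def line_vec_def det2_def algebra_simps)
  moreover have "0 < sin (b j - a i)" using range[OF assms] by (simp add: sin_gt_zero)
  ultimately show False using \<sigma> by (auto simp: det2_dir)
qed

text \<open>At each vertex of the cell two of the four sides vanish, so three vertices determine the
  coefficients, with signs, up to the normalization m' = 1. Evaluation at the incenter, where the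
  sides take the values r and - r, gives the condition on the sums.\<close>

lemma cell_tangent_cell:
  assumes ij: "(i, j) \<in> cells I J"
  shows "tangent_cell (U i) (U (i + 1)) (V j) (V (j + 1))"
proof -
  have m: "i \<in> I" "i + 1 \<in> I" "j \<in> J" "j + 1 \<in> J" using ij by (auto simp: cells_def)
  let ?h = "\<lambda>i j. hom_pt (f i j)"
  have z: "U k \<bullet> ?h k l = 0" "V l \<bullet> ?h k l = 0" if "k \<in> I" "l \<in> J" for k l
    using on_lines[OF that] by (simp_all add: U_hom_pt V_hom_pt)
  define u0 u1 u2 where "u0 = - (U (i + 1) \<bullet> ?h i j)"
    and "u1 = U i \<bullet> ?h (i + 1) j" and "u2 = U i \<bullet> ?h (i + 1) (j + 1)"
  define v0 v1 v2 where "v0 = - (V (j + 1) \<bullet> ?h i j)"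
    and "v1 = - (V (j + 1) \<bullet> ?h (i + 1) j)" and "v2 = V j \<bullet> ?h (i + 1) (j + 1)"
  have pos: "0 < u0" "0 < v0" "0 < u1" "0 < v1" "0 < u2" "0 < v2"
    using side_I[OF m(1,2,3)] side_I[OF m(1,2,4)] side_J[OF m(1,3,4)] side_J[OF m(2,3,4)]
    by (simp_all add: u0_def v0_def u1_def v1_def u2_def v2_def U_hom_pt V_hom_pt)
  define l l' k where "l = v1 / u1" and "l' = v0 / u0" and "k = l * u2 / v2"
  have lpos: "0 < l" "0 < l'" "0 < k" using pos by (simp_all add: l_def l'_def k_def)
  let ?w = "l *\<^sub>R U i + 1 *\<^sub>R V (j + 1) - (l' *\<^sub>R U (i + 1) + k *\<^sub>R V j)"
  have "?w = 0"
  proof (rule vanishing_at_triangle)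
    show "?w \<bullet> ?h i j = 0"
      using pos z[OF m(1,3)] by (simp add: inner_diff_left inner_add_left l'_def u0_def v0_def)
    show "?w \<bullet> ?h (i + 1) j = 0"
      using pos z[OF m(2,3)] by (simp add: inner_diff_left inner_add_left l_def u1_def v1_def)
    show "?w \<bullet> ?h (i + 1) (j + 1) = 0"
      using pos z[OF m(2,4)] by (simp add: inner_diff_left inner_add_left k_def u2_def v2_def)
    let ?n = "dir \<sigma> (a (i + 1))" and ?p = "dir \<sigma> (b j)"
    let ?x = "f (i + 1) j - f i j" and ?y = "f (i + 1) (j + 1) - f (i + 1) j"
    have "0 < ?n \<bullet> ?x" "?n \<bullet> ?y = 0" "?p \<bullet> ?x = 0" "0 < ?p \<bullet> ?y"
      using side_I[OF m(1,2,3)] side_J[OF m(2,3,4)] on_lines[OF m(1,3)] on_lines[OF m(2,3)] on_lines[OF m(2,4)]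
      by (simp_all add: inner_diff_right)
    then have "0 < det2 ?n ?p * det2 ?x ?y" unfolding inner_det2_identity[symmetric] by simp
    then show "det2 ?x ?y \<noteq> 0" by auto
  qed
  then have eq: "l *\<^sub>R U i + 1 *\<^sub>R V (j + 1) = l' *\<^sub>R U (i + 1) + k *\<^sub>R V j" by simp
  have "(l *\<^sub>R U i + 1 *\<^sub>R V (j + 1)) \<bullet> hom_pt (\<omega> i j) = (l' *\<^sub>R U (i + 1) + k *\<^sub>R V j) \<bullet> hom_pt (\<omega> i j)"
    unfolding eq ..
  moreover have "U i \<bullet> hom_pt (\<omega> i j) = r i j" "U (i + 1) \<bullet> hom_pt (\<omega> i j) = - r i j"
    "V j \<bullet> hom_pt (\<omega> i j) = r i j" "V (j + 1) \<bullet> hom_pt (\<omega> i j) = - r i j"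
    using tangent_I[OF ij] tangent_J[OF ij] by (simp_all add: U_hom_pt V_hom_pt)
  ultimately have "(l + l') * r i j = (k + 1) * r i j"
    by (simp add: inner_add_left algebra_simps)
  then have "l + l' = k + 1" using r_pos[OF ij] by simp
  then show ?thesis unfolding tangent_cell_def using eq lpos zero_less_one by blast
qed

lemma vertex_relation_normals:
  assumes c: "(i, j) \<in> cells I J" "(i + 1, j) \<in> cells I J" "(i, j + 1) \<in> cells I J" "(i + 1, j + 1) \<in> cells I J"
  shows "(1 - normal_product (U (i + 1)) (V (j + 2))) * (1 - normal_product (U (i + 1)) (V j)) *
      ((1 + normal_product (U (i + 2)) (V (j + 1))) * (1 + normal_product (U i) (V (j + 1)))) =
    (1 + normal_product (U (i + 1)) (V (j + 2))) * (1 + normal_product (U (i + 1)) (V j)) *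
      ((1 - normal_product (U (i + 2)) (V (j + 1))) * (1 - normal_product (U i) (V (j + 1))))"
  unfolding normal_products
  \<comment> \<open>Each side has four factors of the form 2 S^2 or 2 C^2, whence 16 = 2^4.\<close>
  using arg_cong[OF vertex_relation[OF c], of "\<lambda>x. 16 * x\<^sup>2"]
  by (simp add: power_mult_distrib mult_ac)

section \<open>Extending an inscribed conic to all lines\<close>

text \<open>The backward direction is the forward one for the reversed and negated family; negation
  turns each 1 - n into 1 + n and so only exchanges the sides of \<open>star\<close>.\<close>

lemma isotropic_step:
  assumes m: "i \<in> I" "i + 1 \<in> I" "i + 2 \<in> I" "j \<in> J" "j + 1 \<in> J" "j + 2 \<in> J"
    and \<phi>: "bilinear \<phi>" "\<And>x y. \<phi> x y = \<phi> y x"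
    and V0: "\<phi> (V j) (V j) = (0::real)" "\<phi> (V (j + 1)) (V (j + 1)) = 0" "\<phi> (V (j + 2)) (V (j + 2)) = 0"
    and U1: "\<phi> (U (i + 1)) (U (i + 1)) = 0"
  shows "\<phi> (U i) (U i) = 0 \<longleftrightarrow> \<phi> (U (i + 2)) (U (i + 2)) = 0"
proof -
  have c: "(i, j) \<in> cells I J" "(i + 1, j) \<in> cells I J" "(i, j + 1) \<in> cells I J" "(i + 1, j + 1) \<in> cells I J"
    using m by (auto simp: cells_def add.assoc)
  note t = cell_tangent_cell[OF c(1)] cell_tangent_cell[OF c(3), unfolded int_shift]
    cell_tangent_cell[OF c(2), unfolded int_shift] cell_tangent_cell[OF c(4), unfolded int_shift]
  note star = vertex_relation_normals[OF c]
  let ?n = normal_product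
  note lr = bilinear_lneg bilinear_rneg
  have neg: "\<phi> (- x) (- x) = \<phi> x x" "?n (- x) y = - ?n x y" "?n y (- x) = - ?n y x" for x y
    by (simp_all add: lr[OF \<phi>(1)] lr[OF normal_product_bilinear])
  have bd: "\<bar>?n (U k) (V l)\<bar> < 1" if "k \<in> I" "l \<in> J" for k l
    using normal_product_bounds[OF that] by linarith
  show ?thesis
  proof
    assume "\<phi> (U i) (U i) = 0"
    then show "\<phi> (U (i + 2)) (U (i + 2)) = 0"
      by (intro tangent_line_extension[OF t _ _ star \<phi>]) (use m V0 U1 bd in \<open>simp_all add: normal_products(1,2)\<close>)
  next
    assume U2: "\<phi> (U (i + 2)) (U (i + 2)) = 0"
    have "\<phi> (- U i) (- U i) = 0"
      by (intro tangent_line_extension[OF tangent_cell_reverse[OF t(3)] tangent_cell_reverse[OF t(4)]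
            tangent_cell_reverse[OF t(1)] tangent_cell_reverse[OF t(2)] _ _ _ \<phi>])
        (use m V0 U1 U2 bd star in \<open>simp_all add: normal_products(1,2) neg mult_ac\<close>)
    then show "\<phi> (U i) (U i) = 0" using neg by simp
  qed
qed

text \<open>Two isotropic neighbours are needed to gain a third line, so the induction runs over
  pairs of consecutive lines.\<close>

lemma isotropic_all_U:
  assumes i: "i \<in> I" "i + 1 \<in> I" and j: "j \<in> J" "j + 1 \<in> J" "j + 2 \<in> J"
    and \<phi>: "bilinear \<phi>" "\<And>x y. \<phi> x y = \<phi> y x"
    and V0: "\<phi> (V j) (V j) = (0::real)" "\<phi> (V (j + 1)) (V (j + 1)) = 0" "\<phi> (V (j + 2)) (V (j + 2)) = 0"
    and U0: "\<phi> (U i) (U i) = 0" "\<phi> (U (i + 1)) (U (i + 1)) = 0"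
    and k: "k \<in> I"
  shows "\<phi> (U k) (U k) = 0"
proof -
  let ?K = "{k. k \<in> I \<and> k + 1 \<in> I}" and ?z = "\<lambda>k. \<phi> (U k) (U k) = 0"
  have K: "int_interval ?K"
    using int_interval_shift(1)[OF I I, of 0 1] by (simp add: add.commute)
  have all: "?z l \<and> ?z (l + 1)" if "l \<in> ?K" for l
  proof -
    have "?z i \<and> ?z (i + 1) \<longleftrightarrow> ?z l \<and> ?z (l + 1)"
    proof (rule int_interval_iff_induct[OF K _ that])
      fix m assume "m \<in> ?K" "m + 1 \<in> ?K"
      then have m: "m \<in> I" "m + 1 \<in> I" "m + 1 + 1 \<in> I" by blast+
      from isotropic_step[OF m[unfolded int_shift] j \<phi> V0]
      show "?z m \<and> ?z (m + 1) \<longleftrightarrow> ?z (m + 1) \<and> ?z (m + 1 + 1)"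
        unfolding int_shift by blast
    qed (use i in simp)
    then show ?thesis using U0 by simp
  qed
  have "k + 1 \<in> I \<or> k - 1 \<in> I"
    using int_interval_neighbour[OF I i k] .
  then show ?thesis
  proof
    assume "k + 1 \<in> I"
    then show ?thesis using all[of k] k by simp
  next
    assume "k - 1 \<in> I"
    then show ?thesis using all[of "k - 1"] k by simp
  qed
qed

text \<open>Three consecutive V and two consecutive U carry isotropy to all U; then three U and two
  V do the same for V in the transposed net.\<close>

lemma isotropic_all:
  assumes i: "i \<in> I" "i + 1 \<in> I" "i + 2 \<in> I" and j: "j \<in> J" "j + 1 \<in> J" "j + 2 \<in> J"
    and \<phi>: "bilinear \<phi>" "\<And>x y. \<phi> x y = \<phi> y x"
    and V0: "\<phi> (V j) (V j) = (0::real)" "\<phi> (V (j + 1)) (V (j + 1)) = 0" "\<phi> (V (j + 2)) (V (j + 2)) = 0"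
    and U0: "\<phi> (U i) (U i) = 0" "\<phi> (U (i + 1)) (U (i + 1)) = 0"
  shows "k \<in> I \<Longrightarrow> \<phi> (U k) (U k) = 0" "l \<in> J \<Longrightarrow> \<phi> (V l) (V l) = 0"
proof -
  show U: "\<phi> (U k) (U k) = 0" if "k \<in> I" for k
    by (rule isotropic_all_U[OF i(1,2) j \<phi> V0 U0 that])
  interpret T: incircular_net J I "\<lambda>j i. f i j" "\<lambda>j i. \<omega> i j" "- \<sigma>" "\<lambda>j. - b j" "\<lambda>i. - a i" e d "\<lambda>j i. r i j"
    by (rule transposed)
  have UV: "T.U k = V k" "T.V k = U k" for k
    by (simp_all add: T.U_def T.V_def U_def V_def dir_uminus)
  show "\<phi> (V l) (V l) = 0" if "l \<in> J"
    by (rule T.isotropic_all_U[OF j(1,2) i \<phi>, unfolded UV]) (use U i V0 that in auto)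
qed

lemma inscribed_conic:
  assumes i: "i \<in> I" "i + 2 \<in> I" and j: "j \<in> J" "j + 2 \<in> J"
  obtains B where "transpose B = B" "B \<noteq> 0"
    "\<And>k. k \<in> I \<Longrightarrow> U k \<bullet> (B *v U k) = 0" "\<And>l. l \<in> J \<Longrightarrow> V l \<bullet> (B *v V l) = 0"
proof -
  have "i + 1 \<in> {i..i + 2}" "j + 1 \<in> {j..j + 2}" by simp_all
  then have m: "i + 1 \<in> I" "j + 1 \<in> J"
    using I J i j unfolding int_interval_def by blast+
  let ?S = "set [U i, U (i + 1), V j, V (j + 1), V (j + 2)]"
  have "card ?S \<le> 5" using card_length[of "[U i, U (i + 1), V j, V (j + 1), V (j + 2)]"] by simp
  then obtain B where B: "transpose B = B" "B \<noteq> 0" and S: "\<And>u. u \<in> ?S \<Longrightarrow> u \<bullet> (B *v u) = 0"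
    using five_tangents_conic[of ?S] by blast
  note all = isotropic_all[OF i(1) m(1) i(2) j(1) m(2) j(2) bilinear_matrix[of B] symmetric_matrix_inner[OF B(1)]]
  show ?thesis
    by (rule that[OF B]) (rule all; simp add: S)+
qed

lemma hom_pt_orthogonal:
  "i \<in> I \<Longrightarrow> j \<in> J \<Longrightarrow> hom_pt (f i j) \<bullet> U i = 0" "i \<in> I \<Longrightarrow> j \<in> J \<Longrightarrow> hom_pt (f i j) \<bullet> V j = 0"
  using on_lines[of i j] by (simp_all add: inner_commute[of "hom_pt _"] U_hom_pt V_hom_pt)

lemma center_values:
  assumes "(i, j) \<in> cells I J"
  shows "U i \<bullet> hom_pt (\<omega> i j) = r i j" "U (i + 1) \<bullet> hom_pt (\<omega> i j) = - r i j"
    "V j \<bullet> hom_pt (\<omega> i j) = r i j" "V (j + 1) \<bullet> hom_pt (\<omega> i j) = - r i j"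
  using tangent_I[OF assms] tangent_J[OF assms] by (simp_all add: U_hom_pt V_hom_pt)

text \<open>The centers of a row move along the bisector of two b lines, whose mean angle exceeds
  every \<open>a k\<close> by less than pi. This decides on which side of an incenter a line outside
  its own cell lies.\<close>

lemma row_monotone:
  assumes "(i, j) \<in> cells I J" "(i + 1, j) \<in> cells I J" "k \<in> I"
  shows "U k \<bullet> hom_pt (\<omega> i j) < U k \<bullet> hom_pt (\<omega> (i + 1) j)"
proof -
  have m: "j \<in> J" "j + 1 \<in> J" using assms by (auto simp: cells_def)
  obtain s where s: "0 < s" "\<omega> (i + 1) j - \<omega> i j = s *\<^sub>R dir \<sigma> ((b j + b (j + 1)) / 2 - pi / 2)"
    using row_step[OF assms(1,2)] by blast
  let ?m = "(b j + b (j + 1)) / 2"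
  have "0 < ?m - a k" "?m - a k < pi"
    using range[OF assms(3) m(1)] range[OF assms(3) m(2)] by (simp_all add: field_simps)
  then have "0 < sin (?m - a k)" by (rule sin_gt_zero)
  moreover have "a k - (?m - pi / 2) = pi / 2 - (?m - a k)" by simp
  then have "dir \<sigma> (a k) \<bullet> dir \<sigma> (?m - pi / 2) = sin (?m - a k)"
    unfolding inner_dir[OF \<sigma>] by (simp only: cos_diff[of "pi / 2"]) simp
  ultimately have "0 < dir \<sigma> (a k) \<bullet> (\<omega> (i + 1) j - \<omega> i j)"
    unfolding s(2) using s(1) by simp
  then show ?thesis by (simp add: U_hom_pt inner_diff_right)
qed

end

section \<open>Confocal conics along the diagonals\<close>

context incircular_net
begin

lemma edge_conic_relations:
  assumes sym: "transpose B = B"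
    and iso: "\<And>k. k \<in> I \<Longrightarrow> U k \<bullet> (B *v U k) = 0" "\<And>l. l \<in> J \<Longrightarrow> V l \<bullet> (B *v V l) = 0"
    and ij: "(i, j) \<in> cells I J"
  shows "U i \<bullet> (B *v V j) * (1 - normal_product (U (i + 1)) (V (j + 1))) =
      U (i + 1) \<bullet> (B *v V (j + 1)) * (1 - normal_product (U i) (V j))"
    "U i \<bullet> (B *v V (j + 1)) * (1 + normal_product (U (i + 1)) (V j)) =
      U (i + 1) \<bullet> (B *v V j) * (1 + normal_product (U i) (V (j + 1)))"
proof -
  have m: "i \<in> I" "i + 1 \<in> I" "j \<in> J" "j + 1 \<in> J" using ij by (auto simp: cells_def)
  obtain k k' where
    "U i \<bullet> (B *v V j) * (1 - normal_product (U (i + 1)) (V (j + 1))) =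
      (U (i + 1) \<bullet> (B *v V (j + 1)) - k * (U (i + 1) \<bullet> (B *v U (i + 1)))) * (1 - normal_product (U i) (V j))"
    "U i \<bullet> (B *v V (j + 1)) * (1 + normal_product (U (i + 1)) (V j)) =
      (U (i + 1) \<bullet> (B *v V j) + k' * (U (i + 1) \<bullet> (B *v U (i + 1)))) * (1 + normal_product (U i) (V (j + 1)))"
    by (rule tangent_cell_form[OF cell_tangent_cell[OF ij] normal_products(1,1,2,2)
          bilinear_matrix[of B] symmetric_matrix_inner[OF sym] iso(1)[OF m(1)] iso(2)[OF m(3)] iso(2)[OF m(4)]])
      blast
  then show "U i \<bullet> (B *v V j) * (1 - normal_product (U (i + 1)) (V (j + 1))) =
      U (i + 1) \<bullet> (B *v V (j + 1)) * (1 - normal_product (U i) (V j))"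
    "U i \<bullet> (B *v V (j + 1)) * (1 + normal_product (U (i + 1)) (V j)) =
      U (i + 1) \<bullet> (B *v V j) * (1 + normal_product (U i) (V (j + 1)))"
    unfolding iso(1)[OF m(2)] by simp_all
qed

lemma confocal_form:
  "x \<bullet> ((B + \<tau> *\<^sub>R circular_pts) *v y) = x \<bullet> (B *v y) + \<tau> * normal_product x y"
  by (simp add: matrix_vector_mult_add_rdistrib inner_add_right normal_product_def
      scaleR_matrix_vector_assoc[symmetric])

text \<open>If \<open>B + \<tau> *\<^sub>R circular_pts\<close> were an incenter, counted doubly, then \<open>B\<close> would be the incircle of
  that cell, and the relation between two cells gives contradictory signs.\<close>

lemma center_not_double_focus:
  assumes B: "transpose B = B" "B \<noteq> 0"
    and iso: "\<And>k. k \<in> I \<Longrightarrow> U k \<bullet> (B *v U k) = 0" "\<And>l. l \<in> J \<Longrightarrow> V l \<bullet> (B *v V l) = 0"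
    and ij: "(i, j) \<in> cells I J" "i - 1 \<in> I \<or> i + 2 \<in> I"
    and rank1: "B + \<tau> *\<^sub>R circular_pts = \<epsilon> *\<^sub>R outer p p" "p = k *\<^sub>R hom_pt (\<omega> i j)"
  shows False
proof -
  define E where "E = \<epsilon> * k\<^sup>2"
  let ?X = "\<lambda>x. x \<bullet> hom_pt (\<omega> i j)" and ?n = normal_product
  \<comment> \<open>This is the tangent line equation of a circle around the incenter; the next
    facts identify its squared radius with \<open>r i j\<close> squared.\<close>
  have form: "x \<bullet> (B *v y) = E * (?X x * ?X y) - \<tau> * ?n x y" for x y
  proof -
    have "x \<bullet> ((B + \<tau> *\<^sub>R circular_pts) *v y) = E * (?X x * ?X y)"
      unfolding rank1(1)
      by (simp add: scaleR_matrix_vector_assoc[symmetric] outer_mult_vec rank1(2) E_def power2_eq_square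
          inner_commute[of "hom_pt (\<omega> i j)"])
    then show ?thesis unfolding confocal_form by simp
  qed
  have m: "i \<in> I" "i + 1 \<in> I" "j \<in> J" "j + 1 \<in> J" using ij by (auto simp: cells_def)
  note X = center_values[OF ij(1)]
  let ?r = "r i j"
  have r: "0 < ?r" by (rule r_pos[OF ij(1)])
  have \<tau>: "\<tau> = E * ?r\<^sup>2"
    using form[of "U i" "U i"] iso(1)[OF m(1)] by (simp add: normal_products X power2_eq_square)
  have E: "E \<noteq> 0"
  proof
    assume "E = 0"
    then have "x \<bullet> (B *v y) = 0" for x y using form[of x y] \<tau> by simp
    then have "B *v y = 0" for y by (metis inner_eq_zero_iff)
    then have "B = 0" by (metis matrix_eq matrix_vector_mult_0)
    then show False using B(2) by simp
  qed
  \<comment> \<open>An isotropic line has distance \<open>r i j\<close> from the incenter; only its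
    side remains to be found.\<close>
  have sq: "t = ?r \<or> t = - ?r" if "E * (t * t) - \<tau> = 0" for t
    using that E by (simp add: \<tau> power2_eq_square flip: right_diff_distrib) (simp add: square_eq_iff)
  have np: "0 < 1 - ?n (U x) (V y)" "0 < 1 + ?n (U x) (V y)" if "x \<in> I" "y \<in> J" for x y
    using normal_product_bounds[OF that] .
  have contra: False if "(- E * ?r\<^sup>2 * (1 + x)) * q = (E * ?r\<^sup>2 * q) * (1 - x)" "0 < q" for x q
  proof -
    have "2 * (E * ?r\<^sup>2 * q) = 0" using that(1) by (simp add: algebra_simps)
    then show False using E r that(2) by simp
  qed
  show False
    using ij(2)
  proof
    assume i2: "i + 2 \<in> I"
    have c: "(i + 1, j) \<in> cells I J" using m i2 by (simp add: cells_def add.assoc)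
    \<comment> \<open>The next line lies on the same side of the incenter as U (i + 1), so the
      values on it and on V (j + 1) have equal signs, whereas those on U (i + 1) and V j have
      opposite signs; the relation of the neighbouring cell then fails.\<close>
    have "?X (U (i + 2)) < U (i + 2) \<bullet> hom_pt (\<omega> (i + 1) j)" by (rule row_monotone[OF ij(1) c i2])
    also have "\<dots> < 0" using center_values(2)[OF c] r_pos[OF c] by (simp add: add.assoc)
    finally have "?X (U (i + 2)) = - ?r"
      using sq[of "?X (U (i + 2))"] form[of "U (i + 2)" "U (i + 2)"] iso(1)[OF i2] r
      by (simp add: normal_products)
    then have "(- E * ?r\<^sup>2 * (1 + ?n (U (i + 1)) (V j))) * (1 - ?n (U (i + 2)) (V (j + 1))) =
        (E * ?r\<^sup>2 * (1 - ?n (U (i + 2)) (V (j + 1)))) * (1 - ?n (U (i + 1)) (V j))"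
      using edge_conic_relations(1)[OF B(1) iso c, unfolded int_shift]
      unfolding form \<tau> X by (simp add: power2_eq_square algebra_simps)
    then show False by (rule contra) (rule np[OF i2 m(4)])
  next
    assume i1: "i - 1 \<in> I"
    have c: "(i - 1, j) \<in> cells I J" using m i1 by (simp add: cells_def)
    have "0 < U (i - 1) \<bullet> hom_pt (\<omega> (i - 1) j)" using center_values(1)[OF c] r_pos[OF c] by simp
    also have "\<dots> < ?X (U (i - 1))"
      using row_monotone[OF c _ i1, unfolded int_shift] ij(1) by simp
    finally have "?X (U (i - 1)) = ?r"
      using sq[of "?X (U (i - 1))"] form[of "U (i - 1)" "U (i - 1)"] iso(1)[OF i1] r
      by (simp add: normal_products)
    then have "(E * ?r\<^sup>2 * (1 - ?n (U (i - 1)) (V j))) * (1 - ?n (U i) (V (j + 1))) =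
        (- E * ?r\<^sup>2 * (1 + ?n (U i) (V (j + 1)))) * (1 - ?n (U (i - 1)) (V j))"
      using edge_conic_relations(1)[OF B(1) iso c, unfolded int_shift]
      unfolding form \<tau> X by (simp add: power2_eq_square algebra_simps)
    from this[symmetric] show False by (rule contra) (rule np[OF i1 m(3)])
  qed
qed

text \<open>With \<open>s = 1\<close> and \<open>s = - 1\<close> this treats the two families of bisectors. The premise
  \<open>connected\<close> says that consecutive bisectors on the diagonal \<open>W\<close> meet in an incenter; it forces
  them to coincide in the case of rank one.\<close>

lemma confocal_member:
  fixes s \<tau> :: real and W :: "(int \<times> int) set"
  assumes B: "transpose B = B" "B \<noteq> 0"
    and iso: "\<And>k. k \<in> I \<Longrightarrow> U k \<bullet> (B *v U k) = 0" "\<And>l. l \<in> J \<Longrightarrow> V l \<bullet> (B *v V l) = 0"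
    and wide: "\<And>i j. (i, j) \<in> cells I J \<Longrightarrow> i - 1 \<in> I \<or> i + 2 \<in> I"
    and i0: "i0 \<in> I" and s: "s * s = 1"
    and W: "\<And>i j. (i, j) \<in> W \<Longrightarrow> i \<in> I \<and> j \<in> J \<and>
      s * (U i \<bullet> (B *v V j)) + \<tau> * (1 + s * normal_product (U i) (V j)) = 0"
    and connected: "\<And>P i j i' j'. \<lbrakk>(i, j) \<in> W; (i', j') \<in> W;
      \<And>k l k' l' m n. \<lbrakk>(k, l) \<in> W; (k', l') \<in> W; (m, n) \<in> cells I J;
        (U k + s *\<^sub>R V l) \<bullet> hom_pt (\<omega> m n) = 0; (U k' + s *\<^sub>R V l') \<bullet> hom_pt (\<omega> m n) = 0\<rbrakk>
        \<Longrightarrow> P k l \<longleftrightarrow> P k' l'\<rbrakk> \<Longrightarrow> P i j \<longleftrightarrow> P i' j'"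
  obtains A where "is_conic (A, B + \<tau> *\<^sub>R circular_pts)"
    "\<And>i j. (i, j) \<in> W \<Longrightarrow> \<exists>\<kappa>. A *v hom_pt (f i j) = \<kappa> *\<^sub>R (U i + s *\<^sub>R V j)"
    "\<And>i j. (i, j) \<in> W \<Longrightarrow> \<exists>\<kappa>. (B + \<tau> *\<^sub>R circular_pts) *v (U i + s *\<^sub>R V j) = \<kappa> *\<^sub>R hom_pt (f i j)"
proof -
  let ?B = "B + \<tau> *\<^sub>R circular_pts"
  have sym: "transpose ?B = ?B"
    using symmetric_matrix_swap[OF B(1)] by (simp add: transpose_def vec_eq_iff circular_pts_def)
  \<comment> \<open>The line \<open>U i0\<close> is isotropic for B but has normal product 1 with
    itself, so a vanishing sum would force \<tau> = 0 and then B = 0.\<close>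
  have nz: "?B \<noteq> 0"
  proof
    assume 0: "?B = 0"
    have "\<tau> = U i0 \<bullet> (?B *v U i0)"
      unfolding confocal_form by (simp add: iso(1)[OF i0] normal_products)
    then have "\<tau> = 0" unfolding 0 by simp
    then show False using 0 B(2) by simp
  qed
  have w: "U i + s *\<^sub>R V j \<noteq> 0" if "(i, j) \<in> W" for i j
  proof
    assume "U i + s *\<^sub>R V j = 0"
    then have "U i = (- s) *\<^sub>R V j" by (simp add: eq_neg_iff_add_eq_0)
    then have "cross3 (U i) (V j) = 0" by (simp add: cross_mult_left)
    then show False using U_V_independent W[OF that] by blast
  qed
  \<comment> \<open>The image of the bisector is orthogonal to both lines through the vertex:
    isotropy of the two lines reduces both products to the equation supplied by W.\<close>
  have pole: "\<exists>\<kappa>. ?B *v (U i + s *\<^sub>R V j) = \<kappa> *\<^sub>R hom_pt (f i j)" if ij: "(i, j) \<in> W" for i j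
  proof -
    have m: "i \<in> I" "j \<in> J" and eq: "s * (U i \<bullet> (B *v V j)) + \<tau> * (1 + s * normal_product (U i) (V j)) = 0"
      using W[OF ij] by blast+
    let ?x = "?B *v (U i + s *\<^sub>R V j)"
    have lin: "y \<bullet> ?x = y \<bullet> (?B *v U i) + s * (y \<bullet> (?B *v V j))" for y
      by (simp only: matrix_vector_right_distrib matrix_vector_mult_scaleR inner_add_right inner_scaleR_right)
    have "U i \<bullet> ?x = s * (U i \<bullet> (B *v V j)) + \<tau> * (1 + s * normal_product (U i) (V j))"
      unfolding lin unfolding confocal_form iso(1)[OF m(1)] normal_products(1) by (simp add: algebra_simps)
    moreover have "V j \<bullet> ?x = (s * s) * (U i \<bullet> (B *v V j)) + \<tau> * (s + (s * s) * normal_product (U i) (V j))"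
      unfolding lin unfolding confocal_form iso(2)[OF m(2)] normal_products(2) s
        symmetric_matrix_inner[OF B(1), of "V j" "U i"] normal_product_commute[of "V j" "U i"]
      by (simp add: algebra_simps)
    then have "V j \<bullet> ?x = s * (s * (U i \<bullet> (B *v V j)) + \<tau> * (1 + s * normal_product (U i) (V j)))"
      by (simp add: algebra_simps)
    ultimately have "?x \<bullet> U i = 0" "?x \<bullet> V j = 0" unfolding eq by (simp_all add: inner_commute)
    then show ?thesis
      using common_orthogonal_parallel[OF U_V_independent[OF m] _ _ hom_pt_orthogonal(1)[OF m]
          hom_pt_orthogonal(2)[OF m] hom_pt_nonzero] by blast
  qed
  let ?F = "(\<lambda>(i, j). (U i + s *\<^sub>R V j, hom_pt (f i j))) ` W"
  obtain A where A: "is_conic (A, ?B)" "\<And>u x. (u, x) \<in> ?F \<Longrightarrow> \<exists>\<kappa>. A *v x = \<kappa> *\<^sub>R u"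
  proof (rule conic_with_tangents[OF sym nz, of ?F])
    fix u x assume "(u, x) \<in> ?F"
    then obtain i j where ij: "(i, j) \<in> W" and u: "u = U i + s *\<^sub>R V j" and x: "x = hom_pt (f i j)" by auto
    have "i \<in> I" "j \<in> J" using W[OF ij] by blast+
    then have "u \<bullet> x = 0"
      using hom_pt_orthogonal unfolding u x by (simp add: inner_commute[of _ "hom_pt _"] inner_add_right)
    then show "u \<noteq> 0 \<and> u \<bullet> x = 0 \<and> (\<exists>\<kappa>. ?B *v u = \<kappa> *\<^sub>R x)"
      using w[OF ij] pole[OF ij] unfolding u x by blast
  next
    fix \<epsilon> p u x u' x'
    assume rank1: "?B = \<epsilon> *\<^sub>R outer p p" "p \<noteq> 0" and thru: "\<And>u x. (u, x) \<in> ?F \<Longrightarrow> u \<bullet> p = 0"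
      and "(u, x) \<in> ?F" "(u', x') \<in> ?F"
    then obtain i j i' j' where ij: "(i, j) \<in> W" "(i', j') \<in> W"
      and u: "u = U i + s *\<^sub>R V j" "u' = U i' + s *\<^sub>R V j'" by auto
    have "cross3 u (U i + s *\<^sub>R V j) = 0 \<longleftrightarrow> cross3 u (U i' + s *\<^sub>R V j') = 0"
    proof (rule connected[OF ij, where P = "\<lambda>i j. cross3 u (U i + s *\<^sub>R V j) = 0"])
      fix k l k' l' m n
      assume kl: "(k, l) \<in> W" "(k', l') \<in> W" and mn: "(m, n) \<in> cells I J"
        and orth: "(U k + s *\<^sub>R V l) \<bullet> hom_pt (\<omega> m n) = 0" "(U k' + s *\<^sub>R V l') \<bullet> hom_pt (\<omega> m n) = 0"
      \<comment> \<open>Both bisectors pass through the incenter and through p. As these points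
        differ, the two bisectors are the same line.\<close>
      have "cross3 (hom_pt (\<omega> m n)) p \<noteq> 0"
      proof
        assume "cross3 (hom_pt (\<omega> m n)) p = 0"
        then obtain k where "p = k *\<^sub>R hom_pt (\<omega> m n)"
          unfolding cross_eq_0 by (metis collinear_lemma hom_pt_nonzero scaleR_zero_left)
        then show False
          using center_not_double_focus[OF B iso mn wide[OF mn] rank1(1)] by blast
      qed
      moreover have "(U k + s *\<^sub>R V l) \<bullet> p = 0" "(U k' + s *\<^sub>R V l') \<bullet> p = 0"
        using thru kl by force+
      ultimately obtain \<kappa> where \<kappa>: "U k + s *\<^sub>R V l = \<kappa> *\<^sub>R (U k' + s *\<^sub>R V l')"
        using common_orthogonal_parallel orth w[OF kl(2)] by metis
      then have "\<kappa> \<noteq> 0" using w[OF kl(1)] by auto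
      then show "cross3 u (U k + s *\<^sub>R V l) = 0 \<longleftrightarrow> cross3 u (U k' + s *\<^sub>R V l') = 0"
        unfolding \<kappa> by (simp add: cross_mult_right)
    qed
    then have "cross3 u u' = 0" unfolding u by simp
    moreover have "u \<noteq> 0" using w[OF ij(1)] u by simp
    ultimately show "\<exists>c. u' = c *\<^sub>R u"
      unfolding cross_eq_0 by (metis collinear_lemma scaleR_zero_left)
  qed blast
  show ?thesis
  proof (rule that[OF A(1) _ pole])
    fix i j assume "(i, j) \<in> W"
    then have "(U i + s *\<^sub>R V j, hom_pt (f i j)) \<in> ?F" by force
    then show "\<exists>\<kappa>. A *v hom_pt (f i j) = \<kappa> *\<^sub>R (U i + s *\<^sub>R V j)" by (rule A(2))
  qed
qed

text \<open>The value of \<tau> is the one that makes U i + V j isotropic, and the second relation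
  of \<open>edge_conic_relations\<close> keeps it along the antidiagonal. Consecutive bisectors, at
  opposite vertices of a cell, meet in its incenter, where the values r and - r cancel.\<close>

lemma antidiagonal_conic:
  assumes B: "transpose B = B" "B \<noteq> 0"
    and iso: "\<And>k. k \<in> I \<Longrightarrow> U k \<bullet> (B *v U k) = 0" "\<And>l. l \<in> J \<Longrightarrow> V l \<bullet> (B *v V l) = 0"
    and wide: "\<And>i j. (i, j) \<in> cells I J \<Longrightarrow> i - 1 \<in> I \<or> i + 2 \<in> I" and i0: "i0 \<in> I"
  shows "\<exists>A \<tau>. is_conic (A, B + \<tau> *\<^sub>R circular_pts) \<and> (\<forall>i\<in>I. \<forall>j\<in>J. i + j = c \<longrightarrow>
    (\<exists>\<kappa>. A *v hom_pt (f i j) = \<kappa> *\<^sub>R (U i + V j)) \<and>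
    (\<exists>\<kappa>. (B + \<tau> *\<^sub>R circular_pts) *v (U i + V j) = \<kappa> *\<^sub>R hom_pt (f i j)))"
proof -
  let ?W = "{(i, j). i \<in> I \<and> j \<in> J \<and> i + j = c}"
  let ?n = "\<lambda>i j. normal_product (U i) (V j)" and ?\<beta> = "\<lambda>i j. U i \<bullet> (B *v V j)"
  obtain \<tau> where \<tau>: "\<And>i j. (i, j) \<in> ?W \<Longrightarrow> ?\<beta> i j = - \<tau> * (1 + ?n i j)"
  proof (cases "?W = {}")
    case False
    then obtain k l where kl: "k \<in> I" "l \<in> J" "k + l = c" by auto
    define \<tau> where "\<tau> = - ?\<beta> k l / (1 + ?n k l)"
    have kl\<tau>: "?\<beta> k l = - \<tau> * (1 + ?n k l)"
      using normal_product_bounds(2)[OF kl(1,2)] by (simp add: \<tau>_def)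
    have "?\<beta> i j = - \<tau> * (1 + ?n i j)" if "(i, j) \<in> ?W" for i j
    proof -
      have "?\<beta> k l = - \<tau> * (1 + ?n k l) \<longleftrightarrow> ?\<beta> i j = - \<tau> * (1 + ?n i j)"
      proof (rule antidiagonal_iff[OF I J])
        fix i j assume ij: "(i, j) \<in> cells I J"
        then have "0 < 1 + ?n i (j + 1)" "0 < 1 + ?n (i + 1) j"
          by (auto simp: cells_def intro!: normal_product_bounds)
        moreover have "x = t * q \<longleftrightarrow> y = t * p"
          if "x * p = y * q" "0 < q" "0 < p" for x y t p q :: real
          using that by (auto simp: mult_ac)
        ultimately show "?\<beta> i (j + 1) = - \<tau> * (1 + ?n i (j + 1)) \<longleftrightarrow> ?\<beta> (i + 1) j = - \<tau> * (1 + ?n (i + 1) j)"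
          using edge_conic_relations(2)[OF B(1) iso ij] by blast
      qed (use that kl in auto)
      then show ?thesis using kl\<tau> by simp
    qed
    then show ?thesis using that by blast
  qed (use that in blast)
  obtain A where "is_conic (A, B + \<tau> *\<^sub>R circular_pts)"
    "\<And>i j. (i, j) \<in> ?W \<Longrightarrow> \<exists>\<kappa>. A *v hom_pt (f i j) = \<kappa> *\<^sub>R (U i + 1 *\<^sub>R V j)"
    "\<And>i j. (i, j) \<in> ?W \<Longrightarrow> \<exists>\<kappa>. (B + \<tau> *\<^sub>R circular_pts) *v (U i + 1 *\<^sub>R V j) = \<kappa> *\<^sub>R hom_pt (f i j)"
  proof (rule confocal_member[OF B iso wide i0, where W = ?W and s = 1 and \<tau> = \<tau>])
    fix P i j i' j'
    assume ij: "(i, j) \<in> ?W" "(i', j') \<in> ?W"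
      and step: "\<And>k l k' l' m n. \<lbrakk>(k, l) \<in> ?W; (k', l') \<in> ?W; (m, n) \<in> cells I J;
        (U k + 1 *\<^sub>R V l) \<bullet> hom_pt (\<omega> m n) = 0; (U k' + 1 *\<^sub>R V l') \<bullet> hom_pt (\<omega> m n) = 0\<rbrakk>
        \<Longrightarrow> P k l \<longleftrightarrow> P k' l'"
    \<comment> \<open>The guard makes the step trivial on cells away from this antidiagonal, since
      the induction asks for a step on every cell.\<close>
    have "(i + j = c \<longrightarrow> P i j) \<longleftrightarrow> (i' + j' = c \<longrightarrow> P i' j')"
    proof (rule antidiagonal_iff[OF I J])
      fix m n assume mn: "(m, n) \<in> cells I J"
      have "P m (n + 1) \<longleftrightarrow> P (m + 1) n" if "m + (n + 1) = c"
        using mn that center_values[OF mn]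
        by (intro step[of m "n + 1" "m + 1" n m n]) (auto simp: cells_def inner_add_left)
      then show "(m + (n + 1) = c \<longrightarrow> P m (n + 1)) \<longleftrightarrow> (m + 1 + n = c \<longrightarrow> P (m + 1) n)"
        by (simp add: algebra_simps)
    qed (use ij in auto)
    then show "P i j \<longleftrightarrow> P i' j'" using ij by simp
  qed (use \<tau> in auto)
  then show ?thesis by (intro exI[of _ A] exI[of _ \<tau>]) simp
qed

lemma diagonal_conic:
  assumes B: "transpose B = B" "B \<noteq> 0"
    and iso: "\<And>k. k \<in> I \<Longrightarrow> U k \<bullet> (B *v U k) = 0" "\<And>l. l \<in> J \<Longrightarrow> V l \<bullet> (B *v V l) = 0"
    and wide: "\<And>i j. (i, j) \<in> cells I J \<Longrightarrow> i - 1 \<in> I \<or> i + 2 \<in> I" and i0: "i0 \<in> I"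
  shows "\<exists>A \<tau>. is_conic (A, B + \<tau> *\<^sub>R circular_pts) \<and> (\<forall>i\<in>I. \<forall>j\<in>J. i - j = c \<longrightarrow>
    (\<exists>\<kappa>. A *v hom_pt (f i j) = \<kappa> *\<^sub>R (U i - V j)) \<and>
    (\<exists>\<kappa>. (B + \<tau> *\<^sub>R circular_pts) *v (U i - V j) = \<kappa> *\<^sub>R hom_pt (f i j)))"
proof -
  let ?W = "{(i, j). i \<in> I \<and> j \<in> J \<and> i - j = c}"
  let ?n = "\<lambda>i j. normal_product (U i) (V j)" and ?\<beta> = "\<lambda>i j. U i \<bullet> (B *v V j)"
  obtain \<tau> where \<tau>: "\<And>i j. (i, j) \<in> ?W \<Longrightarrow> ?\<beta> i j = \<tau> * (1 - ?n i j)"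
  proof (cases "?W = {}")
    case False
    then obtain k l where kl: "k \<in> I" "l \<in> J" "k - l = c" by auto
    define \<tau> where "\<tau> = ?\<beta> k l / (1 - ?n k l)"
    have kl\<tau>: "?\<beta> k l = \<tau> * (1 - ?n k l)"
      using normal_product_bounds(1)[OF kl(1,2)] by (simp add: \<tau>_def)
    have "?\<beta> i j = \<tau> * (1 - ?n i j)" if "(i, j) \<in> ?W" for i j
    proof -
      have "?\<beta> k l = \<tau> * (1 - ?n k l) \<longleftrightarrow> ?\<beta> i j = \<tau> * (1 - ?n i j)"
      proof (rule diagonal_iff[OF I J])
        fix i j assume ij: "(i, j) \<in> cells I J"
        then have "i \<in> I" "i + 1 \<in> I" "j \<in> J" "j + 1 \<in> J" by (auto simp: cells_def)
        then have "0 < 1 - ?n i j" "0 < 1 - ?n (i + 1) (j + 1)"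
          using normal_product_bounds(1) by blast+
        moreover have "x = t * q \<longleftrightarrow> y = t * p"
          if "x * p = y * q" "0 < q" "0 < p" for x y t p q :: real
          using that by (auto simp: mult_ac)
        ultimately show "?\<beta> i j = \<tau> * (1 - ?n i j) \<longleftrightarrow> ?\<beta> (i + 1) (j + 1) = \<tau> * (1 - ?n (i + 1) (j + 1))"
          using edge_conic_relations(1)[OF B(1) iso ij] by blast
      qed (use that kl in auto)
      then show ?thesis using kl\<tau> by simp
    qed
    then show ?thesis using that by blast
  qed (use that in blast)
  obtain A where "is_conic (A, B + \<tau> *\<^sub>R circular_pts)"
    "\<And>i j. (i, j) \<in> ?W \<Longrightarrow> \<exists>\<kappa>. A *v hom_pt (f i j) = \<kappa> *\<^sub>R (U i + (- 1) *\<^sub>R V j)"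
    "\<And>i j. (i, j) \<in> ?W \<Longrightarrow> \<exists>\<kappa>. (B + \<tau> *\<^sub>R circular_pts) *v (U i + (- 1) *\<^sub>R V j) = \<kappa> *\<^sub>R hom_pt (f i j)"
  proof (rule confocal_member[OF B iso wide i0, where W = ?W and s = "- 1" and \<tau> = \<tau>])
    fix P i j i' j'
    assume ij: "(i, j) \<in> ?W" "(i', j') \<in> ?W"
      and step: "\<And>k l k' l' m n. \<lbrakk>(k, l) \<in> ?W; (k', l') \<in> ?W; (m, n) \<in> cells I J;
        (U k + (- 1) *\<^sub>R V l) \<bullet> hom_pt (\<omega> m n) = 0; (U k' + (- 1) *\<^sub>R V l') \<bullet> hom_pt (\<omega> m n) = 0\<rbrakk>
        \<Longrightarrow> P k l \<longleftrightarrow> P k' l'"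
    have "(i - j = c \<longrightarrow> P i j) \<longleftrightarrow> (i' - j' = c \<longrightarrow> P i' j')"
    proof (rule diagonal_iff[OF I J])
      fix m n assume mn: "(m, n) \<in> cells I J"
      have "P m n \<longleftrightarrow> P (m + 1) (n + 1)" if "m - n = c"
        using mn that center_values[OF mn]
        by (intro step[of m n "m + 1" "n + 1" m n]) (auto simp: cells_def inner_diff_left)
      then show "(m - n = c \<longrightarrow> P m n) \<longleftrightarrow> (m + 1 - (n + 1) = c \<longrightarrow> P (m + 1) (n + 1))"
        by simp
    qed (use ij in auto)
    then show "P i j \<longleftrightarrow> P i' j'" using ij by simp
  qed (use \<tau> in auto)
  then show ?thesis by (intro exI[of _ A] exI[of _ \<tau>]) simp
qed

end

section \<open>Existence of angle coordinates and the two subnets\<close>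

lemma sin_pos_imp_range:
  assumes "0 < sin x" "- pi < x" "x < 2 * pi"
  shows "0 < x \<and> x < pi"
proof (rule ccontr)
  assume "\<not> (0 < x \<and> x < pi)"
  then consider "0 \<le> - x" "- x \<le> pi" | "0 \<le> x - pi" "x - pi \<le> pi" using assms by linarith
  then show False
  proof cases
    case 1
    then have "0 \<le> sin (- x)" by (rule sin_ge_zero)
    then show False using assms(1) by simp
  next
    case 2
    then have "0 \<le> sin (x - pi)" by (rule sin_ge_zero)
    then show False using assms(1) by (simp add: sin_diff)
  qed
qed

text \<open>The b are lifted relative to one a line and the a relative to one b line. Then
  \<open>b j - a i\<close> is a combination of three known differences, which confines it to the
  interval from - pi to 2 pi; there a positive sine leaves only 0 to pi.\<close>

lemma global_angles:
  assumes \<sigma>: "\<sigma> * \<sigma> = 1" and i0: "i0 \<in> I" and j0: "j0 \<in> J"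
    and n: "\<And>i. i \<in> I \<Longrightarrow> n i \<bullet> n i = 1" and p: "\<And>j. j \<in> J \<Longrightarrow> p j \<bullet> p j = 1"
    and det: "\<And>i j. i \<in> I \<Longrightarrow> j \<in> J \<Longrightarrow> 0 < \<sigma> * det2 (n i) (p j)"
  obtains a b :: "int \<Rightarrow> real" where "\<And>i. i \<in> I \<Longrightarrow> n i = dir \<sigma> (a i)" "\<And>j. j \<in> J \<Longrightarrow> p j = dir \<sigma> (b j)"
    "\<And>i j. i \<in> I \<Longrightarrow> j \<in> J \<Longrightarrow> 0 < b j - a i \<and> b j - a i < pi"
proof -
  obtain a0 where a0: "n i0 = dir \<sigma> a0"
    using dir_exists[OF \<sigma> n[OF i0], of 0] by auto
  have sin: "0 < sin (t - s)" if "i \<in> I" "j \<in> J" "n i = dir \<sigma> s" "p j = dir \<sigma> t" for i j s t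
  proof -
    have "\<sigma> * det2 (n i) (p j) = (\<sigma> * \<sigma>) * sin (t - s)" unfolding that(3,4) det2_dir by simp
    then show ?thesis using det[OF that(1,2)] \<sigma> by simp
  qed
  have "\<exists>t. p j = dir \<sigma> t \<and> 0 < t - a0 \<and> t - a0 < pi" if j: "j \<in> J" for j
  proof -
    obtain t where t: "0 \<le> t" "t < 2 * pi" "p j = dir \<sigma> (a0 + t)"
      using dir_exists[OF \<sigma> p[OF j]] by blast
    have "0 < sin t" using sin[OF i0 j a0 t(3)] by simp
    then have "0 < t \<and> t < pi" by (rule sin_pos_imp_range) (use t pi_gt_zero in linarith)+
    then show ?thesis using t(3) by (intro exI[of _ "a0 + t"]) simp
  qed
  then obtain b where b: "\<And>j. j \<in> J \<Longrightarrow> p j = dir \<sigma> (b j) \<and> 0 < b j - a0 \<and> b j - a0 < pi" by metis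
  have "\<exists>s. n i = dir \<sigma> s \<and> 0 < b j0 - s \<and> b j0 - s < pi" if i: "i \<in> I" for i
  proof -
    \<comment> \<open>Starting one full turn below \<open>b j0\<close> makes the difference positive
      and at most 2 pi; the end point is excluded separately.\<close>
    obtain t where t: "0 \<le> t" "t < 2 * pi" "n i = dir \<sigma> (b j0 - 2 * pi + t)"
      using dir_exists[OF \<sigma> n[OF i]] by blast
    let ?s = "b j0 - 2 * pi + t"
    have s: "0 < sin (b j0 - ?s)" by (rule sin[OF i j0 t(3)]) (use b[OF j0] in simp)
    have "b j0 - ?s \<noteq> 2 * pi"
    proof
      assume "b j0 - ?s = 2 * pi"
      then show False using s by (simp only: sin_two_pi less_irrefl)
    qed
    then have "0 < b j0 - ?s \<and> b j0 - ?s < pi"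
      by (intro sin_pos_imp_range[OF s]) (use t pi_gt_zero in auto)
    then show ?thesis using t(3) by blast
  qed
  then obtain a where a: "\<And>i. i \<in> I \<Longrightarrow> n i = dir \<sigma> (a i) \<and> 0 < b j0 - a i \<and> b j0 - a i < pi" by metis
  show ?thesis
  proof (rule that[of a b])
    show "0 < b j - a i \<and> b j - a i < pi" if ij: "i \<in> I" "j \<in> J" for i j
    proof (rule sin_pos_imp_range)
      show "0 < sin (b j - a i)" using sin[OF ij] a[OF ij(1)] b[OF ij(2)] by blast
      show "- pi < b j - a i" "b j - a i < 2 * pi"
        using a[OF ij(1)] b[OF ij(2)] b[OF j0] by linarith+
    qed
  qed (use a b in blast)+
qed

text \<open>The normals come from \<open>oriented_normal\<close>, used for each family. All their
  determinants have one common sign, which becomes \<sigma>, and \<open>global_angles\<close> then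
  supplies the angles.\<close>

lemma IC_net_incircular_net:
  assumes I: "int_interval I" and J: "int_interval J" and ic: "IC_net I J f"
    and \<omega>: "net_of_incenters I J f \<omega>" and c0: "(i0, j0) \<in> cells I J"
  obtains \<sigma> a b d e r where "incircular_net I J f \<omega> \<sigma> a b d e r"
proof -
  have m0: "i0 \<in> I" "i0 + 1 \<in> I" "j0 \<in> J" "j0 + 1 \<in> J" using c0 by (auto simp: cells_def)
  have lines: "\<And>i. i \<in> I \<Longrightarrow> on_line_in_order J (\<lambda>j. f i j)" "\<And>j. j \<in> J \<Longrightarrow> on_line_in_order I (\<lambda>i. f i j)"
    using ic unfolding IC_net_def by blast+
  have "\<exists>r. incircle (f i j) (f (i + 1) j) (f (i + 1) (j + 1)) (f i (j + 1)) (\<omega> i j) r"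
    if "(i, j) \<in> cells I J" for i j
    using \<omega> that unfolding net_of_incenters_def is_incenter_def by blast
  then obtain r where inc: "\<And>i j. (i, j) \<in> cells I J \<Longrightarrow>
      incircle (f i j) (f (i + 1) j) (f (i + 1) (j + 1)) (f i (j + 1)) (\<omega> i j) (r i j)" by metis
  then have convex: "\<And>i j. (i, j) \<in> cells I J \<Longrightarrow>
      convex_quad (f i j) (f (i + 1) j) (f (i + 1) (j + 1)) (f i (j + 1))"
    unfolding incircle_def by blast
  have "\<exists>n d. n \<bullet> n = 1 \<and> (\<forall>j\<in>J. n \<bullet> f i j = d) \<and> (\<forall>j\<in>J. i + 1 \<in> I \<longrightarrow> d < n \<bullet> f (i + 1) j)
      \<and> (\<forall>j\<in>J. i - 1 \<in> I \<longrightarrow> n \<bullet> f (i - 1) j < d)" if i: "i \<in> I" for i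
  proof -
    obtain i1 where "i1 \<in> I" "i1 = i + 1 \<or> i1 = i - 1"
      using int_interval_neighbour[OF I m0(1,2) i] by blast
    from oriented_normal[OF J m0(3,4) i this lines(1)[OF i] lines(2) convex]
    show ?thesis by metis
  qed
  then obtain n d where n: "\<And>i. i \<in> I \<Longrightarrow> n i \<bullet> n i = 1 \<and> (\<forall>j\<in>J. n i \<bullet> f i j = d i) \<and>
      (\<forall>j\<in>J. i + 1 \<in> I \<longrightarrow> d i < n i \<bullet> f (i + 1) j) \<and> (\<forall>j\<in>J. i - 1 \<in> I \<longrightarrow> n i \<bullet> f (i - 1) j < d i)"
    by metis
  have convex': "convex_quad (f i j) (f i (j + 1)) (f (i + 1) (j + 1)) (f (i + 1) j)"
    if "(j, i) \<in> cells J I" for i j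
    using that by (intro convex_quad_symmetries(1)[OF convex]) (auto simp: cells_def)
  have "\<exists>p e. p \<bullet> p = 1 \<and> (\<forall>i\<in>I. p \<bullet> f i j = e) \<and> (\<forall>i\<in>I. j + 1 \<in> J \<longrightarrow> e < p \<bullet> f i (j + 1))
      \<and> (\<forall>i\<in>I. j - 1 \<in> J \<longrightarrow> p \<bullet> f i (j - 1) < e)" if j: "j \<in> J" for j
  proof -
    obtain j1 where "j1 \<in> J" "j1 = j + 1 \<or> j1 = j - 1"
      using int_interval_neighbour[OF J m0(3,4) j] by blast
    from oriented_normal[where f = "\<lambda>j i. f i j", OF I m0(1,2) j this lines(2)[OF j] lines(1) convex']
    show ?thesis by metis
  qed
  then obtain p e where p: "\<And>j. j \<in> J \<Longrightarrow> p j \<bullet> p j = 1 \<and> (\<forall>i\<in>I. p j \<bullet> f i j = e j) \<and>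
      (\<forall>i\<in>I. j + 1 \<in> J \<longrightarrow> e j < p j \<bullet> f i (j + 1)) \<and> (\<forall>i\<in>I. j - 1 \<in> J \<longrightarrow> p j \<bullet> f i (j - 1) < e j)"
    by metis
  have sI: "d i < n i \<bullet> f (i + 1) j \<and> n (i + 1) \<bullet> f i j < d (i + 1)"
    if "i \<in> I" "i + 1 \<in> I" "j \<in> J" for i j
    using n[OF that(1)] n[OF that(2)] that by auto
  have sJ: "e j < p j \<bullet> f i (j + 1) \<and> p (j + 1) \<bullet> f i j < e (j + 1)"
    if "i \<in> I" "j \<in> J" "j + 1 \<in> J" for i j
    using p[OF that(2)] p[OF that(3)] that by auto
  have on: "n i \<bullet> f i j = d i" "p j \<bullet> f i j = e j" if "i \<in> I" "j \<in> J" for i j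
    using n[OF that(1)] p[OF that(2)] that by auto
  have det1: "q \<bullet> w = det2 m q * det2 m w" if "m \<bullet> m = 1" "m \<bullet> w = 0" for m q w
    using inner_det2_identity[of m m q w] that by simp
  \<comment> \<open>The step ?w along line i is perpendicular to \<open>n i\<close>, so its positive
    products with \<open>p j\<close> and \<open>p (j + 1)\<close> are their determinants with
    \<open>n i\<close> times one common factor.\<close>
  have stepJ: "det2 (n i) (p j) \<noteq> 0 \<and> det2 (n i) (p (j + 1)) \<noteq> 0 \<and>
      (0 < det2 (n i) (p j) \<longleftrightarrow> 0 < det2 (n i) (p (j + 1)))"
    if m: "i \<in> I" "j \<in> J" "j + 1 \<in> J" for i j
  proof -
    let ?w = "f i (j + 1) - f i j"
    have "n i \<bullet> ?w = 0" "0 < p j \<bullet> ?w" "0 < p (j + 1) \<bullet> ?w"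
      using sJ[OF m] on[OF m(1,2)] on[OF m(1,3)] by (simp_all add: inner_diff_right)
    then have "0 < det2 (n i) (p j) * det2 (n i) ?w" "0 < det2 (n i) (p (j + 1)) * det2 (n i) ?w"
      using det1[of "n i"] n[OF m(1)] by auto
    then show ?thesis by (auto simp: zero_less_mult_iff)
  qed
  have stepI: "det2 (n i) (p j) \<noteq> 0 \<and> det2 (n (i + 1)) (p j) \<noteq> 0 \<and>
      (0 < det2 (n i) (p j) \<longleftrightarrow> 0 < det2 (n (i + 1)) (p j))"
    if m: "i \<in> I" "i + 1 \<in> I" "j \<in> J" for i j
  proof -
    let ?w = "f (i + 1) j - f i j"
    have "p j \<bullet> ?w = 0" "0 < n i \<bullet> ?w" "0 < n (i + 1) \<bullet> ?w"
      using sI[OF m] on[OF m(1,3)] on[OF m(2,3)] by (simp_all add: inner_diff_right)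
    then have "0 < det2 (p j) (n i) * det2 (p j) ?w" "0 < det2 (p j) (n (i + 1)) * det2 (p j) ?w"
      using det1[of "p j"] p[OF m(3)] by auto
    moreover have "det2 (p j) (n i) = - det2 (n i) (p j)" for i by (simp add: det2_def)
    ultimately show ?thesis by (auto simp: zero_less_mult_iff mult_less_0_iff)
  qed
  define \<sigma> :: real where "\<sigma> = (if 0 < det2 (n i0) (p j0) then 1 else - 1)"
  have \<sigma>: "\<sigma> * \<sigma> = 1" by (simp add: \<sigma>_def)
  have det: "0 < \<sigma> * det2 (n i) (p j)" if ij: "i \<in> I" "j \<in> J" for i j
  proof -
    have "0 < det2 (n i0) (p j0) \<longleftrightarrow> 0 < det2 (n i0) (p j)"
      by (rule int_interval_iff_induct[OF J m0(3) ij(2)]) (use stepJ[OF m0(1)] in blast)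
    moreover have "0 < det2 (n i0) (p j) \<longleftrightarrow> 0 < det2 (n i) (p j)"
      by (rule int_interval_iff_induct[OF I m0(1) ij(1)]) (use stepI[OF _ _ ij(2)] in blast)
    moreover have "det2 (n i) (p j) \<noteq> 0"
      using int_interval_neighbour[OF I m0(1,2) ij(1)]
    proof
      assume "i + 1 \<in> I"
      then show ?thesis using stepI[of i j] ij by blast
    next
      assume "i - 1 \<in> I"
      then show ?thesis using stepI[of "i - 1" j] ij by simp
    qed
    ultimately show ?thesis by (auto simp: \<sigma>_def)
  qed
  obtain a b where a: "\<And>i. i \<in> I \<Longrightarrow> n i = dir \<sigma> (a i)" and b: "\<And>j. j \<in> J \<Longrightarrow> p j = dir \<sigma> (b j)"
    and range: "\<And>i j. i \<in> I \<Longrightarrow> j \<in> J \<Longrightarrow> 0 < b j - a i \<and> b j - a i < pi"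
    using global_angles[OF \<sigma> m0(1,3), of n p] n p det by blast
  have "incircular_net I J f \<omega> \<sigma> a b d e r"
  proof
    fix i j assume ij: "(i, j) \<in> cells I J"
    then have m: "i \<in> I" "i + 1 \<in> I" "j \<in> J" "j + 1 \<in> J" by (auto simp: cells_def)
    \<comment> \<open>The four versions put the sides on the lines i, i + 1, j, j + 1 in turn into
      the position D A; for i + 1 and j + 1 the inward normal is the negated one.\<close>
    note inc1 = inc[OF ij] and inc2 = incircle_symmetries(2)[OF inc[OF ij]]
      and inc3 = incircle_symmetries(1)[OF inc[OF ij]]
      and inc4 = incircle_symmetries(2)[OF incircle_symmetries(1)[OF inc[OF ij]]]
    note sides = sI[OF m(1,2,3)] sI[OF m(1,2,4)] sJ[OF m(1,3,4)] sJ[OF m(2,3,4)]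
    note ons = on[OF m(1,3)] on[OF m(1,4)] on[OF m(2,3)] on[OF m(2,4)]
    have ne: "f i j \<noteq> f i (j + 1)" "f (i + 1) j \<noteq> f (i + 1) (j + 1)" "f i j \<noteq> f (i + 1) j"
      "f i (j + 1) \<noteq> f (i + 1) (j + 1)"
      using sides ons by auto
    show "0 < r i j" using inc1 unfolding incircle_def by blast
    have "n i \<bullet> \<omega> i j = d i + r i j"
      by (rule incircle_distance[OF inc1]) (use n[OF m(1)] ne sides ons in auto)
    moreover have "(- n (i + 1)) \<bullet> \<omega> i j = - d (i + 1) + r i j"
      by (rule incircle_distance[OF inc2]) (use n[OF m(2)] ne sides ons in auto)
    ultimately show "dir \<sigma> (a i) \<bullet> \<omega> i j = d i + r i j \<and> dir \<sigma> (a (i + 1)) \<bullet> \<omega> i j = d (i + 1) - r i j"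
      using a[OF m(1)] a[OF m(2)] by simp
    have "p j \<bullet> \<omega> i j = e j + r i j"
      by (rule incircle_distance[OF inc3]) (use p[OF m(3)] ne sides ons in auto)
    moreover have "(- p (j + 1)) \<bullet> \<omega> i j = - e (j + 1) + r i j"
      by (rule incircle_distance[OF inc4]) (use p[OF m(4)] ne sides ons in auto)
    ultimately show "dir \<sigma> (b j) \<bullet> \<omega> i j = e j + r i j \<and> dir \<sigma> (b (j + 1)) \<bullet> \<omega> i j = e (j + 1) - r i j"
      using b[OF m(3)] b[OF m(4)] by simp
  qed (use I J \<sigma> range on sI sJ a b in auto)
  then show ?thesis using that by blast
qed

text \<open>The offset c is 0 for \<open>eta\<close> and 1 for \<open>etat\<close>, so that
  statements about a subnet are proved once for both.\<close>

lemma subnet_index: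
  fixes k l c :: int
  shows "k + 1 - l = k - l + 1" "k + 1 + l + c = k + l + c + 1"
    "k - (l + 1) = k - l - 1" "k + (l + 1) + c = k + l + c + 1"
    "k - l + 1 - 1 = k - l" "k - l - 1 + 1 = k - l" "k - 1 - l = k - l - 1" "k - 1 + l + c = k + l + c - 1"
    "k - (l - 1) = k - l + 1" "k + (l - 1) + c = k + l + c - 1"
    "k + l + c + 1 + 1 = k + l + c + 2"
  by simp_all

lemma subnet_index0:
  fixes k l :: int
  shows "k + 1 + l = k + l + 1" "k + (l + 1) = k + l + 1" "k + (l - 1) = k + l - 1" "k - 1 + l = k + l - 1"
    "k - 1 + 1 = k" "k + l + 1 + 1 = k + l + 2"
  by simp_all

context incircular_net
begin

lemma confocal_conics:
  assumes i0: "i0 \<in> I" "i0 + 2 \<in> I" and j0: "j0 \<in> J" "j0 + 2 \<in> J"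
  shows "\<exists>\<alpha> C D. diagonal_conics I J f \<alpha> C D \<and>
    (\<forall>i j. (i, j) \<in> cells I J \<and> (i + 1, j + 1) \<in> cells I J \<longrightarrow>
      edge_touches_at (\<omega> i j) (\<omega> (i + 1) (j + 1)) (f (i + 1) (j + 1)) (D (i - j))) \<and>
    (\<forall>i j. (i + 1, j) \<in> cells I J \<and> (i, j + 1) \<in> cells I J \<longrightarrow>
      edge_touches_at (\<omega> (i + 1) j) (\<omega> i (j + 1)) (f (i + 1) (j + 1)) (C (i + j + 2)))"
proof -
  obtain B where B: "transpose B = B" "B \<noteq> 0"
    and iso: "\<And>k. k \<in> I \<Longrightarrow> U k \<bullet> (B *v U k) = 0" "\<And>l. l \<in> J \<Longrightarrow> V l \<bullet> (B *v V l) = 0"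
    using inscribed_conic[OF i0 j0] by blast
  \<comment> \<open>With three consecutive lines in I every strip has a neighbouring strip, on which
    the exclusion of the double focus relies.\<close>
  have wide: "i - 1 \<in> I \<or> i + 2 \<in> I" if "(i, j) \<in> cells I J" for i j
  proof -
    have i: "i \<in> I" "i + 1 \<in> I" using that by (auto simp: cells_def)
    show ?thesis
    proof (cases "i \<le> i0")
      case True
      then have "i + 2 \<in> {i..i0 + 2}" by simp
      then show ?thesis using I i i0 unfolding int_interval_def by blast
    next
      case False
      then have "i - 1 \<in> {i0..i}" by simp
      then show ?thesis using I i i0 unfolding int_interval_def by blast
    qed
  qed
  \<comment> \<open>Only tangent lines, not points of tangency, are prescribed for \<alpha>, so the
    list of incident pairs is empty.\<close>
  obtain A0 where A0: "is_conic (A0, B)"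
    using conic_with_tangents[OF B, of "{}"] by blast
  have "\<forall>c. \<exists>Q. is_conic Q \<and> confocal (A0, B) Q \<and> (\<forall>i\<in>I. \<forall>j\<in>J. i + j = c \<longrightarrow>
      (\<exists>\<kappa>. fst Q *v hom_pt (f i j) = \<kappa> *\<^sub>R (U i + V j)) \<and> (\<exists>\<kappa>. snd Q *v (U i + V j) = \<kappa> *\<^sub>R hom_pt (f i j)))"
  proof
    fix c
    obtain A \<tau> where "is_conic (A, B + \<tau> *\<^sub>R circular_pts)" "\<forall>i\<in>I. \<forall>j\<in>J. i + j = c \<longrightarrow>
        (\<exists>\<kappa>. A *v hom_pt (f i j) = \<kappa> *\<^sub>R (U i + V j)) \<and>
        (\<exists>\<kappa>. (B + \<tau> *\<^sub>R circular_pts) *v (U i + V j) = \<kappa> *\<^sub>R hom_pt (f i j))"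
      using antidiagonal_conic[OF B iso _ i0(1), of c] wide by blast
    moreover have "confocal (A0, B) (A, B + \<tau> *\<^sub>R circular_pts)"
      unfolding confocal_def by (intro exI[of _ 1] exI[of _ \<tau>]) simp
    ultimately show "\<exists>Q. is_conic Q \<and> confocal (A0, B) Q \<and> (\<forall>i\<in>I. \<forall>j\<in>J. i + j = c \<longrightarrow>
        (\<exists>\<kappa>. fst Q *v hom_pt (f i j) = \<kappa> *\<^sub>R (U i + V j)) \<and> (\<exists>\<kappa>. snd Q *v (U i + V j) = \<kappa> *\<^sub>R hom_pt (f i j)))"
      by (intro exI[of _ "(A, B + \<tau> *\<^sub>R circular_pts)"]) simp
  qed
  then obtain C where C: "\<forall>c. is_conic (C c) \<and> confocal (A0, B) (C c) \<and> (\<forall>i\<in>I. \<forall>j\<in>J. i + j = c \<longrightarrow>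
      (\<exists>\<kappa>. fst (C c) *v hom_pt (f i j) = \<kappa> *\<^sub>R (U i + V j)) \<and> (\<exists>\<kappa>. snd (C c) *v (U i + V j) = \<kappa> *\<^sub>R hom_pt (f i j)))"
    by (rule choice[THEN exE])
  have "\<forall>c. \<exists>Q. is_conic Q \<and> confocal (A0, B) Q \<and> (\<forall>i\<in>I. \<forall>j\<in>J. i - j = c \<longrightarrow>
      (\<exists>\<kappa>. fst Q *v hom_pt (f i j) = \<kappa> *\<^sub>R (U i - V j)) \<and> (\<exists>\<kappa>. snd Q *v (U i - V j) = \<kappa> *\<^sub>R hom_pt (f i j)))"
  proof
    fix c
    obtain A \<tau> where "is_conic (A, B + \<tau> *\<^sub>R circular_pts)" "\<forall>i\<in>I. \<forall>j\<in>J. i - j = c \<longrightarrow>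
        (\<exists>\<kappa>. A *v hom_pt (f i j) = \<kappa> *\<^sub>R (U i - V j)) \<and>
        (\<exists>\<kappa>. (B + \<tau> *\<^sub>R circular_pts) *v (U i - V j) = \<kappa> *\<^sub>R hom_pt (f i j))"
      using diagonal_conic[OF B iso _ i0(1), of c] wide by blast
    moreover have "confocal (A0, B) (A, B + \<tau> *\<^sub>R circular_pts)"
      unfolding confocal_def by (intro exI[of _ 1] exI[of _ \<tau>]) simp
    ultimately show "\<exists>Q. is_conic Q \<and> confocal (A0, B) Q \<and> (\<forall>i\<in>I. \<forall>j\<in>J. i - j = c \<longrightarrow>
        (\<exists>\<kappa>. fst Q *v hom_pt (f i j) = \<kappa> *\<^sub>R (U i - V j)) \<and> (\<exists>\<kappa>. snd Q *v (U i - V j) = \<kappa> *\<^sub>R hom_pt (f i j)))"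
      by (intro exI[of _ "(A, B + \<tau> *\<^sub>R circular_pts)"]) simp
  qed
  then obtain D where D: "\<forall>c. is_conic (D c) \<and> confocal (A0, B) (D c) \<and> (\<forall>i\<in>I. \<forall>j\<in>J. i - j = c \<longrightarrow>
      (\<exists>\<kappa>. fst (D c) *v hom_pt (f i j) = \<kappa> *\<^sub>R (U i - V j)) \<and> (\<exists>\<kappa>. snd (D c) *v (U i - V j) = \<kappa> *\<^sub>R hom_pt (f i j)))"
    by (rule choice[THEN exE])
  have orth: "U i \<bullet> hom_pt (f i j) = 0" "V j \<bullet> hom_pt (f i j) = 0" if "i \<in> I" "j \<in> J" for i j
    using hom_pt_orthogonal[OF that] by (simp_all add: inner_commute)
  have nz: "U i \<noteq> 0" "V j \<noteq> 0" "U i + V j \<noteq> 0" "U i - V j \<noteq> 0" if "i \<in> I" "j \<in> J" for i j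
    using U_V_independent[OF that] by (auto simp: eq_neg_iff_add_eq_0[symmetric])
  have tanC: "tangent_at (U i + V j) (f i j) (C (i + j))" if ij: "i \<in> I" "j \<in> J" for i j
    unfolding tangent_at_def using C ij nz[OF ij] orth[OF ij] by (simp add: inner_add_left)
  have tanD: "tangent_at (U i - V j) (f i j) (D (i - j))" if ij: "i \<in> I" "j \<in> J" for i j
    unfolding tangent_at_def using D ij nz[OF ij] orth[OF ij] by (simp add: inner_diff_left)
  have on: "on_conic p Q" if tan: "tangent_at u p Q" for u p Q
  proof -
    obtain \<kappa> where "fst Q *v hom_pt p = \<kappa> *\<^sub>R u" "u \<bullet> hom_pt p = 0" using tan unfolding tangent_at_def by blast
    then show ?thesis by (simp add: on_conic_def inner_commute)
  qed
  have touch: "touches_conic (line_through P Q) (A0, B)"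
    if h: "P \<noteq> Q" "w \<bullet> hom_pt P = 0" "w \<bullet> hom_pt Q = 0" "w \<noteq> 0" "w \<bullet> (B *v w) = 0" for P Q w
  proof -
    obtain c where "line_through P Q = c *\<^sub>R w" using line_through_eq[OF h(1-4)] by blast
    then show ?thesis using h(5) by (simp add: touches_conic_def matrix_vector_mult_scaleR)
  qed
  have edge: "edge_touches_at P Q p X"
    if h: "p \<in> open_segment P Q" "w \<bullet> hom_pt P = 0" "w \<bullet> hom_pt Q = 0" "tangent_at w p X" for P Q p X w
  proof -
    have "P \<noteq> Q" using h(1) by auto
    moreover have "w \<noteq> 0" using h(4) unfolding tangent_at_def by blast
    ultimately obtain c where "c \<noteq> 0" "line_through P Q = c *\<^sub>R w" using line_through_eq h(2,3) by blast
    then show ?thesis using h(1) tangent_at_scaleR[OF h(4)] by (simp add: edge_touches_at_def)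
  qed
  have "diagonal_conics I J f (A0, B) C D"
    unfolding diagonal_conics_def
  proof (intro conjI ballI impI allI)
    fix i j assume ij: "i \<in> I" "j \<in> J"
    show "on_conic (f i j) (C (i + j))" by (rule on[OF tanC[OF ij]])
    show "on_conic (f i j) (D (i - j))" by (rule on[OF tanD[OF ij]])
    show "touches_conic (line_through (f i j) (f i (j + 1))) (A0, B)" if j1: "j + 1 \<in> J"
    proof (rule touch)
      show "f i j \<noteq> f i (j + 1)" using side_J[OF ij j1] on_lines[OF ij] by auto
    qed (use orth[OF ij] orth[OF ij(1) j1] nz[OF ij] iso(1)[OF ij(1)] in simp_all)
    show "touches_conic (line_through (f i j) (f (i + 1) j)) (A0, B)" if i1: "i + 1 \<in> I"
    proof (rule touch)
      show "f i j \<noteq> f (i + 1) j" using side_I[OF ij(1) i1 ij(2)] on_lines[OF ij] by auto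
    qed (use orth[OF ij] orth[OF i1 ij(2)] nz[OF ij] iso(2)[OF ij(2)] in simp_all)
  qed (use A0 C D in auto)
  moreover have "edge_touches_at (\<omega> i j) (\<omega> (i + 1) (j + 1)) (f (i + 1) (j + 1)) (D (i - j))"
    if c: "(i, j) \<in> cells I J" "(i + 1, j + 1) \<in> cells I J" for i j
  proof (rule edge[OF diagonal_edge(1)[OF c]])
    show "tangent_at (U (i + 1) - V (j + 1)) (f (i + 1) (j + 1)) (D (i - j))"
      using tanD[of "i + 1" "j + 1"] c by (simp add: cells_def)
  qed (use center_values[OF c(1)] center_values[OF c(2)] in \<open>simp_all add: inner_diff_left\<close>)
  moreover have "edge_touches_at (\<omega> (i + 1) j) (\<omega> i (j + 1)) (f (i + 1) (j + 1)) (C (i + j + 2))"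
    if c: "(i + 1, j) \<in> cells I J" "(i, j + 1) \<in> cells I J" for i j
  proof (rule edge[OF antidiagonal_edge(1)[OF c]])
    have m: "i + 1 \<in> I" "j + 1 \<in> J" using c by (auto simp: cells_def)
    have eq: "i + 1 + (j + 1) = i + j + 2" by simp
    show "tangent_at (U (i + 1) + V (j + 1)) (f (i + 1) (j + 1)) (C (i + j + 2))"
      using tanC[OF m] unfolding eq .
  qed (use center_values[OF c(1)] center_values[OF c(2)] in \<open>simp_all add: inner_add_left\<close>)
  ultimately show ?thesis by blast
qed

lemma subnet_circular_conical:
  assumes x: "\<And>k l. x k l = \<omega> (k - l) (k + l + c)"
    and dom: "\<And>k l. (k, l) \<in> W \<longleftrightarrow> (k - l, k + l + c) \<in> cells I J"
  shows "circular_conical W x"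
  unfolding circular_conical_def
proof (intro conjI allI impI)
  fix k l assume q: "quad_in W k l"
  have "(k - l, k + l + c) \<in> cells I J" "(k - l + 1, k + l + c + 1) \<in> cells I J"
    "(k - l - 1, k + l + c + 1) \<in> cells I J" "(k - l, k + l + c + 2) \<in> cells I J"
    using q unfolding quad_in_def insert_subset dom subnet_index by blast+
  note ang = quad_angles[OF this]
  show "angle (x k (l + 1)) (x k l) (x (k + 1) l) +
      angle (x (k + 1) l) (x (k + 1) (l + 1)) (x k (l + 1)) = pi"
    unfolding x subnet_index by (rule ang(1))
  show "angle (x k l) (x (k + 1) l) (x (k + 1) (l + 1)) +
      angle (x (k + 1) (l + 1)) (x k (l + 1)) (x k l) = pi"
    unfolding x subnet_index by (rule ang(2))
next
  fix k l assume s: "star_in W k l"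
  have "(k - l, k + l + c) \<in> cells I J" "(k - l + 1, k + l + c + 1) \<in> cells I J"
    "(k - l - 1, k + l + c + 1) \<in> cells I J" "(k - l - 1, k + l + c - 1) \<in> cells I J"
    "(k - l + 1, k + l + c - 1) \<in> cells I J"
    using s unfolding star_in_def insert_subset dom subnet_index by blast+
  note ang = star_angles[OF this]
  show "angle (x (k + 1) l) (x k l) (x k (l + 1)) +
      angle (x (k - 1) l) (x k l) (x k (l - 1)) = pi"
    unfolding x subnet_index by (rule ang(1))
  show "angle (x k (l + 1)) (x k l) (x (k - 1) l) +
      angle (x k (l - 1)) (x k l) (x (k + 1) l) = pi"
    unfolding x subnet_index by (rule ang(2))
qed

lemma subnet_quad_cells:
  assumes "(i, j) \<in> cells I J" "(i + 1, j + 1) \<in> cells I J" "(i - 1, j + 1) \<in> cells I J"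
    "(i, j + 2) \<in> cells I J"
  shows "(i, j + 1) \<in> cells I J"
  using assms by (auto simp: cells_def)

lemma subnet_koenigs:
  assumes x: "\<And>k l. x k l = \<omega> (k - l) (k + l + c)"
    and dom: "\<And>k l. (k, l) \<in> W \<longleftrightarrow> (k - l, k + l + c) \<in> cells I J"
  shows "koenigs_net W x"
proof -
  obtain \<nu> where \<nu>: "\<And>i j. 0 < \<nu> i j"
    "\<And>i j. {(i, j), (i, j + 1), (i, j + 2), (i - 1, j + 1), (i + 1, j + 1)} \<subseteq> cells I J \<Longrightarrow>
      \<nu> i j *\<^sub>R (\<omega> i (j + 2) - \<omega> i (j + 1)) = \<nu> i (j + 2) *\<^sub>R (\<omega> i (j + 1) - \<omega> i j) \<and>
      \<nu> (i - 1) (j + 1) *\<^sub>R (\<omega> (i + 1) (j + 1) - \<omega> i (j + 1)) =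
        \<nu> (i + 1) (j + 1) *\<^sub>R (\<omega> i (j + 1) - \<omega> (i - 1) (j + 1))"
    using koenigs_function by blast
  show ?thesis
    unfolding koenigs_net_def
  proof (intro exI[of _ "\<lambda>k l. \<nu> (k - l) (k + l + c)"] conjI allI impI)
    fix k l assume q: "quad_in W k l"
    have cells: "(k - l, k + l + c) \<in> cells I J" "(k - l + 1, k + l + c + 1) \<in> cells I J"
      "(k - l - 1, k + l + c + 1) \<in> cells I J" "(k - l, k + l + c + 2) \<in> cells I J"
      using q unfolding quad_in_def insert_subset dom subnet_index by blast+
    have "{(k - l, k + l + c), (k - l, k + l + c + 1), (k - l, k + l + c + 2),
        (k - l - 1, k + l + c + 1), (k - l + 1, k + l + c + 1)} \<subseteq> cells I J"
      using cells subnet_quad_cells[OF cells] by blast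
    from \<nu>(2)[OF this]
    show "x (k + 1) (l + 1) - x (k + 1) l - x k (l + 1) + x k l =
      ((\<nu> (k - (l + 1)) (k + (l + 1) + c) * \<nu> (k + 1 - (l + 1)) (k + 1 + (l + 1) + c) -
          \<nu> (k - l) (k + l + c) * \<nu> (k + 1 - l) (k + 1 + l + c)) /
        (\<nu> (k - l) (k + l + c) * (\<nu> (k + 1 - l) (k + 1 + l + c) + \<nu> (k - (l + 1)) (k + (l + 1) + c)))) *\<^sub>R
          (x (k + 1) l - x k l) +
      ((\<nu> (k + 1 - l) (k + 1 + l + c) * \<nu> (k + 1 - (l + 1)) (k + 1 + (l + 1) + c) -
          \<nu> (k - l) (k + l + c) * \<nu> (k - (l + 1)) (k + (l + 1) + c)) /
        (\<nu> (k - l) (k + l + c) * (\<nu> (k + 1 - l) (k + 1 + l + c) + \<nu> (k - (l + 1)) (k + (l + 1) + c)))) *\<^sub>R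
          (x k (l + 1) - x k l)"
      unfolding x subnet_index by (intro koenigs_equation[OF \<nu>(1) \<nu>(1) \<nu>(1) \<nu>(1)]) blast+
  qed (use \<nu>(1) in auto)
qed

lemma subnet_diagonals:
  assumes x: "\<And>k l. x k l = \<omega> (k - l) (k + l + c)"
    and dom: "\<And>k l. (k, l) \<in> W \<longleftrightarrow> (k - l, k + l + c) \<in> cells I J"
    and q: "quad_in W k l"
  shows "(k - l, k + l + c + 1) \<in> cells I J"
    "closed_segment (x k l) (x (k + 1) (l + 1)) \<inter> closed_segment (x (k + 1) l) (x k (l + 1)) =
      {\<omega> (k - l) (k + l + c + 1)}"
proof -
  have cells: "(k - l, k + l + c) \<in> cells I J" "(k - l + 1, k + l + c + 1) \<in> cells I J"
    "(k - l - 1, k + l + c + 1) \<in> cells I J" "(k - l, k + l + c + 2) \<in> cells I J"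
    using q unfolding quad_in_def insert_subset dom subnet_index by blast+
  note mid = subnet_quad_cells[OF cells]
  show "(k - l, k + l + c + 1) \<in> cells I J" by (rule mid)
  show "closed_segment (x k l) (x (k + 1) (l + 1)) \<inter> closed_segment (x (k + 1) l) (x k (l + 1)) =
      {\<omega> (k - l) (k + l + c + 1)}"
    unfolding x subnet_index by (rule diagonals_meet[OF cells(1) mid cells(4,3,2)])
qed

end

theorem theoremA1:
  fixes I J :: "int set" and f \<omega> :: "int \<Rightarrow> int \<Rightarrow> real^2"
  assumes "int_interval I" and "int_interval J"
    and "IC_net I J f"
    and "net_of_incenters I J f \<omega>"
  shows
    \<comment> \<open>(i); the guard says that the subnets have edges\<close>
    "((\<exists>i\<in>I. \<exists>j\<in>J. i + 2 \<in> I \<and> j + 2 \<in> J) \<longrightarrow>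
       (\<exists>\<alpha> C D. diagonal_conics I J f \<alpha> C D \<and>
          (\<forall>k l. (k, l) \<in> eta_dom I J \<and> (k + 1, l) \<in> eta_dom I J \<longrightarrow>
             edge_touches_at (eta \<omega> k l) (eta \<omega> (k + 1) l)
               (f (k - l + 1) (k + l + 1)) (D (- 2 * l))) \<and>
          (\<forall>k l. (k, l) \<in> eta_dom I J \<and> (k, l + 1) \<in> eta_dom I J \<longrightarrow>
             edge_touches_at (eta \<omega> k l) (eta \<omega> k (l + 1))
               (f (k - l) (k + l + 1)) (C (2 * k + 1))) \<and>
          (\<forall>k l. (k, l) \<in> etat_dom I J \<and> (k + 1, l) \<in> etat_dom I J \<longrightarrow>
             edge_touches_at (etat \<omega> k l) (etat \<omega> (k + 1) l)
               (f (k - l + 1) (k + l + 2)) (D (- 2 * l - 1))) \<and>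
          (\<forall>k l. (k, l) \<in> etat_dom I J \<and> (k, l + 1) \<in> etat_dom I J \<longrightarrow>
             edge_touches_at (etat \<omega> k l) (etat \<omega> k (l + 1))
               (f (k - l) (k + l + 2)) (C (2 * k + 2))))) \<and>
     \<comment> \<open>(ii)\<close>
     (\<forall>k l. quad_in (eta_dom I J) k l \<longrightarrow>
        (k, l) \<in> etat_dom I J \<and>
        closed_segment (eta \<omega> k l) (eta \<omega> (k + 1) (l + 1)) \<inter>
        closed_segment (eta \<omega> (k + 1) l) (eta \<omega> k (l + 1)) = {etat \<omega> k l}) \<and>
     (\<forall>k l. quad_in (etat_dom I J) k l \<longrightarrow>
        (k + 1, l + 1) \<in> eta_dom I J \<and>
        closed_segment (etat \<omega> k l) (etat \<omega> (k + 1) (l + 1)) \<inter>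
        closed_segment (etat \<omega> (k + 1) l) (etat \<omega> k (l + 1)) = {eta \<omega> (k + 1) (l + 1)}) \<and>
     \<comment> \<open>(iii)\<close>
     circular_conical (eta_dom I J) (eta \<omega>) \<and>
     circular_conical (etat_dom I J) (etat \<omega>) \<and>
     \<comment> \<open>(iv)\<close>
     (\<forall>k l. {(k, l), (k + 1, l)} \<subseteq> eta_dom I J \<and> {(k, l - 1), (k, l)} \<subseteq> etat_dom I J \<longrightarrow>
        cross_orthogonally (eta \<omega> k l) (eta \<omega> (k + 1) l) (etat \<omega> k (l - 1)) (etat \<omega> k l)) \<and>
     (\<forall>k l. {(k, l), (k, l + 1)} \<subseteq> eta_dom I J \<and> {(k - 1, l), (k, l)} \<subseteq> etat_dom I J \<longrightarrow>
        cross_orthogonally (eta \<omega> k l) (eta \<omega> k (l + 1)) (etat \<omega> (k - 1) l) (etat \<omega> k l)) \<and>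
     \<comment> \<open>(v)\<close>
     koenigs_net (eta_dom I J) (eta \<omega>) \<and>
     koenigs_net (etat_dom I J) (etat \<omega>)"
proof (cases "cells I J = {}")
  case True
  \<comment> \<open>Without a cell both subnets are empty, and the guard of (i) fails, because index
    differences of 2 within intervals enclose a cell.\<close>
  have "\<not> (\<exists>i\<in>I. \<exists>j\<in>J. i + 2 \<in> I \<and> j + 2 \<in> J)"
  proof
    assume "\<exists>i\<in>I. \<exists>j\<in>J. i + 2 \<in> I \<and> j + 2 \<in> J"
    then obtain i j where ij: "i \<in> I" "i + 2 \<in> I" "j \<in> J" "j + 2 \<in> J" by blast
    have "i + 1 \<in> {i..i + 2}" "j + 1 \<in> {j..j + 2}" by simp_all
    then have "(i, j) \<in> cells I J"
      using ij assms(1,2) unfolding int_interval_def cells_def by blast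
    then show False using True by blast
  qed
  moreover have "eta_dom I J = {}" "etat_dom I J = {}"
    using True by (auto simp: eta_dom_def etat_dom_def)
  ultimately show ?thesis
    by (auto simp: quad_in_def star_in_def circular_conical_def koenigs_net_def)
next
  case False
  then obtain i0 j0 where "(i0, j0) \<in> cells I J" by auto
  then obtain \<sigma> a b d e r where "incircular_net I J f \<omega> \<sigma> a b d e r"
    using IC_net_incircular_net[OF assms] by blast
  then interpret incircular_net I J f \<omega> \<sigma> a b d e r .
  have eta: "eta \<omega> k l = \<omega> (k - l) (k + l + 0)" "(k, l) \<in> eta_dom I J \<longleftrightarrow> (k - l, k + l + 0) \<in> cells I J" for k l
    by (simp_all add: eta_def eta_dom_def)
  have etat: "etat \<omega> k l = \<omega> (k - l) (k + l + 1)" "(k, l) \<in> etat_dom I J \<longleftrightarrow> (k - l, k + l + 1) \<in> cells I J" for k l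
    by (simp_all add: etat_def etat_dom_def)
  have part1: "\<exists>\<alpha> C D. diagonal_conics I J f \<alpha> C D \<and>
          (\<forall>k l. (k, l) \<in> eta_dom I J \<and> (k + 1, l) \<in> eta_dom I J \<longrightarrow>
             edge_touches_at (eta \<omega> k l) (eta \<omega> (k + 1) l)
               (f (k - l + 1) (k + l + 1)) (D (- 2 * l))) \<and>
          (\<forall>k l. (k, l) \<in> eta_dom I J \<and> (k, l + 1) \<in> eta_dom I J \<longrightarrow>
             edge_touches_at (eta \<omega> k l) (eta \<omega> k (l + 1))
               (f (k - l) (k + l + 1)) (C (2 * k + 1))) \<and>
          (\<forall>k l. (k, l) \<in> etat_dom I J \<and> (k + 1, l) \<in> etat_dom I J \<longrightarrow>
             edge_touches_at (etat \<omega> k l) (etat \<omega> (k + 1) l)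
               (f (k - l + 1) (k + l + 2)) (D (- 2 * l - 1))) \<and>
          (\<forall>k l. (k, l) \<in> etat_dom I J \<and> (k, l + 1) \<in> etat_dom I J \<longrightarrow>
             edge_touches_at (etat \<omega> k l) (etat \<omega> k (l + 1))
               (f (k - l) (k + l + 2)) (C (2 * k + 2)))"
    if wide: "\<exists>i\<in>I. \<exists>j\<in>J. i + 2 \<in> I \<and> j + 2 \<in> J"
  proof -
    obtain i j where ij: "i \<in> I" "i + 2 \<in> I" "j \<in> J" "j + 2 \<in> J" using wide by blast
    obtain \<alpha> C D where conics: "diagonal_conics I J f \<alpha> C D"
      and D: "\<And>i j. (i, j) \<in> cells I J \<Longrightarrow> (i + 1, j + 1) \<in> cells I J \<Longrightarrow>
        edge_touches_at (\<omega> i j) (\<omega> (i + 1) (j + 1)) (f (i + 1) (j + 1)) (D (i - j))"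
      and C: "\<And>i j. (i + 1, j) \<in> cells I J \<Longrightarrow> (i, j + 1) \<in> cells I J \<Longrightarrow>
        edge_touches_at (\<omega> (i + 1) j) (\<omega> i (j + 1)) (f (i + 1) (j + 1)) (C (i + j + 2))"
      using confocal_conics[OF ij] by blast
    \<comment> \<open>Edges of the subnets in the second direction run from (i, j) to (i - 1, j +
      1), hence the shift of the first index.\<close>
    have C': "edge_touches_at (\<omega> i j) (\<omega> (i - 1) (j + 1)) (f i (j + 1)) (C (i + j + 1))"
      if "(i, j) \<in> cells I J" "(i - 1, j + 1) \<in> cells I J" for i j
    proof -
      have eq: "i - 1 + j + 2 = i + j + 1" by simp
      show ?thesis using C[of "i - 1" j, unfolded int_shift eq] that by blast
    qed
    have idx: "k - l - (k + l) = - 2 * l" "k - l - (k + l + 1) = - 2 * l - 1"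
      "k - l + (k + l) + 1 = 2 * k + 1" "k - l + (k + l) + 2 = 2 * k + 2"
      "k - l + (k + l + 1) + 1 = 2 * k + 2" for k l :: int
      by simp_all
    have E1: "edge_touches_at (eta \<omega> k l) (eta \<omega> (k + 1) l) (f (k - l + 1) (k + l + 1)) (D (- 2 * l))"
      if "(k, l) \<in> eta_dom I J" "(k + 1, l) \<in> eta_dom I J" for k l
      using that D[of "k - l" "k + l"]
      unfolding eta etat subnet_index subnet_index0 idx int_shift add_0_right by blast
    have E2: "edge_touches_at (eta \<omega> k l) (eta \<omega> k (l + 1)) (f (k - l) (k + l + 1)) (C (2 * k + 1))"
      if "(k, l) \<in> eta_dom I J" "(k, l + 1) \<in> eta_dom I J" for k l
      using that C'[of "k - l" "k + l"]
      unfolding eta etat subnet_index subnet_index0 idx int_shift add_0_right by blast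
    have E3: "edge_touches_at (etat \<omega> k l) (etat \<omega> (k + 1) l) (f (k - l + 1) (k + l + 2)) (D (- 2 * l - 1))"
      if "(k, l) \<in> etat_dom I J" "(k + 1, l) \<in> etat_dom I J" for k l
    proof -
      have "- 2 * l - 1 = k - l - (k + l + 1)" by simp
      then show ?thesis
        using that D[of "k - l" "k + l + 1"] by (simp only: etat) (simp add: algebra_simps)
    qed
    have E4: "edge_touches_at (etat \<omega> k l) (etat \<omega> k (l + 1)) (f (k - l) (k + l + 2)) (C (2 * k + 2))"
      if "(k, l) \<in> etat_dom I J" "(k, l + 1) \<in> etat_dom I J" for k l
      using that C'[of "k - l" "k + l + 1"]
      by (simp add: etat algebra_simps)
    show ?thesis
      by (intro exI[of _ \<alpha>] exI[of _ C] exI[of _ D] conjI allI impI; (elim conjE)?)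
        (rule conics E1 E2 E3 E4; assumption)+
  qed
  have part2: "(k, l) \<in> etat_dom I J \<and>
        closed_segment (eta \<omega> k l) (eta \<omega> (k + 1) (l + 1)) \<inter>
        closed_segment (eta \<omega> (k + 1) l) (eta \<omega> k (l + 1)) = {etat \<omega> k l}"
    if "quad_in (eta_dom I J) k l" for k l
    using subnet_diagonals[of "eta \<omega>" 0 "eta_dom I J" k l, OF eta that]
    unfolding etat add_0_right by blast
  have part2': "(k + 1, l + 1) \<in> eta_dom I J \<and>
        closed_segment (etat \<omega> k l) (etat \<omega> (k + 1) (l + 1)) \<inter>
        closed_segment (etat \<omega> (k + 1) l) (etat \<omega> k (l + 1)) = {eta \<omega> (k + 1) (l + 1)}"
    if "quad_in (etat_dom I J) k l" for k l
  proof -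
    \<comment> \<open>The center of a quadrilateral of \<open>etat\<close> lies half a step further
      in both indices, which for the integer labels of \<open>eta\<close> means (k + 1, l +
      1).\<close>
    have idx: "k + 1 - (l + 1) = k - l" "k + 1 + (l + 1) + 0 = k + l + 1 + 1" by simp_all
    show ?thesis
      using subnet_diagonals[of "etat \<omega>" 1 "etat_dom I J" k l, OF etat that]
      unfolding eta[of "k + 1" "l + 1"] idx by blast
  qed
  have part4: "cross_orthogonally (eta \<omega> k l) (eta \<omega> (k + 1) l) (etat \<omega> k (l - 1)) (etat \<omega> k l)"
    if "{(k, l), (k + 1, l)} \<subseteq> eta_dom I J \<and> {(k, l - 1), (k, l)} \<subseteq> etat_dom I J" for k l
    using edges_cross_orthogonally(1)[of "k - l" "k + l"] that
    by (simp only: eta etat insert_subset) (simp add: algebra_simps)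
  have part4': "cross_orthogonally (eta \<omega> k l) (eta \<omega> k (l + 1)) (etat \<omega> (k - 1) l) (etat \<omega> k l)"
    if "{(k, l), (k, l + 1)} \<subseteq> eta_dom I J \<and> {(k - 1, l), (k, l)} \<subseteq> etat_dom I J" for k l
    using edges_cross_orthogonally(2)[of "k - l - 1" "k + l"] that
    by (simp only: eta etat insert_subset) (simp add: algebra_simps)
  show ?thesis
    by (intro conjI allI impI)
      (assumption | rule part1 part2[THEN conjunct1] part2[THEN conjunct2] part2'[THEN conjunct1]
        part2'[THEN conjunct2] part4 part4'
        subnet_circular_conical[of "eta \<omega>" 0 "eta_dom I J", OF eta]
        subnet_circular_conical[of "etat \<omega>" 1 "etat_dom I J", OF etat]
        subnet_koenigs[of "eta \<omega>" 0 "eta_dom I J", OF eta]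
        subnet_koenigs[of "etat \<omega>" 1 "etat_dom I J", OF etat])+
qed

end
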